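(* (Weyl character formula for Macdonald polynomials.) Let $n\ge1$ and let $\lambda=(\lambda_1,\ldots,\lambda_n)\in\mathbb{Z}^n$ with $\lambda_1\ge\lambda_2\ge\cdots\ge\lambda_n$. Then $$P_\lambda(q,qt)=\frac{A_{\lambda+\rho}(q,t)}{A_\rho(t)},\qquad\text{where } A_\rho(t)=\prod_{1\le i<j\le n}(x_j-tx_i),$$ $P_\lambda(q,qt)$ is the bosonic (symmetric) Macdonald polynomial $P_\lambda=P_\lambda(q,t)$ with $t$ replaced by $qt$, and $A_{\lambda+\rho}(q,t)$ is the fermionic Macdonald polynomial.
   Context: Let $q,t^{1/2}$ be independent indeterminates over $\mathbb{C}$, $t=(t^{1/2})^2$, $K=\mathbb{C}(q,t^{1/2})$, $K[X]=K[x_1^{\pm1},\ldots,x_n^{\pm1}]$. $S_n$ acts on $K[X]$ by permuting variables and on $\mathbb{Z}^n$ by permuting positions, $(w\mu)_{w(i)}=\mu_i$; $s_i=(i,i+1)$; $\ell$ is the length. Put $x^\mu=x_1^{\mu_1}\cdots x_n^{\mu_n}$, $\rho=(n-1,n-2,\ldots,1,0)$, and $\partial_if=\frac{f-s_if}{x_i-x_{i+1}}$. For $\mu\in\mathbb{Z}^n$, $v_\mu\in S_n$ is the minimal length permutation such that $v_\mu\mu$ is weakly increasing; explicitly $v_\mu(r)=1+\#\{r'<r:\mu_{r'}\le\mu_r\}+\#\{r'>r:\mu_{r'}<\mu_r\}$. The electronic (nonsymmetric) Macdonald polynomials $E_\mu=E_\mu(q,t)\in K[X]$, $\mu\in\mathbb{Z}^n$,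 are determined by: (E0) $E_{(0,\ldots,0)}=1$; (E1) $E_{(\mu_n+1,\mu_1,\ldots,\mu_{n-1})}=q^{\mu_n}x_1E_\mu(x_2,\ldots,x_n,q^{-1}x_1)$; (E2) if $\mu\in\mathbb{Z}_{\ge0}^n$ and $\mu_i>\mu_{i+1}$ then $E_{s_i\mu}=\partial_i(x_iE_\mu)-tx_i\partial_iE_\mu+\frac{(1-t)a}{1-a}E_\mu$ with $a=q^{\mu_i-\mu_{i+1}}t^{v_\mu(i)-v_\mu(i+1)}$; (E3) $E_{(\mu_1-1,\ldots,\mu_n-1)}=x_1^{-1}\cdots x_n^{-1}E_\mu$. For weakly decreasing $\lambda\in\mathbb{Z}^n$, the bosonic Macdonald polynomial is $$P_\lambda=P_\lambda(q,t)=\frac1{W_\lambda(t)}\sum_{w\in S_n}w\Big(E_\lambda\prod_{i<j}\frac{x_i-tx_j}{x_i-x_j}\Big),$$ where $W_\lambda(t)$ is the constant making the coefficient of $x^\lambda$ in $P_\lambda$ equal to $1$; and the fermionic Macdonald polynomial is $$A_{\lambda+\rho}(q,t)=\Big(\prod_{i<j}\frac{x_j-tx_i}{x_i-x_j}\Big)\sum_{w\in S_n}(-1)^{\ell(w)}\,wE_{\lambda+\rho}(q,t).$$ *)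

theory Defs
  imports
    Complex_Main
    "HOL-Library.Poly_Mapping"
    "HOL-Computational_Algebra.Polynomial_Factorial"
    "HOL-Combinatorics.Permutations"
begin

text \<open>
  The ground field \<open>K = \<complex>(q, t\<^sup>1\<^sup>/\<^sup>2)\<close> is the fraction field of \<open>\<complex>[q][t\<^sup>1\<^sup>/\<^sup>2]\<close>.  The Macdonald
  polynomials are defined below for two arbitrary parameters of an arbitrary field, so that
  \<open>P\<^sub>\<lambda>(q, q t)\<close> is \<open>bosonic n q (q * t) \<lambda>\<close>.
\<close>

type_synonym K = "complex poly poly fract"

definition qK :: K where
  "qK = to_fract [:[:0, 1:]:]"

definition thalfK :: K where
  "thalfK = to_fract [:0, 1:]"

definition tK :: K where
  "tK = thalfK ^ 2"

text \<open>
  Variables carry the indices \<open>1, \<dots>, n\<close>.  A vector of \<open>\<int>\<^sup>n\<close> is a finitely supported map with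
  support in \<open>{1..n}\<close>.  Laurent polynomials, and their fractions, are taken in the variables
  \<open>x\<^sub>0, x\<^sub>1, \<dots>\<close>; those in \<open>x\<^sub>1, \<dots>, x\<^sub>n\<close> are singled out by \<open>laurent_ring n\<close>.
\<close>

type_synonym 'k laurent = "(nat \<Rightarrow>\<^sub>0 int) \<Rightarrow>\<^sub>0 'k"
type_synonym 'k ratfun = "'k laurent fract"

definition Zn :: "nat \<Rightarrow> (nat \<Rightarrow>\<^sub>0 int) set" where
  "Zn n = {\<mu>. Poly_Mapping.keys \<mu> \<subseteq> {1..n}}"

definition zvec :: "nat \<Rightarrow> (nat \<Rightarrow> int) \<Rightarrow> (nat \<Rightarrow>\<^sub>0 int)" where
  "zvec n f = (\<Sum>i\<in>{1..n}. Poly_Mapping.single i (f i))"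

definition rho :: "nat \<Rightarrow> (nat \<Rightarrow>\<^sub>0 int)" where
  "rho n = zvec n (\<lambda>i. int n - int i)"

text \<open>\<open>(w \<mu>)\<^bsub>w(i)\<^esub> = \<mu>\<^sub>i\<close>\<close>

definition perm_vec :: "nat \<Rightarrow> (nat \<Rightarrow> nat) \<Rightarrow> (nat \<Rightarrow>\<^sub>0 int) \<Rightarrow> (nat \<Rightarrow>\<^sub>0 int)" where
  "perm_vec n w \<mu> = zvec n (\<lambda>j. Poly_Mapping.lookup \<mu> (inv w j))"

definition laurent_ring :: "nat \<Rightarrow> 'k::field laurent set" where
  "laurent_ring n = {f. Poly_Mapping.keys f \<subseteq> Zn n}"

definition cst :: "'k::field \<Rightarrow> 'k ratfun" where
  "cst c = to_fract (Poly_Mapping.single 0 c)"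

definition xvar :: "nat \<Rightarrow> 'k::field ratfun" where
  "xvar i = to_fract (Poly_Mapping.single (Poly_Mapping.single i 1) 1)"

text \<open>\<open>subst_laurent g f = f(g\<^sub>1, g\<^sub>2, \<dots>)\<close>\<close>

definition subst_laurent :: "(nat \<Rightarrow> 'k::field ratfun) \<Rightarrow> 'k laurent \<Rightarrow> 'k ratfun" where
  "subst_laurent g f =
    (\<Sum>\<mu>\<in>Poly_Mapping.keys f. cst (Poly_Mapping.lookup f \<mu>) *
      (\<Prod>i\<in>Poly_Mapping.keys \<mu>. g i powi Poly_Mapping.lookup \<mu> i))"

text \<open>
  The action of a permutation \<open>w\<close> on rational functions by \<open>x\<^sub>i \<mapsto> x\<^bsub>w(i)\<^esub>\<close>.  It is computed on an
  arbitrary representation as a fraction, on which the result does not depend.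
\<close>

definition perm_act :: "(nat \<Rightarrow> nat) \<Rightarrow> 'k::field ratfun \<Rightarrow> 'k ratfun" where
  "perm_act w z = (THE u. \<forall>f g. g \<noteq> 0 \<longrightarrow> z = Fract f g \<longrightarrow>
     u = subst_laurent (\<lambda>i. xvar (w i)) f / subst_laurent (\<lambda>i. xvar (w i)) g)"

definition sref :: "nat \<Rightarrow> nat \<Rightarrow> nat" where
  "sref i = transpose i (i + 1)"

definition ddiff :: "nat \<Rightarrow> 'k::field ratfun \<Rightarrow> 'k ratfun" where
  "ddiff i f = (f - perm_act (sref i) f) / (xvar i - xvar (i + 1))"

text \<open>The permutation \<open>v\<^sub>\<mu>\<close>\<close>

definition vperm :: "nat \<Rightarrow> (nat \<Rightarrow>\<^sub>0 int) \<Rightarrow> nat \<Rightarrow> nat" where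
  "vperm n \<mu> r =
     1 + card {r' \<in> {1..n}. r' < r \<and> Poly_Mapping.lookup \<mu> r' \<le> Poly_Mapping.lookup \<mu> r}
       + card {r' \<in> {1..n}. r' > r \<and> Poly_Mapping.lookup \<mu> r' < Poly_Mapping.lookup \<mu> r}"

text \<open>
  The conjunct setting \<open>E\<close> to \<open>0\<close> outside \<open>\<int>\<^sup>n\<close> only serves to make \<open>E\<close> unique as a total function.
\<close>

definition is_electronic ::
    "nat \<Rightarrow> 'k::field \<Rightarrow> 'k \<Rightarrow> ((nat \<Rightarrow>\<^sub>0 int) \<Rightarrow> 'k laurent) \<Rightarrow> bool" where
  "is_electronic n q t E \<longleftrightarrow>
     (\<forall>\<mu>\<in>Zn n. E \<mu> \<in> laurent_ring n) \<and>
     (\<forall>\<mu>. \<mu> \<notin> Zn n \<longrightarrow> E \<mu> = 0) \<and>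
     E 0 = 1 \<and>
     (\<forall>\<mu>\<in>Zn n.
        to_fract (E (zvec n (\<lambda>i. if i = 1 then Poly_Mapping.lookup \<mu> n + 1
                                 else Poly_Mapping.lookup \<mu> (i - 1)))) =
        cst (q powi Poly_Mapping.lookup \<mu> n) * xvar 1 *
        subst_laurent (\<lambda>i. if i = n then cst (inverse q) * xvar 1 else xvar (i + 1)) (E \<mu>)) \<and>
     (\<forall>\<mu>\<in>Zn n. \<forall>i\<in>{1..<n}.
        (\<forall>j\<in>{1..n}. 0 \<le> Poly_Mapping.lookup \<mu> j) \<longrightarrow>
        Poly_Mapping.lookup \<mu> i > Poly_Mapping.lookup \<mu> (i + 1) \<longrightarrow>
        (let a = q powi (Poly_Mapping.lookup \<mu> i - Poly_Mapping.lookup \<mu> (i + 1)) *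
                 t powi (int (vperm n \<mu> i) - int (vperm n \<mu> (i + 1)))
         in to_fract (E (perm_vec n (sref i) \<mu>)) =
              ddiff i (xvar i * to_fract (E \<mu>))
              - cst t * xvar i * ddiff i (to_fract (E \<mu>))
              + cst ((1 - t) * a / (1 - a)) * to_fract (E \<mu>))) \<and>
     (\<forall>\<mu>\<in>Zn n.
        to_fract (E (\<mu> - zvec n (\<lambda>_. 1))) =
        (\<Prod>i\<in>{1..n}. inverse (xvar i)) * to_fract (E \<mu>))"

definition electronic ::
    "nat \<Rightarrow> 'k::field \<Rightarrow> 'k \<Rightarrow> (nat \<Rightarrow>\<^sub>0 int) \<Rightarrow> 'k laurent" where
  "electronic n q t = (THE E. is_electronic n q t E)"

definition index_pairs :: "nat \<Rightarrow> (nat \<times> nat) set" where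
  "index_pairs n = {(i, j). 1 \<le> i \<and> i < j \<and> j \<le> n}"

definition bosonic_sum ::
    "nat \<Rightarrow> 'k::field \<Rightarrow> 'k \<Rightarrow> (nat \<Rightarrow>\<^sub>0 int) \<Rightarrow> 'k ratfun" where
  "bosonic_sum n q t lam =
     (\<Sum>w | w permutes {1..n}.
        perm_act w (to_fract (electronic n q t lam) *
          (\<Prod>(i, j)\<in>index_pairs n. (xvar i - cst t * xvar j) / (xvar i - xvar j))))"

definition Wconst :: "nat \<Rightarrow> 'k::field \<Rightarrow> 'k \<Rightarrow> (nat \<Rightarrow>\<^sub>0 int) \<Rightarrow> 'k" where
  "Wconst n q t lam = (THE c. \<exists>p\<in>laurent_ring n.
     to_fract p = bosonic_sum n q t lam / cst c \<and> Poly_Mapping.lookup p lam = 1)"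

definition bosonic ::
    "nat \<Rightarrow> 'k::field \<Rightarrow> 'k \<Rightarrow> (nat \<Rightarrow>\<^sub>0 int) \<Rightarrow> 'k ratfun" where
  "bosonic n q t lam = bosonic_sum n q t lam / cst (Wconst n q t lam)"

text \<open>
  \<open>sign w = (-1)\<^bsup>\<ell>(w)\<^esup>\<close>, since \<open>w\<close> is a product of \<open>\<ell>(w)\<close> transpositions.
\<close>

definition fermionic ::
    "nat \<Rightarrow> 'k::field \<Rightarrow> 'k \<Rightarrow> (nat \<Rightarrow>\<^sub>0 int) \<Rightarrow> 'k ratfun" where
  "fermionic n q t \<mu> =
     (\<Prod>(i, j)\<in>index_pairs n. (xvar j - cst t * xvar i) / (xvar i - xvar j)) *
     (\<Sum>w | w permutes {1..n}. of_int (sign w) * perm_act w (to_fract (electronic n q t \<mu>)))"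

definition A_rho :: "nat \<Rightarrow> 'k::field \<Rightarrow> 'k ratfun" where
  "A_rho n t = (\<Prod>(i, j)\<in>index_pairs n. xvar j - cst t * xvar i)"

end

(*
  E_mu is a joint eigenvector of the Cherednik operators and is triangular for the Bruhat order.
  The sum C of these operators commutes with the Hecke algebra, and the bosonic and fermionic sums
  are, up to normalization, the symmetrizer and the antisymmetrizer of the Hecke algebra applied to
  E_lambda and E_{lambda + rho}; hence they are eigenvectors of C for the parameters (q, q t) and (q, t).
  On symmetric functions C acts as Macdonald's operator D_{q,t}, whereas on A_rho(t) g with g symmetric
  it acts as A_rho(t) D_{q,qt} g, up to scalars.  So both sides of the formula are eigenvectors of
  D_{q,qt}, with leading monomial x^lambda; its eigenvalues separate the leading monomials.

  The existence of the E_mu is not assumed: (E1) and (E2) are used as a recursion, and the Yang-Baxter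
  equation for the intertwiners shows that the result does not depend on the order of the steps.
*)
theory Submission
  imports Defs
begin

text \<open>The sums over S_n have rational coefficients and are not visibly built from Hecke
  operators. They are split along cosets that single out one variable at a time; the partial coset
  sums obey a three-term recursion whose steps are the two-term symmetrizers
  \<open>RR a b i\<close>. A linear space closed under these therefore contains the full sum. The
  coefficients (1, t) give the bosonic sum, (t, 1) the fermionic one, and (1, 0) the divisibility by
  the Vandermonde product. The same recursion, factored into first-order steps, evaluates
  \<open>C\<close> as Macdonald's operator.

  The shift of t to q t has one source: the rotation turns x_n into q^{-1} x_1, and the quotient of
  the rotated A_rho by A_rho cancels the numerators x_i - t x_k of the antisymmetrizer, leaving
  factors x_k - q t x_i.

  Leading terms can be compared after symmetrization because a dominant vector is minimal among its
  rearrangements for the order used here: every permutation sends the other monomials of E_lambda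
  lexicographically below x^lambda.\<close>

abbreviation lookup :: "('a \<Rightarrow>\<^sub>0 'b::zero) \<Rightarrow> 'a \<Rightarrow> 'b" where "lookup \<equiv> Poly_Mapping.lookup"
abbreviation keys :: "('a \<Rightarrow>\<^sub>0 'b::zero) \<Rightarrow> 'a set" where "keys \<equiv> Poly_Mapping.keys"
abbreviation single :: "'a \<Rightarrow> 'b \<Rightarrow> 'a \<Rightarrow>\<^sub>0 'b::zero" where "single \<equiv> Poly_Mapping.single"

section \<open>Monomials and monomial substitutions\<close>

definition xmon :: "(nat \<Rightarrow>\<^sub>0 int) \<Rightarrow> 'k::field ratfun" where
  "xmon \<nu> = to_fract (single \<nu> 1)"

lemma cst_0 [simp]: "cst 0 = 0" by (simp add: cst_def)
lemma cst_1 [simp]: "cst 1 = 1" by (simp add: cst_def)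
lemma cst_add: "cst (a + b) = cst a + cst b" by (simp add: cst_def single_add)
lemma cst_uminus: "cst (- a) = - cst a" by (simp add: cst_def single_uminus)
lemma cst_diff: "cst (a - b) = cst a - cst b" by (simp add: cst_def single_diff)
lemma cst_mult: "cst (a * b) = cst a * cst b"
  by (simp add: cst_def mult_single flip: to_fract_mult)
lemma cst_eq_iff [simp]: "cst a = cst b \<longleftrightarrow> a = b"
  by (simp add: cst_def) (metis lookup_single_eq)
lemma cst_eq_0_iff [simp]: "cst a = 0 \<longleftrightarrow> a = 0"
  using cst_eq_iff[of a 0] by simp
lemma cst_inverse: "cst (inverse a) = inverse (cst a)"
proof (cases "a = 0")
  case False
  then have "cst a * cst (inverse a) = 1" by (simp flip: cst_mult)
  then show ?thesis by (metis inverse_unique)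
qed simp
lemma cst_divide: "cst (a / b) = cst a / cst b"
  by (simp add: divide_inverse cst_mult cst_inverse)
lemma cst_power: "cst (a ^ m) = cst a ^ m" by (induction m) (simp_all add: cst_mult)
lemma cst_powi: "cst (a powi k) = cst a powi k"
  by (simp add: power_int_def cst_power cst_inverse)
lemma cst_sum: "cst (sum f A) = (\<Sum>i\<in>A. cst (f i))"
  by (induction A rule: infinite_finite_induct) (simp_all add: cst_add)
lemma cst_prod: "cst (prod f A) = (\<Prod>i\<in>A. cst (f i))"
  by (induction A rule: infinite_finite_induct) (simp_all add: cst_mult)

lemma xmon_0 [simp]: "xmon 0 = 1" by (simp add: xmon_def)
lemma xmon_add: "xmon (\<mu> + \<nu>) = xmon \<mu> * xmon \<nu>"
  by (simp add: xmon_def mult_single flip: to_fract_mult)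
lemma xmon_nonzero [simp]: "xmon \<mu> \<noteq> 0"
  by (simp add: xmon_def) (metis lookup_single_eq lookup_zero zero_neq_one)
lemma xmon_uminus: "xmon (- \<mu>) = inverse (xmon \<mu>)"
proof -
  have "xmon \<mu> * xmon (- \<mu>) = 1" by (simp flip: xmon_add)
  then show ?thesis by (metis inverse_unique)
qed
lemma xmon_sum: "xmon (sum f A) = (\<Prod>i\<in>A. xmon (f i))"
  by (induction A rule: infinite_finite_induct) (simp_all add: xmon_add)
lemma xvar_xmon: "xvar i = xmon (single i 1)" by (simp add: xvar_def xmon_def)
lemma xvar_nonzero [simp]: "xvar i \<noteq> 0" by (simp add: xvar_xmon)
lemma xmon_single: "xmon (single i k) = xvar i powi k"
proof -
  have pos: "xmon (single i (int m)) = xvar i ^ m" for m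
    by (induction m) (simp_all add: xvar_xmon xmon_add single_add)
  show ?thesis
  proof (cases "k \<ge> 0")
    case True then show ?thesis using pos[of "nat k"] by (simp add: power_int_def)
  next
    case False
    then have "single i k = - single i (int (nat (- k)))" by (simp add: single_uminus)
    then show ?thesis using pos[of "nat (-k)"] False by (simp add: power_int_def xmon_uminus power_inverse)
  qed
qed

lemma xmon_eq_iff: "(xmon \<mu> :: 'k::field ratfun) = xmon \<nu> \<longleftrightarrow> \<mu> = \<nu>"
  by (auto simp: xmon_def poly_mapping_eq_iff fun_eq_iff lookup_single when_def split: if_splits)

lemma xvar_eq_iff [simp]: "(xvar i :: 'k::field ratfun) = xvar j \<longleftrightarrow> i = j"
  unfolding xvar_xmon xmon_eq_iff by (metis lookup_single_eq lookup_single_not_eq zero_neq_one)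

lemma xvar_scaled_neq: "i \<noteq> j \<Longrightarrow> (cst c :: 'k::field ratfun) * xvar i \<noteq> cst d * xvar j" if "c \<noteq> 0"
proof
  assume "i \<noteq> j" and eq: "(cst c :: 'k ratfun) * xvar i = cst d * xvar j"
  have "single (single i (1::int)) c = single (single j 1) d"
    using eq by (simp add: cst_def xvar_def mult_single flip: to_fract_mult)
  then have "lookup (single (single i (1::int)) c) (single i (1::int)) = lookup (single (single j (1::int)) d) (single i (1::int))"
    by simp
  moreover have "single j (1::int) \<noteq> single i 1"
    using \<open>i \<noteq> j\<close> by (metis lookup_single_eq lookup_single_not_eq zero_neq_one)
  ultimately show False using that by (simp add: lookup_single)
qed

lemma poly_mapping_sum_single:
  assumes "finite A" "keys f \<subseteq> A"
  shows "f = (\<Sum>k\<in>A. single k (lookup f k))"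
proof (rule poly_mapping_eqI)
  fix k
  have "lookup (\<Sum>k\<in>A. single k (lookup f k)) k = (\<Sum>k'\<in>A. if k' = k then lookup f k' else 0)"
    by (simp add: lookup_sum lookup_single when_def)
  also have "\<dots> = lookup f k" using assms by (auto simp: in_keys_iff)
  finally show "lookup f k = lookup (\<Sum>k\<in>A. single k (lookup f k)) k" ..
qed

lemma to_fract_single: "to_fract (single \<nu> c) = cst c * xmon \<nu>"
  by (simp add: cst_def xmon_def mult_single flip: to_fract_mult)

lemma to_fract_expand: "to_fract f = (\<Sum>\<nu>\<in>keys f. cst (lookup f \<nu>) * xmon \<nu>)"
  by (subst poly_mapping_sum_single[of "keys f" f]) (simp_all add: to_fract_single)

lemma xmon_expand:
  assumes "finite A" "keys \<nu> \<subseteq> A"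
  shows "xmon \<nu> = (\<Prod>i\<in>A. xvar i powi lookup \<nu> i)"
  by (subst poly_mapping_sum_single[OF assms]) (simp add: xmon_sum xmon_single)

definition mval :: "(nat \<Rightarrow> 'k::field ratfun) \<Rightarrow> (nat \<Rightarrow>\<^sub>0 int) \<Rightarrow> 'k ratfun" where
  "mval g \<mu> = (\<Prod>i\<in>keys \<mu>. g i powi lookup \<mu> i)"

lemma mval_superset:
  assumes "finite A" "keys \<mu> \<subseteq> A"
  shows "mval g \<mu> = (\<Prod>i\<in>A. g i powi lookup \<mu> i)"
  unfolding mval_def using assms by (intro prod.mono_neutral_left) (auto simp: in_keys_iff)

lemma mval_add:
  assumes "\<And>i. g i \<noteq> 0"
  shows "mval g (\<mu> + \<nu>) = mval g \<mu> * mval g \<nu>"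
  using keys_add[of \<mu> \<nu>]
  by (simp add: mval_superset[of "keys \<mu> \<union> keys \<nu>"] lookup_add power_int_add assms prod.distrib)

lemma subst_laurent_superset:
  assumes "finite A" "keys f \<subseteq> A"
  shows "subst_laurent g f = (\<Sum>\<mu>\<in>A. cst (lookup f \<mu>) * mval g \<mu>)"
  unfolding subst_laurent_def mval_def
  using assms by (intro sum.mono_neutral_left) (auto simp: in_keys_iff)

lemma subst_laurent_add: "subst_laurent g (f + h) = subst_laurent g f + subst_laurent g h"
  using keys_add[of f h]
  by (simp add: subst_laurent_superset[of "keys f \<union> keys h"] lookup_add cst_add algebra_simps sum.distrib)

lemma subst_laurent_0 [simp]: "subst_laurent g 0 = 0"
  by (simp add: subst_laurent_def)

lemma subst_laurent_sum: "subst_laurent g (sum f A) = (\<Sum>i\<in>A. subst_laurent g (f i))"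
  by (induction A rule: infinite_finite_induct) (simp_all add: subst_laurent_add)

lemma subst_laurent_single: "subst_laurent g (single \<mu> c) = cst c * mval g \<mu>"
  by (subst subst_laurent_superset[of "{\<mu>}"]) simp_all

text \<open>Exponents may be negative, and powers of 0 with integer exponents are not additive;
  hence the condition that the values of g do not vanish.\<close>

lemma subst_laurent_mult:
  assumes "\<And>i. g i \<noteq> 0"
  shows "subst_laurent g (f * h) = subst_laurent g f * subst_laurent g h"
proof -
  let ?F = "\<Sum>\<mu>\<in>keys f. single \<mu> (lookup f \<mu>)" and ?H = "\<Sum>\<mu>\<in>keys h. single \<mu> (lookup h \<mu>)"
  have "subst_laurent g (?F * ?H) = subst_laurent g ?F * subst_laurent g ?H"
    by (simp add: sum_product mult_single subst_laurent_sum subst_laurent_single cst_mult mval_add assms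
        mult_ac)
  then show ?thesis by (simp flip: poly_mapping_sum_single)
qed

text \<open>The action on exponents for any bijection of the naturals, not tied to n. On
  \<open>Zn n\<close> it agrees with \<open>perm_vec n w\<close> when w permutes {1..n}
  (\<open>pmap_perm_vec\<close>).\<close>

definition pmap :: "(nat \<Rightarrow> nat) \<Rightarrow> (nat \<Rightarrow>\<^sub>0 int) \<Rightarrow> (nat \<Rightarrow>\<^sub>0 int)" where
  "pmap w \<mu> = Poly_Mapping.map_key (inv w) \<mu>"

lemma lookup_pmap: "bij w \<Longrightarrow> lookup (pmap w \<mu>) j = lookup \<mu> (inv w j)"
  by (simp add: pmap_def map_key.rep_eq bij_imp_bij_inv bij_is_inj)

lemma lookup_pmap': "bij w \<Longrightarrow> lookup (pmap w \<mu>) (w j) = lookup \<mu> j"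
  by (simp add: lookup_pmap bij_is_inj)

lemma pmap_inj: "bij w \<Longrightarrow> pmap w \<mu> = pmap w \<nu> \<longleftrightarrow> \<mu> = \<nu>"
  by (metis lookup_pmap' poly_mapping_eqI)

lemma keys_pmap: "bij w \<Longrightarrow> keys (pmap w \<mu>) = w ` keys \<mu>"
proof (intro equalityI subsetI)
  fix j assume w: "bij w" and "j \<in> keys (pmap w \<mu>)"
  then have "inv w j \<in> keys \<mu>" by (simp add: in_keys_iff lookup_pmap)
  then have "w (inv w j) \<in> w ` keys \<mu>" by (rule imageI)
  then show "j \<in> w ` keys \<mu>" using surj_f_inv_f[OF bij_is_surj[OF w], of j] by simp
next
  fix j assume w: "bij w" and "j \<in> w ` keys \<mu>"
  then obtain i where "j = w i" "i \<in> keys \<mu>" by blast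
  then show "j \<in> keys (pmap w \<mu>)" using w by (simp add: in_keys_iff lookup_pmap')
qed

text \<open>Monomial substitutions of this shape include the permutations, the rotation of (E1) and
  the q-shift of a single variable, and they are closed under composition. All three are therefore
  treated at once.\<close>

definition gsub :: "(nat \<Rightarrow> 'k::field) \<Rightarrow> (nat \<Rightarrow> nat) \<Rightarrow> nat \<Rightarrow> 'k ratfun" where
  "gsub c w i = cst (c i) * xvar (w i)"

definition cval :: "(nat \<Rightarrow> 'k::field) \<Rightarrow> (nat \<Rightarrow>\<^sub>0 int) \<Rightarrow> 'k" where
  "cval c \<mu> = (\<Prod>i\<in>keys \<mu>. c i powi lookup \<mu> i)"

lemma cval_superset:
  assumes "finite A" "keys \<mu> \<subseteq> A"
  shows "cval c \<mu> = (\<Prod>i\<in>A. c i powi lookup \<mu> i)"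
  unfolding cval_def using assms by (intro prod.mono_neutral_left) (auto simp: in_keys_iff)

lemma cval_1 [simp]: "cval (\<lambda>_. 1) \<mu> = 1" by (simp add: cval_def)

lemma cval_nonzero: "(\<And>i. c i \<noteq> 0) \<Longrightarrow> cval c \<mu> \<noteq> 0" by (simp add: cval_def)

lemma mval_gsub:
  fixes c :: "nat \<Rightarrow> 'k::field"
  assumes "bij w"
  shows "mval (gsub c w) \<mu> = cst (cval c \<mu>) * xmon (pmap w \<mu>)"
proof -
  have "(xmon (pmap w \<mu>) :: 'k ratfun) = (\<Prod>i\<in>w ` keys \<mu>. xvar i powi lookup (pmap w \<mu>) i)"
    by (rule xmon_expand) (simp_all add: keys_pmap assms)
  also have "\<dots> = (\<Prod>i\<in>keys \<mu>. xvar (w i) powi lookup \<mu> i)"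
    by (subst prod.reindex[OF inj_on_subset[OF bij_is_inj[OF assms] subset_UNIV]])
       (simp add: lookup_pmap' assms)
  finally show ?thesis
    by (simp add: mval_def gsub_def cval_def cst_prod cst_powi power_int_mult_distrib prod.distrib)
qed

locale monsub =
  fixes c :: "nat \<Rightarrow> 'k::field" and w :: "nat \<Rightarrow> nat"
  assumes c_nonzero: "c i \<noteq> 0" and bij_w: "bij w"
begin

text \<open>Distinct monomials go to nonzero multiples of distinct monomials, so nothing cancels.
  This lets the substitution extend to fractions.\<close>

lemma subst_nonzero:
  assumes "f \<noteq> 0" shows "subst_laurent (gsub c w) f \<noteq> 0"
proof -
  let ?h = "\<Sum>\<mu>\<in>keys f. single (pmap w \<mu>) (lookup f \<mu> * cval c \<mu>)"
  have eq: "subst_laurent (gsub c w) f = to_fract ?h"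
    by (simp add: subst_laurent_superset[of "keys f"] mval_gsub bij_w to_fract_single cst_mult mult_ac)
  from assms obtain \<mu> where \<mu>: "\<mu> \<in> keys f" by fastforce
  have "lookup ?h (pmap w \<mu>) = (\<Sum>\<nu>\<in>keys f. if \<nu> = \<mu> then lookup f \<nu> * cval c \<nu> else 0)"
    by (simp add: lookup_sum lookup_single when_def pmap_inj bij_w cong: if_cong)
  also have "\<dots> = lookup f \<mu> * cval c \<mu>" using \<mu> by simp
  also have "\<dots> \<noteq> 0" using \<mu> by (simp add: in_keys_iff cval_nonzero c_nonzero)
  finally have "?h \<noteq> 0" by fastforce
  then show ?thesis unfolding eq to_fract_eq_0_iff .
qed

end

text \<open>Shaped after \<open>perm_act\<close>, which becomes the case c = 1.\<close>

definition msub :: "(nat \<Rightarrow> 'k::field) \<Rightarrow> (nat \<Rightarrow> nat) \<Rightarrow> 'k ratfun \<Rightarrow> 'k ratfun" where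
  "msub c w z = (THE u. \<forall>f g. g \<noteq> 0 \<longrightarrow> z = Fract f g \<longrightarrow>
     u = subst_laurent (gsub c w) f / subst_laurent (gsub c w) g)"

lemma perm_act_msub: "perm_act w = msub (\<lambda>_. 1) w"
  unfolding fun_eq_iff perm_act_def msub_def by (simp add: gsub_def[abs_def])

context monsub
begin

lemma gsub_nonzero: "gsub c w i \<noteq> 0" by (simp add: gsub_def c_nonzero)

lemma msub_Fract:
  assumes "g \<noteq> 0"
  shows "msub c w (Fract f g) = subst_laurent (gsub c w) f / subst_laurent (gsub c w) g"
  unfolding msub_def
proof (rule the_equality)
  let ?S = "subst_laurent (gsub c w)"
  show "\<forall>f' g'. g' \<noteq> 0 \<longrightarrow> Fract f g = Fract f' g' \<longrightarrow> ?S f / ?S g = ?S f' / ?S g'"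
  proof (intro allI impI)
    fix f' g' :: "'k laurent" assume g': "g' \<noteq> 0" and "Fract f g = Fract f' g'"
    then have "f * g' = f' * g" using assms by (simp add: eq_fract)
    then have "?S f * ?S g' = ?S f' * ?S g"
      by (simp flip: subst_laurent_mult[of "gsub c w", OF gsub_nonzero])
    then show "?S f / ?S g = ?S f' / ?S g'"
      using subst_nonzero[OF assms] subst_nonzero[OF g'] by (simp add: field_simps)
  qed
qed (use assms in blast)

lemma subst_1: "subst_laurent (gsub c w) 1 = 1"
  using subst_laurent_single[of "gsub c w" 0 1] by (simp add: mval_def)

lemma msub_to_fract: "msub c w (to_fract f) = subst_laurent (gsub c w) f"
  using msub_Fract[of 1 f] by (simp add: subst_1 Fract_conv_to_fract)

lemma msub_frac: "g \<noteq> 0 \<Longrightarrow> msub c w (to_fract f / to_fract g) = subst_laurent (gsub c w) f / subst_laurent (gsub c w) g"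
  using msub_Fract[of g f] by (simp add: Fract_conv_to_fract)

lemma msub_0 [simp]: "msub c w 0 = 0" using msub_to_fract[of 0] by simp
lemma msub_1 [simp]: "msub c w 1 = 1" using msub_to_fract[of 1] by (simp add: subst_1)

lemma msub_add: "msub c w (y + z) = msub c w y + msub c w z"
proof (cases y; cases z)
  fix a b a' b' assume *: "y = Fract a b" "b \<noteq> 0" "z = Fract a' b'" "b' \<noteq> 0"
  then show ?thesis
    using subst_nonzero
    by (simp add: msub_Fract subst_laurent_add subst_laurent_mult gsub_nonzero divide_simps)
qed

lemma msub_mult: "msub c w (y * z) = msub c w y * msub c w z"
proof (cases y; cases z)
  fix a b a' b' assume *: "y = Fract a b" "b \<noteq> 0" "z = Fract a' b'" "b' \<noteq> 0"
  then show ?thesis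
    using subst_nonzero
    by (simp add: msub_Fract subst_laurent_add subst_laurent_mult gsub_nonzero)
qed

lemma msub_uminus: "msub c w (- y) = - msub c w y"
  using msub_add[of y "- y"] by (simp add: eq_neg_iff_add_eq_0 add.commute)
lemma msub_diff: "msub c w (y - z) = msub c w y - msub c w z"
  using msub_add[of y "- z"] by (simp add: msub_uminus)
lemma msub_inverse: "msub c w (inverse y) = inverse (msub c w y)"
proof (cases "y = 0")
  case False
  then have "msub c w y * msub c w (inverse y) = 1" by (simp flip: msub_mult)
  then show ?thesis by (metis inverse_unique)
qed simp
lemma msub_divide: "msub c w (y / z) = msub c w y / msub c w z"
  by (simp add: divide_inverse msub_mult msub_inverse)
lemma msub_power: "msub c w (y ^ m) = msub c w y ^ m" by (induction m) (simp_all add: msub_mult)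
lemma msub_powi: "msub c w (y powi k) = msub c w y powi k"
  by (simp add: power_int_def msub_power msub_inverse)
lemma msub_sum: "msub c w (sum f A) = (\<Sum>i\<in>A. msub c w (f i))"
  by (induction A rule: infinite_finite_induct) (simp_all add: msub_add)
lemma msub_prod: "msub c w (prod f A) = (\<Prod>i\<in>A. msub c w (f i))"
  by (induction A rule: infinite_finite_induct) (simp_all add: msub_mult)
lemma msub_cst [simp]: "msub c w (cst a) = cst a"
  using msub_to_fract[of "single 0 a"] by (simp add: cst_def[of a] subst_laurent_single mval_def)
lemma msub_xmon: "msub c w (xmon \<mu>) = cst (cval c \<mu>) * xmon (pmap w \<mu>)"
  using msub_to_fract[of "single \<mu> 1"] by (simp add: xmon_def[of \<mu>] subst_laurent_single mval_gsub bij_w)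
lemma msub_xvar: "msub c w (xvar i) = cst (c i) * xvar (w i)"
  using msub_to_fract[of "single (single i 1) 1"]
  by (simp add: xvar_def[of i] subst_laurent_single mval_def gsub_def)

lemmas msub_hom = msub_add msub_mult msub_uminus msub_diff msub_inverse msub_divide msub_power
  msub_powi msub_xvar

lemma msub_subst: "msub c w (subst_laurent g f) = subst_laurent (\<lambda>i. msub c w (g i)) f"
  by (simp add: subst_laurent_def msub_sum msub_mult msub_prod msub_powi)

end

text \<open>The outer coefficient is read at \<open>w' i\<close>, the variable produced by the inner
  substitution. Commutation rules among permutations, \<open>om\<close> and \<open>qshift\<close>
  thereby reduce to equalities of coefficient functions and bijections.\<close>

lemma msub_msub:
  assumes "monsub c w" "monsub c' w'"
  shows "msub c w (msub c' w' z) = msub (\<lambda>i. c' i * c (w' i)) (w \<circ> w') z"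
proof -
  interpret A: monsub c w by fact
  interpret B: monsub c' w' by fact
  interpret C: monsub "\<lambda>i. c' i * c (w' i)" "w \<circ> w'"
    by standard (use A.c_nonzero B.c_nonzero A.bij_w B.bij_w in \<open>auto intro: bij_comp\<close>)
  have g: "(\<lambda>i. msub c w (gsub c' w' i)) = gsub (\<lambda>i. c' i * c (w' i)) (w \<circ> w')"
    by (auto simp: fun_eq_iff gsub_def A.msub_hom cst_mult)
  show ?thesis
    by (cases z) (simp add: A.msub_subst B.msub_Fract C.msub_Fract A.msub_divide g)
qed

lemma monsub_perm: "bij w \<Longrightarrow> monsub (\<lambda>_. 1) w" by standard simp_all

lemma msub_id: "msub (\<lambda>_. 1) (\<lambda>x. x) z = z"
proof -
  interpret monsub "\<lambda>_. 1" "\<lambda>x. x" by (rule monsub_perm) (simp add: bij_betw_def)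
  have pm: "pmap (\<lambda>x. x) \<mu> = \<mu>" for \<mu>
    by (rule poly_mapping_eqI) (use lookup_pmap'[OF bij_w] in simp)
  have S: "subst_laurent (gsub (\<lambda>_. 1) (\<lambda>x. x)) f = to_fract f" for f :: "'a laurent"
    by (simp add: to_fract_expand subst_laurent_superset[of "keys f"] mval_gsub[OF bij_w] pm)
  show ?thesis by (cases z) (simp add: msub_frac S Fract_conv_to_fract)
qed

lemma perm_act_comp: "bij v \<Longrightarrow> bij w \<Longrightarrow> perm_act v (perm_act w z) = perm_act (v \<circ> w) z"
  by (simp add: perm_act_msub msub_msub monsub_perm)

section \<open>Demazure--Lusztig operators\<close>

abbreviation s :: "nat \<Rightarrow> 'k::field ratfun \<Rightarrow> 'k ratfun" where
  "s i \<equiv> perm_act (sref i)"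

lemma bij_sref [simp]: "bij (sref i)" by (simp add: sref_def)

interpretation sr: monsub "\<lambda>_. 1 :: 'k::field" "sref i" for i
  by (rule monsub_perm) simp

lemmas s_hom = sr.msub_hom[folded perm_act_msub, simplified]
lemmas s_cst [simp] = sr.msub_cst[folded perm_act_msub]
lemmas s_0 [simp] = sr.msub_0[folded perm_act_msub]
lemmas s_1 [simp] = sr.msub_1[folded perm_act_msub]
lemmas s_xmon = sr.msub_xmon[folded perm_act_msub, simplified]

lemma sref_apply [simp]: "sref i i = Suc i" "sref i (Suc i) = i"
  "k \<noteq> i \<Longrightarrow> k \<noteq> Suc i \<Longrightarrow> sref i k = k"
  by (simp_all add: sref_def)

lemma s_s [simp]: "s i (s i f) = f"
proof -
  have "s i (s i f) = perm_act (\<lambda>x. x) f"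
    by (simp add: perm_act_comp) (simp add: sref_def o_def)
  then show ?thesis by (simp add: perm_act_msub msub_id)
qed

lemma s_comm: "Suc i < j \<Longrightarrow> s i (s j f) = s j (s i f)"
proof -
  assume "Suc i < j"
  then have "sref i \<circ> sref j = sref j \<circ> sref i"
    by (auto simp: fun_eq_iff sref_def transpose_def)
  then show ?thesis by (simp add: perm_act_comp)
qed

lemma s_braid: "s (Suc i) (s i (s (Suc i) f)) = s i (s (Suc i) (s i f))"
proof -
  have "sref (Suc i) \<circ> (sref i \<circ> sref (Suc i)) = sref i \<circ> (sref (Suc i) \<circ> sref i)"
    by (auto simp: fun_eq_iff sref_def transpose_def)
  then show ?thesis by (simp add: perm_act_comp bij_comp)
qed

locale hecke =
  fixes n :: nat and q t :: "'k::field"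
  assumes n_pos: "n \<ge> 1" and q_nonzero [simp]: "q \<noteq> 0" and t_nonzero [simp]: "t \<noteq> 0"
begin

definition ca :: "'k ratfun \<Rightarrow> 'k ratfun \<Rightarrow> 'k ratfun" where
  "ca x y = (1 - cst t) * x / (x - y)"

definition cb :: "'k ratfun \<Rightarrow> 'k ratfun \<Rightarrow> 'k ratfun" where
  "cb x y = (cst t * x - y) / (x - y)"

text \<open>The Demazure-Lusztig operator, normalized by (T - 1)(T + t) = 0, so that functions
  invariant under \<open>s i\<close> have eigenvalue 1.\<close>

definition T :: "nat \<Rightarrow> 'k ratfun \<Rightarrow> 'k ratfun" where
  "T i f = ca (xvar i) (xvar (Suc i)) * f + cb (xvar i) (xvar (Suc i)) * s i f"

lemma T_ddiff:
  "T i f = ddiff i (xvar i * f) - cst t * xvar i * ddiff i f"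
  by (simp add: T_def ca_def cb_def ddiff_def s_hom divide_simps) (simp add: algebra_simps)

lemma s_ca: "s i (ca x y) = ca (s i x) (s i y)" by (simp add: ca_def s_hom)
lemma s_cb: "s i (cb x y) = cb (s i x) (s i y)" by (simp add: cb_def s_hom)

lemma T_add: "T i (f + g) = T i f + T i g" by (simp add: T_def s_hom algebra_simps)
lemma T_sym: "s i g = g \<Longrightarrow> T i (g * f) = g * T i f" by (simp add: T_def s_hom algebra_simps)
lemma T_cst: "T i (cst c * f) = cst c * T i f" by (simp add: T_sym)
lemma T_0 [simp]: "T i 0 = 0" by (simp add: T_def)
lemma T_uminus: "T i (- f) = - T i f" using T_cst[of i "-1" f] by (simp add: cst_uminus)
lemma T_diff: "T i (f - g) = T i f - T i g"
  using T_add[of i f "- g"] by (simp add: T_uminus)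
lemma T_sum: "T i (sum f A) = (\<Sum>j\<in>A. T i (f j))"
  by (induction A rule: infinite_finite_induct) (simp_all add: T_add)

lemma ca_plus_cb: "x \<noteq> y \<Longrightarrow> ca x y + cb x y = 1"
  by (simp add: ca_def cb_def divide_simps) (simp add: algebra_simps)

lemma T_fix: "s i f = f \<Longrightarrow> T i f = f"
  by (simp add: T_def flip: distrib_right) (simp add: ca_plus_cb)

lemma T_1 [simp]: "T i 1 = 1" by (simp add: T_fix)

lemma T_quad: "T i (T i f) = cst (1 - t) * T i f + cst t * f"
proof -
  have *: "x \<noteq> y \<Longrightarrow> ca x y * ca x y + cb x y * cb y x = cst (1 - t) * ca x y + cst t"
    "x \<noteq> y \<Longrightarrow> ca x y * cb x y + cb x y * ca y x = cst (1 - t) * cb x y" for x y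
    by (simp_all add: ca_def cb_def cst_diff divide_simps) (simp_all add: algebra_simps)
  let ?x = "xvar i" and ?y = "xvar (Suc i)"
  have "T i (T i f) = (ca ?x ?y * ca ?x ?y + cb ?x ?y * cb ?y ?x) * f
      + (ca ?x ?y * cb ?x ?y + cb ?x ?y * ca ?y ?x) * s i f"
    by (simp add: T_def s_hom s_ca s_cb algebra_simps)
  also have "\<dots> = cst (1 - t) * T i f + cst t * f"
    by (simp add: * ) (simp add: T_def algebra_simps)
  finally show ?thesis .
qed

lemma T_comm: "Suc i < j \<Longrightarrow> T i (T j f) = T j (T i f)"
  by (simp add: T_def s_hom s_ca s_cb s_comm[of i j f] algebra_simps)

lemma T_comm': "Suc i < j \<or> Suc j < i \<Longrightarrow> T i (T j f) = T j (T i f)"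
  using T_comm by metis

lemma T_braid: "T (Suc i) (T i (T (Suc i) f)) = T i (T (Suc i) (T i f))"
proof -
  let ?x = "xvar i" and ?y = "xvar (Suc i)" and ?z = "xvar (Suc (Suc i))"
  \<comment> \<open>Both sides are expanded over the six elements of S_3. The coefficients of f,
    \<open>s i f\<close> and \<open>s (Suc i) f\<close> agree by these three identities; the
    remaining three coincide as written.\<close>
  have 1: "ca x y * ca y z * ca x y + cb x y * ca x z * cb y x
      = ca y z * ca x y * ca y z + cb y z * ca x z * cb z y"
    and 2: "ca x y * ca y z + ca x z * ca y x = ca y z * ca x z"
    and 3: "ca y z * ca x y + ca x z * ca z y = ca x y * ca x z"
    if "x \<noteq> y" "y \<noteq> z" "x \<noteq> z" for x y z
    using that by (simp_all add: ca_def cb_def divide_simps) (simp_all add: algebra_simps)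
  have L: "T i (T (Suc i) (T i f)) =
      (ca ?x ?y * ca ?y ?z * ca ?x ?y + cb ?x ?y * ca ?x ?z * cb ?y ?x) * f
      + cb ?x ?y * (ca ?x ?y * ca ?y ?z + ca ?x ?z * ca ?y ?x) * s i f
      + cb ?y ?z * (ca ?x ?y * ca ?x ?z) * s (Suc i) f
      + ca ?x ?y * cb ?y ?z * cb ?x ?z * s (Suc i) (s i f)
      + cb ?x ?y * cb ?x ?z * ca ?y ?z * s i (s (Suc i) f)
      + cb ?x ?y * cb ?x ?z * cb ?y ?z * s i (s (Suc i) (s i f))"
    by (simp add: T_def s_hom s_ca s_cb algebra_simps)
  have R: "T (Suc i) (T i (T (Suc i) f)) =
      (ca ?y ?z * ca ?x ?y * ca ?y ?z + cb ?y ?z * ca ?x ?z * cb ?z ?y) * f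
      + cb ?x ?y * (ca ?y ?z * ca ?x ?z) * s i f
      + cb ?y ?z * (ca ?y ?z * ca ?x ?y + ca ?x ?z * ca ?z ?y) * s (Suc i) f
      + ca ?x ?y * cb ?y ?z * cb ?x ?z * s (Suc i) (s i f)
      + cb ?x ?y * cb ?x ?z * ca ?y ?z * s i (s (Suc i) f)
      + cb ?x ?y * cb ?x ?z * cb ?y ?z * s i (s (Suc i) (s i f))"
    by (simp add: T_def s_hom s_ca s_cb s_braid algebra_simps)
  show ?thesis unfolding L R by (subst 1 2 3; simp)+
qed

definition Ti :: "nat \<Rightarrow> 'k ratfun \<Rightarrow> 'k ratfun" where
  "Ti i f = cst (inverse t) * (T i f - cst (1 - t) * f)"

lemma cst_t_inverse [simp]: "cst t * cst (inverse t) = 1" "cst (inverse t) * cst t = 1"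
  "cst t * (cst (inverse t) * z) = z" "cst (inverse t) * (cst t * z) = z"
  by (simp_all add: cst_inverse)

lemma Ti_T [simp]: "Ti i (T i f) = f"
  by (simp add: Ti_def T_quad)
lemma T_Ti [simp]: "T i (Ti i f) = f"
  by (simp add: Ti_def T_cst T_diff T_quad)
lemma Ti_cst: "Ti i (cst c * f) = cst c * Ti i f" unfolding Ti_def T_cst by (simp add: algebra_simps)
lemma Ti_add: "Ti i (f + g) = Ti i f + Ti i g" by (simp add: Ti_def T_add algebra_simps)
lemma Ti_sym: "s i g = g \<Longrightarrow> Ti i (g * f) = g * Ti i f"
  unfolding Ti_def by (subst T_sym) (simp_all add: algebra_simps)
lemma Ti_fix: "s i f = f \<Longrightarrow> Ti i f = f"
  by (metis T_fix Ti_T)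
lemma T_Ti_comm: "Suc i < j \<or> Suc j < i \<Longrightarrow> T i (Ti j f) = Ti j (T i f)"
  unfolding Ti_def T_cst T_diff using T_comm'[of i j f] by simp

lemma T_xvar: "T i (xvar (Suc i) * f) = cst t * xvar i * Ti i f"
proof -
  have "T i (xvar (Suc i) * f) = xvar i * (T i f - cst (1 - t) * f)"
    by (simp add: T_def s_hom ca_def cb_def cst_diff divide_simps) (simp add: algebra_simps)
  also have "\<dots> = cst t * xvar i * Ti i f"
    unfolding Ti_def by (simp only: mult.assoc mult.left_commute[of "xvar i"] cst_t_inverse)
  finally show ?thesis .
qed

lemma Ti_xvar: "Ti i (xvar i * f) = cst (inverse t) * xvar (Suc i) * T i f"
proof -
  have "T i (xvar (Suc i) * T i f) = cst t * xvar i * f" by (simp add: T_xvar)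
  then have "Ti i (cst t * (xvar i * f)) = xvar (Suc i) * T i f" by (metis Ti_T mult.assoc)
  then have "cst (inverse t) * (cst t * Ti i (xvar i * f)) = cst (inverse t) * (xvar (Suc i) * T i f)"
    by (simp only: Ti_cst)
  then show ?thesis by (simp add: mult_ac)
qed

section \<open>The affine rotation and the operator of (E1)\<close>

definition cyc :: "nat \<Rightarrow> nat" where
  "cyc i = (if 1 \<le> i \<and> i < n then Suc i else if i = n then 1 else i)"

lemma bij_cyc: "bij cyc"
proof (rule o_bij)
  let ?d = "\<lambda>i. if 2 \<le> i \<and> i \<le> n then i - 1 else if i = 1 then n else i"
  show "?d \<circ> cyc = id" using n_pos by (auto simp: fun_eq_iff cyc_def)
  show "cyc \<circ> ?d = id" using n_pos by (auto simp: fun_eq_iff cyc_def)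
qed

definition qn :: "nat \<Rightarrow> 'k" where "qn i = (if i = n then inverse q else 1)"

definition om :: "'k ratfun \<Rightarrow> 'k ratfun" where "om = msub qn cyc"

sublocale om: monsub qn cyc
  by standard (simp_all add: qn_def bij_cyc)

lemmas om_hom = om.msub_hom[folded om_def]
lemmas om_cst [simp] = om.msub_cst[folded om_def]
lemmas om_prod = om.msub_prod[folded om_def]
lemma om_1 [simp]: "om 1 = 1" by (simp add: om_def)
lemma om_0 [simp]: "om 0 = 0" by (simp add: om_def)

lemma om_xvar: "1 \<le> i \<Longrightarrow> i < n \<Longrightarrow> om (xvar i) = xvar (Suc i)"
  and om_xvar_n: "om (xvar n) = cst (inverse q) * xvar 1"
  by (simp_all add: om_hom qn_def cyc_def)

lemma om_s: 
  assumes "1 \<le> i" "Suc i < n" 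
  shows "om (s i f) = s (Suc i) (om f)"
proof -
  have "cyc \<circ> sref i = sref (Suc i) \<circ> cyc"
    using assms by (auto simp: fun_eq_iff sref_def transpose_def cyc_def)
  moreover have "(\<lambda>j. 1 * qn (sref i j)) = (\<lambda>j. qn j * 1)"
    using assms by (auto simp: fun_eq_iff sref_def transpose_def qn_def)
  ultimately show ?thesis
    unfolding om_def perm_act_msub
    by (subst (1 2) msub_msub) (auto simp: sr.monsub_axioms om.monsub_axioms)
qed

text \<open>One rotation carries the adjacent pair (n - 1, n) to (n, 1); a second one carries it to
  (1, 2). By then both variables have acquired the same factor q^{-1}, so the coefficients are
  invariant under the swap.\<close>

lemma om_om_s: 
  assumes "n \<ge> 2"
  shows "om (om (s (n - 1) f)) = s 1 (om (om f))"
proof -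
  interpret om2: monsub "\<lambda>j. qn j * qn (cyc j)" "cyc \<circ> cyc"
    by standard (auto simp: om.c_nonzero bij_comp bij_cyc)
  have 1: "(cyc \<circ> cyc) \<circ> sref (n - 1) = sref 1 \<circ> (cyc \<circ> cyc)"
    using assms by (auto simp: fun_eq_iff sref_def transpose_def cyc_def)
  have 2: "(\<lambda>j. 1 * (qn (sref (n-1) j) * qn (cyc (sref (n-1) j)))) = (\<lambda>j. (qn j * qn (cyc j)) * 1)"
    using assms by (auto simp: fun_eq_iff sref_def transpose_def qn_def cyc_def)
  have om2: "om (om g) = msub (\<lambda>j. qn j * qn (cyc j)) (cyc \<circ> cyc) g" for g
    by (simp add: om_def msub_msub om.monsub_axioms)
  show ?thesis
    unfolding om2 perm_act_msub
    by (subst (1 2) msub_msub)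
       (use 1 2 in \<open>simp_all add: sr.monsub_axioms om2.monsub_axioms\<close>)
qed

lemma om_ca: "om (ca x y) = ca (om x) (om y)" by (simp add: ca_def om_hom)
lemma om_cb: "om (cb x y) = cb (om x) (om y)" by (simp add: cb_def om_hom)

lemma om_T: "1 \<le> i \<Longrightarrow> Suc i < n \<Longrightarrow> om (T i f) = T (Suc i) (om f)"
  by (simp add: T_def om.msub_add[folded om_def] om.msub_mult[folded om_def] om_ca om_cb om_s om_xvar)

lemma ca_scale: "c \<noteq> 0 \<Longrightarrow> ca (c * x) (c * y) = ca x y"
  and cb_scale: "c \<noteq> 0 \<Longrightarrow> cb (c * x) (c * y) = cb x y"
proof -
  assume "c \<noteq> 0"
  moreover have "(1 - cst t) * (c * x) = c * ((1 - cst t) * x)" "c * x - c * y = c * (x - y)"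
    "cst t * (c * x) - c * y = c * (cst t * x - y)"
    by (simp_all add: algebra_simps)
  ultimately show "ca (c * x) (c * y) = ca x y" "cb (c * x) (c * y) = cb x y"
    by (simp_all add: ca_def cb_def)
qed

text \<open>The common factor q^{-1} disappears because the coefficients \<open>ca\<close> and
  \<open>cb\<close> are homogeneous of degree 0.\<close>

lemma om_om_T: 
  assumes "n \<ge> 2"
  shows "om (om (T (n - 1) f)) = T 1 (om (om f))"
proof -
  have x: "om (om (xvar (n - 1))) = cst (inverse q) * xvar 1"
    using assms om_xvar[of "n - 1"] om_xvar_n by simp
  have y: "om (om (xvar n)) = cst (inverse q) * xvar (Suc 1)"
  proof -
    have "om (om (xvar n)) = cst (inverse q) * om (xvar 1)"
      by (simp add: om_xvar_n om.msub_mult[folded om_def])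
    then show ?thesis using assms om_xvar[of 1] by simp
  qed
  have n: "Suc (n - 1) = n" using assms by simp
  show ?thesis
    unfolding T_def n om.msub_add[folded om_def] om.msub_mult[folded om_def] om_ca om_cb x y
      om_om_s[OF assms]
    by (simp add: ca_scale cb_scale)
qed

lemma om_Ti: "1 \<le> i \<Longrightarrow> Suc i < n \<Longrightarrow> om (Ti i f) = Ti (Suc i) (om f)"
  by (metis om_T T_Ti Ti_T)
lemma om_om_Ti: "n \<ge> 2 \<Longrightarrow> om (om (Ti (n - 1) f)) = Ti 1 (om (om f))"
  by (metis om_om_T T_Ti Ti_T)

text \<open>The right-hand side of (E1) without its scalar q^{\<mu>_n}.\<close>

definition Phi :: "'k ratfun \<Rightarrow> 'k ratfun" where "Phi f = xvar 1 * om f"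

lemma Phi_cst: "Phi (cst c * f) = cst c * Phi f"
  by (simp add: Phi_def om.msub_mult[folded om_def] mult_ac)

lemma Phi_add: "Phi (f + g) = Phi f + Phi g"
  by (simp add: Phi_def om.msub_add[folded om_def] algebra_simps)

lemma Phi_T: "1 \<le> i \<Longrightarrow> Suc i < n \<Longrightarrow> Phi (T i f) = T (Suc i) (Phi f)"
  by (simp add: Phi_def om_T T_sym s_hom)

lemma Phi_Phi_T: "n \<ge> 2 \<Longrightarrow> Phi (Phi (T (n - 1) f)) = T 1 (Phi (Phi f))"
proof -
  assume n: "n \<ge> 2"
  have "Phi (Phi g) = xvar 1 * xvar (Suc 1) * om (om g)" for g
    using n om_xvar[of 1] by (simp add: Phi_def om.msub_mult[folded om_def])
  moreover have "s i (xvar i * xvar (Suc i)) = (xvar i * xvar (Suc i) :: 'k ratfun)" for i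
    by (simp add: s_hom mult.commute)
  ultimately show ?thesis using n by (simp add: om_om_T T_sym[of 1 "xvar 1 * xvar (Suc 1)"] del: One_nat_def Suc_1)
qed

end

section \<open>Cherednik operators\<close>

context hecke
begin

primrec ch :: "nat \<Rightarrow> 'k ratfun \<Rightarrow> 'k ratfun" where
  "ch 0 f = f" | "ch (Suc m) f = Ti (Suc m) (ch m f)"

text \<open>What \<open>ch\<close> becomes when it is moved through \<open>om\<close>, which raises
  all indices by one (\<open>om_ch\<close>).\<close>

primrec ch2 :: "nat \<Rightarrow> 'k ratfun \<Rightarrow> 'k ratfun" where
  "ch2 0 f = f" | "ch2 (Suc m) f = Ti (Suc (Suc m)) (ch2 m f)"

primrec up :: "nat \<Rightarrow> 'k ratfun \<Rightarrow> 'k ratfun" where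
  "up 0 f = f" | "up (Suc m) f = T (Suc m) (up m f)"

primrec dn :: "nat \<Rightarrow> 'k ratfun \<Rightarrow> 'k ratfun" where
  "dn 0 f = f" | "dn (Suc m) f = dn m (T (Suc m) f)"

text \<open>\<open>Y m\<close> is the Cherednik operator usually written \<open>Y\<^bsub>m+1\<^esub>\<close>.\<close>

primrec Y :: "nat \<Rightarrow> 'k ratfun \<Rightarrow> 'k ratfun" where
  "Y 0 f = om (ch (n - 1) f)" |
  "Y (Suc m) f = cst (inverse t) * T (Suc m) (Y m (T (Suc m) f))"

lemma ch_cst: "ch m (cst c * f) = cst c * ch m f" by (induction m) (simp_all add: Ti_cst)
lemma ch_add: "ch m (f + g) = ch m f + ch m g" by (induction m) (simp_all add: Ti_add)
lemma ch_dn [simp]: "ch m (dn m f) = f" by (induction m arbitrary: f) simp_all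

lemma ch_T_far: "Suc m < i \<Longrightarrow> ch m (T i f) = T i (ch m f)"
  by (induction m) (simp_all add: T_Ti_comm)

lemma Ti_Ti_T: "Ti (Suc i) (Ti i (T (Suc i) f)) = T i (Ti (Suc i) (Ti i f))"
proof -
  define h where "h = Ti (Suc i) (Ti i f)"
  have f: "f = T i (T (Suc i) h)" by (simp add: h_def)
  show ?thesis unfolding f by (simp add: T_braid)
qed

text \<open>The braid relation lowers the index by one as the operator passes the chain. In
  \<open>Y 0\<close> the rotation raises it again, whence \<open>Y0_T\<close>.\<close>

lemma ch_T: "1 \<le> i \<Longrightarrow> Suc i \<le> m \<Longrightarrow> ch m (T (Suc i) f) = T i (ch m f)"
proof (induction m)
  case (Suc m)
  show ?case
  proof (cases "Suc i = Suc m")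
    case True
    then obtain k where k: "i = m" "m = Suc k" using Suc.prems by (cases m) auto
    then show ?thesis by (simp add: ch_T_far Ti_Ti_T)
  next
    case False
    then show ?thesis using Suc by (simp add: T_Ti_comm)
  qed
qed simp

lemma Y_cst: "Y m (cst c * f) = cst c * Y m f"
  by (induction m arbitrary: f) (simp_all add: ch_cst om.msub_mult[folded om_def] T_cst mult.left_commute)

lemma Y_add: "Y m (f + g) = Y m f + Y m g"
  by (induction m arbitrary: f g) (simp_all add: ch_add om.msub_add[folded om_def] T_add algebra_simps)

lemma Y0_T: "1 \<le> i \<Longrightarrow> Suc i < n \<Longrightarrow> Y 0 (T (Suc i) f) = T (Suc i) (Y 0 f)"
  by (simp add: ch_T om_T)

lemma Y_T_comm:
  assumes "1 \<le> i" "i < n" "i \<noteq> m" "i \<noteq> Suc m" "m < n"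
  shows "Y m (T i f) = T i (Y m f)"
  using assms
proof (induction m arbitrary: i f rule: less_induct)
  case (less m)
  show ?case
  proof (cases m)
    case 0
    then obtain k where "i = Suc k" "1 \<le> k" using less.prems by (cases i) auto
    then show ?thesis using less.prems 0 Y0_T[of k] by simp
  next
    case (Suc k)
    show ?thesis
    proof (cases "i = k")
      case False
      then have "Suc i < Suc k \<or> Suc (Suc k) < i" using less.prems Suc by linarith
      then have c: "T (Suc k) (T i g) = T i (T (Suc k) g)" for g by (intro T_comm') auto
      have IH: "Y k (T i g) = T i (Y k g)" for g using less False Suc by simp
      have "T (Suc k) (Y k (T (Suc k) (T i f))) = T i (T (Suc k) (Y k (T (Suc k) f)))"
        by (simp only: c[of f] IH c[of "Y k (T (Suc k) f)"])
      then show ?thesis by (simp add: Suc T_cst)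
    next
      \<comment> \<open>Here i = k = m - 1. Unfolding two layers gives T_m T_k Y_j T_k T_m up to a
        scalar, with j = k - 1. Since Y_j commutes with T_m, the operator T_k passes by one braid
        relation on each side.\<close>
      case True
      then obtain j where k: "k = Suc j" using less.prems by (cases k) auto
      have IH: "Y j (T (Suc (Suc j)) g) = T (Suc (Suc j)) (Y j g)" for g
        using less k Suc True by simp
      show ?thesis
        by (simp add: Suc True k T_cst T_braid Y_cst flip: IH)
           (simp add: IH flip: T_braid)
    qed
  qed
qed

lemma Y_T_Suc: "Y (Suc m) (T (Suc m) f) = cst (1 - t) * Y (Suc m) f + T (Suc m) (Y m f)"
  by (simp only: Y.simps T_quad Y_add Y_cst T_add T_cst) (simp add: algebra_simps)

lemma T_Y_Suc: "T (Suc m) (Y (Suc m) f) = cst (1 - t) * Y (Suc m) f + Y m (T (Suc m) f)"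
  by (simp add: T_quad T_cst algebra_simps)

lemma ch_xvar: "ch m (xvar 1 * f) = cst (inverse t ^ m) * xvar (Suc m) * up m f"
proof (induction m)
  case (Suc m)
  have "ch (Suc m) (xvar 1 * f) = cst (inverse t ^ m) * Ti (Suc m) (xvar (Suc m) * up m f)"
    by (simp only: ch.simps Suc.IH mult.assoc Ti_cst)
  also have "\<dots> = cst (inverse t ^ Suc m) * xvar (Suc (Suc m)) * up (Suc m) f"
    by (simp add: Ti_xvar cst_mult mult_ac)
  finally show ?case .
qed simp

lemma Y_up: "Y m f = cst (inverse t ^ m) * up m (Y 0 (dn m f))"
proof (induction m arbitrary: f)
  case (Suc m)
  have "Y (Suc m) f = cst (inverse t) * T (Suc m) (Y m (T (Suc m) f))" by simp
  also have "\<dots> = cst (inverse t) * (cst (inverse t ^ m) * up (Suc m) (Y 0 (dn (Suc m) f)))"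
    by (simp only: Suc.IH T_cst up.simps dn.simps)
  finally show ?case by (simp only: power_Suc cst_mult mult.assoc)
qed simp

text \<open>For the last index the inner operators of \<open>Y\<close> cancel the inverse chain
  \<open>ch\<close> completely (\<open>ch_dn\<close>).\<close>

lemma Y_last: "Y (n - 1) f = cst (inverse t ^ (n - 1)) * up (n - 1) (om f)"
  by (subst Y_up) simp

lemma ch_Suc_ch2: "ch (Suc m) f = ch2 m (Ti 1 f)" by (induction m) simp_all

lemma ch2_xvar: "ch2 m (xvar 1 * f) = xvar 1 * ch2 m f"
  by (induction m) (simp_all add: Ti_sym s_hom)

lemma om_ch: "Suc m < n \<Longrightarrow> om (ch m f) = ch2 m (om f)"
  by (induction m) (simp_all add: om_Ti)

text \<open>Rotation raises the index of T, hence that of a Cherednik operator. Only the base case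
  crosses the boundary: there \<open>T_xvar\<close> turns T_1 x_2 into t x_1 T_1^{-1}, and this t
  cancels the t^{-1} in \<open>Y (Suc 0)\<close>.\<close>

lemma Phi_Y: "Suc m < n \<Longrightarrow> Y (Suc m) (Phi f) = Phi (Y m f)"
proof (induction m arbitrary: f)
  case 0
  define k where "k = n - 2"
  have n: "n - Suc 0 = Suc k" "Suc k < n" using 0 by (auto simp: k_def)
  have "Y (Suc 0) (Phi f) = cst (inverse t) * T 1 (om (ch2 k (Phi f)))"
    using ch_Suc_ch2[of k "T 1 (Phi f)"] by (simp add: n)
  also have "om (ch2 k (Phi f)) = xvar (Suc 1) * om (om (ch k f))"
    unfolding Phi_def ch2_xvar om.msub_mult[folded om_def]
    using om_xvar[of 1] 0 n by (simp add: om_ch)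
  also have "cst (inverse t) * T 1 \<dots> = xvar 1 * Ti 1 (om (om (ch k f)))"
    by (simp only: T_xvar) (simp add: mult.assoc)
  also have "\<dots> = Phi (Y 0 f)"
    using om_om_Ti[of "ch k f"] 0 by (simp add: n Phi_def)
  finally show ?case .
next
  case (Suc m)
  then show ?case by (simp add: Phi_cst flip: Phi_T)
qed

text \<open>The chain \<open>ch\<close> carries the factor x_1 to x_n while inverting its own
  operators, and the rotation of x_n produces the factor q^{-1}.\<close>

lemma Phi_Y_last: "Y 0 (Phi f) = cst (inverse q) * Phi (Y (n - 1) f)"
proof -
  have "Y 0 (Phi f) = om (cst (inverse t ^ (n - 1)) * xvar n * up (n - 1) (om f))"
    using ch_xvar[of "n - 1" "om f"] n_pos by (simp add: Phi_def)
  also have "\<dots> = cst (inverse q) * Phi (Y (n - 1) f)"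
    unfolding Y_last Phi_def om.msub_mult[folded om_def] om_xvar_n om_cst by (simp add: mult_ac)
  finally show ?thesis .
qed

definition C :: "'k ratfun \<Rightarrow> 'k ratfun" where "C f = (\<Sum>m<n. Y m f)"

lemma C_cst: "C (cst c * f) = cst c * C f" by (simp add: C_def Y_cst sum_distrib_left)
lemma C_add: "C (f + g) = C f + C g" by (simp add: C_def Y_add sum.distrib)

text \<open>T_i commutes with all but two of the summands, and the correction terms of these two
  cancel.\<close>

lemma C_T:
  assumes "1 \<le> i" "i < n"
  shows "C (T i f) = T i (C f)"
proof -
  obtain m where i: "i = Suc m" using assms by (cases i) auto
  have d: "{..<n} = insert m (insert (Suc m) ({..<n} - {m, Suc m}))" using assms i by auto
  have "(\<Sum>k\<in>{..<n} - {m, Suc m}. Y k (T i f)) = (\<Sum>k\<in>{..<n} - {m, Suc m}. T i (Y k f))"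
    by (intro sum.cong refl Y_T_comm) (use assms i in auto)
  moreover have "Y m (T i f) + Y (Suc m) (T i f) = T i (Y m f) + T i (Y (Suc m) f)"
    by (simp only: i Y_T_Suc T_Y_Suc) (simp add: algebra_simps)
  ultimately show ?thesis
    unfolding C_def T_sum by (subst (1 2) d) (simp add: add.assoc[symmetric])
qed

lemma ch_fix: "(\<And>i. 1 \<le> i \<Longrightarrow> i \<le> m \<Longrightarrow> s i f = f) \<Longrightarrow> ch m f = f"
  by (induction m) (simp_all add: Ti_fix)

lemma Y_fix:
  assumes "\<And>i. 1 \<le> i \<Longrightarrow> i < n \<Longrightarrow> s i f = f" and "m < n"
  shows "Y m f = cst (inverse t ^ m) * up m (om f)"
  using assms(2)
proof (induction m)
  case 0
  show ?case using assms by (simp add: ch_fix)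
next
  case (Suc m)
  then have "T (Suc m) f = f" using assms(1)[of "Suc m"] by (simp add: T_fix)
  with Suc show ?case by (simp add: T_cst cst_mult mult_ac)
qed

lemma ch_anti:
  "(\<And>i. 1 \<le> i \<Longrightarrow> i \<le> m \<Longrightarrow> T i f = - cst t * f) \<Longrightarrow> ch m f = cst ((- inverse t) ^ m) * f"
proof (induction m)
  case (Suc m)
  have "T (Suc m) f = cst (- t) * f" using Suc.prems[of "Suc m"] by (simp add: cst_uminus)
  then have "Ti (Suc m) f = cst (inverse t) * (cst (- t) * f - cst (1 - t) * f)"
    by (simp only: Ti_def)
  also have "\<dots> = cst (inverse t * (- t - (1 - t))) * f"
    by (simp only: cst_mult cst_diff[of "- t"] left_diff_distrib mult.assoc)
  finally have "Ti (Suc m) f = cst (- inverse t) * f" by simp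
  moreover have "ch m f = cst ((- inverse t) ^ m) * f" using Suc by simp
  ultimately show ?case by (simp only: ch.simps Ti_cst power_Suc cst_mult mult.assoc mult.left_commute)
qed simp

text \<open>Each of the n - 1 inverse operators in \<open>Y 0\<close> contributes -t^{-1}. Each
  later step contributes t^{-1} (-t) = -1 from its inner operator, and its outer one joins the chain
  \<open>up\<close>.\<close>

lemma Y_anti:
  assumes "\<And>i. 1 \<le> i \<Longrightarrow> i < n \<Longrightarrow> T i f = - cst t * f" and "m < n"
  shows "Y m f = cst ((- inverse t) ^ (n - 1) * (- 1) ^ m) * up m (om f)"
  using assms(2)
proof (induction m)
  case 0
  show ?case using assms by (simp add: ch_anti om.msub_mult[folded om_def])
next
  case (Suc m)
  have "T (Suc m) f = cst (- t) * f" using assms(1)[of "Suc m"] Suc.prems by (simp add: cst_uminus)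
  then have "Y (Suc m) f = cst (inverse t * (- t)) * T (Suc m) (Y m f)"
    by (simp only: Y.simps Y_cst T_cst cst_mult mult.assoc)
  also have "inverse t * (- t) = - 1" by simp
  also have "Y m f = cst ((- inverse t) ^ (n - 1) * (- 1) ^ m) * up m (om f)" using Suc by simp
  finally show ?case by (simp only: up.simps T_cst power_Suc cst_mult mult.assoc mult.left_commute)
qed

text \<open>Intended for powers of x_1 ... x_n, which move eigenvectors between nonnegative and
  arbitrary exponents.\<close>

lemma Y_sym:
  assumes "\<And>i. 1 \<le> i \<Longrightarrow> i < n \<Longrightarrow> s i g = g" and "om g = cst c * g" and "m < n"
  shows "Y m (g * f) = cst c * g * Y m f"
proof -
  have ch: "ch k (g * f) = g * ch k f" if "k < n" for k f
    using that by (induction k) (simp_all add: Ti_sym assms(1))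
  show ?thesis using assms(3)
  proof (induction m arbitrary: f)
    case 0
    show ?case
      unfolding Y.simps ch[OF diff_less[OF zero_less_one 0]] om.msub_mult[folded om_def] assms(2) ..
  next
    case (Suc m)
    have "T (Suc m) (g * h) = g * T (Suc m) h" for h using Suc.prems assms(1) by (simp add: T_sym)
    then show ?case using Suc by (simp add: mult.assoc T_cst mult.left_commute[of g])
  qed
qed

text \<open>The constant k is determined by the requirement that the multiples of f left over by
  \<open>Y_T_Suc\<close> and \<open>T_Y_Suc\<close> cancel. The operator T + k then exchanges the
  two eigenvalues.\<close>

lemma T_intertwine:
  assumes Y: "Y m f = cst y * f" "Y (Suc m) f = cst y' * f" and "y \<noteq> y'"
    and k: "k * (y - y') = (1 - t) * y'"
  defines "g \<equiv> T (Suc m) f + cst k * f"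
  shows "Y m g = cst y' * g" "Y (Suc m) g = cst y * g"
proof -
  have "Y (Suc m) g = cst ((1 - t) * y' + k * y') * f + cst y * T (Suc m) f"
    unfolding g_def Y_add Y_cst Y_T_Suc Y T_cst
    by (simp add: cst_mult cst_add cst_diff algebra_simps)
  also have "(1 - t) * y' + k * y' = y * k" using k by (simp add: algebra_simps)
  finally show "Y (Suc m) g = cst y * g" by (simp add: g_def cst_mult algebra_simps)
  have "Y m (T (Suc m) f) = T (Suc m) (Y (Suc m) f) - cst (1 - t) * Y (Suc m) f"
    by (simp only: T_Y_Suc) simp
  also have "\<dots> = cst y' * T (Suc m) f - cst ((1 - t) * y') * f"
    by (simp only: Y T_cst cst_mult mult.assoc)
  finally have E: "Y m (T (Suc m) f) = cst y' * T (Suc m) f - cst ((1 - t) * y') * f" .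
  have "Y m g = cst y' * T (Suc m) f + cst (k * y - (1 - t) * y') * f"
    unfolding g_def Y_add Y_cst Y E
    by (simp add: cst_mult cst_add cst_diff algebra_simps)
  also have "k * y - (1 - t) * y' = y' * k" using k by (simp add: algebra_simps)
  finally show "Y m g = cst y' * g" by (simp add: g_def cst_mult algebra_simps)
qed

text \<open>\<open>tau i a\<close> is the operator on the right-hand side of (E2); \<open>YB\<close> below is its Yang--Baxter equation.\<close>

definition kap :: "'k \<Rightarrow> 'k" where "kap a = (1 - t) * a / (1 - a)"

definition tau :: "nat \<Rightarrow> 'k \<Rightarrow> 'k ratfun \<Rightarrow> 'k ratfun" where
  "tau i a f = T i f + cst (kap a) * f"

lemma tau_cst: "tau i a (cst c * f) = cst c * tau i a f"
  unfolding tau_def T_cst by (simp add: algebra_simps)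

lemma tau_comm: "Suc i < j \<or> Suc j < i \<Longrightarrow> tau i a (tau j b f) = tau j b (tau i a f)"
  unfolding tau_def T_add T_cst using T_comm'[of i j f] by (simp add: algebra_simps)

lemma tau_sym: "s i g = g \<Longrightarrow> tau i a (g * f) = g * tau i a f"
  unfolding tau_def by (subst T_sym) (simp_all add: algebra_simps)

lemma Phi_tau: "1 \<le> i \<Longrightarrow> Suc i < n \<Longrightarrow> Phi (tau i a f) = tau (Suc i) a (Phi f)"
  by (simp add: tau_def Phi_add Phi_cst Phi_T)

lemma Phi_Phi_tau: "n \<ge> 2 \<Longrightarrow> Phi (Phi (tau (n - 1) a f)) = tau 1 a (Phi (Phi f))"
  using Phi_Phi_T[of f] unfolding tau_def Phi_add Phi_cst by simp

lemma YB:
  assumes "u \<noteq> 1" "v \<noteq> 1" "u * v \<noteq> 1"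
  shows "tau (Suc i) v (tau i (u * v) (tau (Suc i) u f)) = tau i u (tau (Suc i) (u * v) (tau i v f))"
proof -
  \<comment> \<open>The two expansions below differ only by exchanging the coefficients of T_i f and
    T_{i+1} f. This addition law for \<open>kap\<close> says that these two coefficients are
    equal.\<close>
  have K: "kap u * kap v = (kap u + kap v + (1 - t)) * kap (u * v)"
    using assms by (simp add: kap_def divide_simps) (simp add: algebra_simps)
  define a b c where "a = cst (kap u)" and "b = cst (kap v)" and "c = cst (kap (u * v))"
  have K': "a * b = (a + b + cst (1 - t)) * c"
    using arg_cong[OF K, of cst] by (simp add: a_def b_def c_def cst_mult cst_add)
  have L: "tau (Suc i) v (tau i (u * v) (tau (Suc i) u f)) =
    T i (T (Suc i) (T i f)) + a * T (Suc i) (T i f) + b * T i (T (Suc i) f)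
    + (c * cst (1 - t) + c * a + b * c) * T (Suc i) f + (a * b) * T i f + (c * cst t + a * b * c) * f"
    unfolding tau_def T_add T_cst a_def b_def c_def
    by (simp add: T_add T_cst T_quad T_braid algebra_simps)
  have R: "tau i u (tau (Suc i) (u * v) (tau i v f)) =
    T i (T (Suc i) (T i f)) + a * T (Suc i) (T i f) + b * T i (T (Suc i) f)
    + (c * cst (1 - t) + c * a + b * c) * T i f + (a * b) * T (Suc i) f + (c * cst t + a * b * c) * f"
    unfolding tau_def T_add T_cst a_def b_def c_def
    by (simp add: T_add T_cst T_quad T_braid algebra_simps)
  have "c * cst (1 - t) + c * a + b * c = a * b" using K' by (simp add: algebra_simps)
  then show ?thesis unfolding L R by simp
qed

end

section \<open>Spans of monomials\<close>

definition lspan :: "(nat \<Rightarrow>\<^sub>0 int) set \<Rightarrow> 'k::field ratfun set" where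
  "lspan U = to_fract ` {p. keys p \<subseteq> U}"

lemma lspan_0 [simp]: "0 \<in> lspan U"
  unfolding lspan_def by (rule image_eqI[of _ _ 0]) auto

lemma lspan_add: "f \<in> lspan U \<Longrightarrow> g \<in> lspan U \<Longrightarrow> f + g \<in> lspan U"
  unfolding lspan_def
proof (elim imageE)
  fix a b :: "'a laurent" assume "a \<in> {p. keys p \<subseteq> U}" "b \<in> {p. keys p \<subseteq> U}" "f = to_fract a" "g = to_fract b"
  then show "f + g \<in> to_fract ` {p. keys p \<subseteq> U}"
    using keys_add[of a b] by (intro image_eqI[of _ _ "a + b"]) auto
qed

lemma lspan_xmon: "\<nu> \<in> U \<Longrightarrow> xmon \<nu> \<in> lspan U"
  unfolding lspan_def xmon_def by (rule imageI) simp

lemma lspan_cst_xmon: "\<nu> \<in> U \<Longrightarrow> cst c * xmon \<nu> \<in> lspan U"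
  unfolding lspan_def to_fract_single[symmetric] by (rule imageI) auto

lemma lspan_sum: "(\<And>i. i \<in> A \<Longrightarrow> f i \<in> lspan U) \<Longrightarrow> sum f A \<in> lspan U"
  by (induction A rule: infinite_finite_induct) (auto intro: lspan_add)

lemma lspanE:
  assumes "f \<in> lspan U"
  obtains A c where "finite A" "A \<subseteq> U" "f = (\<Sum>\<nu>\<in>A. cst (c \<nu>) * xmon \<nu>)"
proof -
  from assms obtain p where "f = to_fract p" "keys p \<subseteq> U" by (auto simp: lspan_def)
  then show thesis using that[of "keys p" "lookup p"] by (simp add: to_fract_expand)
qed

lemma lspan_map:
  assumes "f \<in> lspan U"
    and "L 0 = 0" and "\<And>f g. L (f + g) = L f + L g" and "\<And>c f. L (cst c * f) = cst c * L f"
    and "\<And>\<nu>. \<nu> \<in> U \<Longrightarrow> L (xmon \<nu>) \<in> lspan V"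
  shows "L f \<in> lspan V"
proof -
  have cst: "cst c * g \<in> lspan V" if "g \<in> lspan V" for c g
  proof -
    from that obtain A d where "finite A" "A \<subseteq> V" "g = (\<Sum>\<nu>\<in>A. cst (d \<nu>) * xmon \<nu>)" by (rule lspanE)
    then have "cst c * g = (\<Sum>\<nu>\<in>A. cst (c * d \<nu>) * xmon \<nu>)" "A \<subseteq> V"
      by (simp_all add: sum_distrib_left cst_mult mult.assoc)
    then show ?thesis by (auto intro!: lspan_sum lspan_cst_xmon)
  qed
  from assms(1) obtain A c where A: "finite A" "A \<subseteq> U" "f = (\<Sum>\<nu>\<in>A. cst (c \<nu>) * xmon \<nu>)" by (rule lspanE)
  have "L (\<Sum>\<nu>\<in>A. cst (c \<nu>) * xmon \<nu>) = (\<Sum>\<nu>\<in>A. cst (c \<nu>) * L (xmon \<nu>))"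
    using A(1) by induction (simp_all add: assms)
  then show ?thesis using A assms(5) by (auto intro!: lspan_sum cst)
qed

lemma lspan_cst: "f \<in> lspan U \<Longrightarrow> cst c * f \<in> lspan U"
  by (rule lspan_map[where L = "\<lambda>f. cst c * f"]) (auto simp: algebra_simps intro: lspan_cst_xmon)

lemma lspan_uminus: "f \<in> lspan U \<Longrightarrow> - f \<in> lspan U"
  using lspan_cst[of f U "- 1"] by (simp add: cst_uminus)

lemma lspan_diff: "f \<in> lspan U \<Longrightarrow> g \<in> lspan U \<Longrightarrow> f - g \<in> lspan U"
  using lspan_add[of f U "- g"] lspan_uminus by force

lemma lspan_mono: "f \<in> lspan U \<Longrightarrow> U \<subseteq> V \<Longrightarrow> f \<in> lspan V"
  unfolding lspan_def by auto

lemma lspan_xmon_mult: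
  "f \<in> lspan U \<Longrightarrow> (\<And>\<nu>. \<nu> \<in> U \<Longrightarrow> \<mu> + \<nu> \<in> V) \<Longrightarrow> xmon \<mu> * f \<in> lspan V"
  by (rule lspan_map[where L = "\<lambda>f. xmon \<mu> * f"]) (auto simp: algebra_simps xmon_add[symmetric] intro: lspan_xmon)

section \<open>A Bruhat order on compositions\<close>

lemma lookup_zvec: "lookup (zvec n f) i = (if i \<in> {1..n} then f i else 0)"
  by (simp add: zvec_def lookup_sum lookup_single when_def)

lemma zvec_in_Zn [simp]: "zvec n f \<in> Zn n"
  unfolding Zn_def using lookup_zvec[of n f] by (auto simp: in_keys_iff split: if_splits)

lemma perm_vec_in_Zn [simp]: "perm_vec n w \<mu> \<in> Zn n" by (simp add: perm_vec_def)

lemma Zn_lookup_0: "\<mu> \<in> Zn n \<Longrightarrow> i \<notin> {1..n} \<Longrightarrow> lookup \<mu> i = 0"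
  unfolding Zn_def by (auto simp: in_keys_iff subset_iff)

lemma Zn_iff: "\<mu> \<in> Zn n \<longleftrightarrow> (\<forall>i. i \<notin> {1..n} \<longrightarrow> lookup \<mu> i = 0)"
  unfolding Zn_def by (auto simp: in_keys_iff subset_iff)

lemma Zn_eqI: "\<mu> \<in> Zn n \<Longrightarrow> \<nu> \<in> Zn n \<Longrightarrow> (\<And>i. 1 \<le> i \<Longrightarrow> i \<le> n \<Longrightarrow> lookup \<mu> i = lookup \<nu> i) \<Longrightarrow> \<mu> = \<nu>"
  by (rule poly_mapping_eqI) (metis Zn_lookup_0 atLeastAtMost_iff)

lemma Zn_add: "\<mu> \<in> Zn n \<Longrightarrow> \<nu> \<in> Zn n \<Longrightarrow> \<mu> + \<nu> \<in> Zn n"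
  by (auto simp: Zn_iff lookup_add)

lemma Zn_0 [simp]: "0 \<in> Zn n" by (simp add: Zn_iff)

lemma inv_sref [simp]: "inv (sref i) = sref i"
  by (simp add: sref_def)

lemma lookup_perm_sref:
  "1 \<le> j \<Longrightarrow> j \<le> n \<Longrightarrow> lookup (perm_vec n (sref i) \<mu>) j = lookup \<mu> (sref i j)"
  by (simp add: perm_vec_def lookup_zvec)

lemma sref_range: "1 \<le> i \<Longrightarrow> i < n \<Longrightarrow> sref i j \<in> {1..n} \<longleftrightarrow> j \<in> {1..n}"
  by (auto simp: sref_def transpose_def)

lemma pmap_in_Zn: "w permutes {1..n} \<Longrightarrow> \<mu> \<in> Zn n \<Longrightarrow> pmap w \<mu> \<in> Zn n"
  unfolding Zn_def mem_Collect_eq by (simp only: keys_pmap permutes_bij) (metis image_mono permutes_image)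

lemma pmap_perm_vec: "w permutes {1..n} \<Longrightarrow> \<mu> \<in> Zn n \<Longrightarrow> pmap w \<mu> = perm_vec n w \<mu>"
  by (rule Zn_eqI[of _ n]) (simp_all add: pmap_in_Zn lookup_pmap permutes_bij perm_vec_def lookup_zvec)

lemma sref_permutes: "1 \<le> i \<Longrightarrow> i < n \<Longrightarrow> sref i permutes {1..n}"
  by (simp add: sref_def permutes_swap_id)

lemma s_xmon_perm: "1 \<le> i \<Longrightarrow> i < n \<Longrightarrow> \<mu> \<in> Zn n \<Longrightarrow> s i (xmon \<mu>) = xmon (perm_vec n (sref i) \<mu>)"
  by (simp add: s_xmon pmap_perm_vec[OF sref_permutes])

text \<open>
  Extend \<open>\<mu>\<close> to \<open>\<int>\<close> by \<open>\<mu>(r - n) = \<mu>(r) + 1\<close>, so that (E1) becomes the shift of indices.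
  Then \<open>Nf n j h \<mu>\<close> is the number of integers \<open>r > j\<close> with \<open>\<mu>(r) > h\<close>, and comparing these numbers
  gives the Bruhat order of the extended affine symmetric group on \<open>\<int>\<^sup>n\<close>.
\<close>

definition Nf :: "nat \<Rightarrow> nat \<Rightarrow> int \<Rightarrow> (nat \<Rightarrow>\<^sub>0 int) \<Rightarrow> int" where
  "Nf n j h \<mu> = (\<Sum>r\<in>{1..n}. max 0 (lookup \<mu> r - h - (if r \<le> j then 1 else 0)))"

definition weight :: "nat \<Rightarrow> (nat \<Rightarrow>\<^sub>0 int) \<Rightarrow> int" where
  "weight n \<mu> = (\<Sum>r\<in>{1..n}. lookup \<mu> r)"

definition below :: "nat \<Rightarrow> (nat \<Rightarrow>\<^sub>0 int) \<Rightarrow> (nat \<Rightarrow>\<^sub>0 int) set" where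
  "below n \<mu> = {\<nu> \<in> Zn n. weight n \<nu> = weight n \<mu> \<and> (\<forall>j\<le>n. \<forall>h. Nf n j h \<nu> \<le> Nf n j h \<mu>)}"

text \<open>The exponents that can occur in T_i x^\<nu>: the entries at i and i + 1 move along the
  lattice segment from (\<nu>_i, \<nu>_{i+1}) to its reflection.\<close>

definition segment :: "nat \<Rightarrow> nat \<Rightarrow> (nat \<Rightarrow>\<^sub>0 int) \<Rightarrow> (nat \<Rightarrow>\<^sub>0 int) set" where
  "segment n i \<nu> = {\<nu>' \<in> Zn n. (\<forall>r. r \<noteq> i \<longrightarrow> r \<noteq> Suc i \<longrightarrow> lookup \<nu>' r = lookup \<nu> r) \<and>
     lookup \<nu>' i + lookup \<nu>' (Suc i) = lookup \<nu> i + lookup \<nu> (Suc i) \<and>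
     min (lookup \<nu> i) (lookup \<nu> (Suc i)) \<le> lookup \<nu>' i \<and>
     lookup \<nu>' i \<le> max (lookup \<nu> i) (lookup \<nu> (Suc i))}"

lemma sum_split_pair:
  fixes f :: "nat \<Rightarrow> int"
  assumes "1 \<le> i" "i < n"
  shows "sum f {1..n} = f i + f (Suc i) + sum f ({1..n} - {i, Suc i})"
proof -
  have "{1..n} = insert i (insert (Suc i) ({1..n} - {i, Suc i}))" using assms by auto
  then have "sum f {1..n} = sum f (insert i (insert (Suc i) ({1..n} - {i, Suc i})))" by simp
  then show ?thesis by simp
qed

definition Nr :: "nat \<Rightarrow> nat \<Rightarrow> nat \<Rightarrow> int \<Rightarrow> (nat \<Rightarrow>\<^sub>0 int) \<Rightarrow> int" where
  "Nr n i j h \<mu> = (\<Sum>r\<in>{1..n} - {i, Suc i}. max 0 (lookup \<mu> r - h - (if r \<le> j then 1 else 0)))"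

lemma Nf_split:
  assumes "1 \<le> i" "i < n"
  shows "Nf n j h \<mu> = max 0 (lookup \<mu> i - h - (if i \<le> j then 1 else 0))
     + max 0 (lookup \<mu> (Suc i) - h - (if Suc i \<le> j then 1 else 0)) + Nr n i j h \<mu>"
  unfolding Nf_def Nr_def by (rule sum_split_pair[OF assms])

lemma Nr_cong: "(\<And>r. r \<noteq> i \<Longrightarrow> r \<noteq> Suc i \<Longrightarrow> lookup \<mu> r = lookup \<nu> r) \<Longrightarrow> Nr n i j h \<mu> = Nr n i j h \<nu>"
  unfolding Nr_def by (rule sum.cong) auto

lemma Nr_shift: "Nr n i (i - 1) h \<mu> = Nr n i i h \<mu>" "Nr n i (Suc i) h \<mu> = Nr n i i h \<mu>"
proof -
  have "(r \<le> i - 1) = (r \<le> i)" "(r \<le> Suc i) = (r \<le> i)" if "r \<noteq> i" "r \<noteq> Suc i" for r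
    using that by auto
  then show "Nr n i (i - 1) h \<mu> = Nr n i i h \<mu>" "Nr n i (Suc i) h \<mu> = Nr n i i h \<mu>"
    unfolding Nr_def by (auto intro!: sum.cong)
qed

lemma segment_in_Zn: "\<nu>' \<in> segment n i \<nu> \<Longrightarrow> \<nu>' \<in> Zn n" by (simp add: segment_def)

lemma segment_weight:
  assumes "1 \<le> i" "i < n" "\<nu>' \<in> segment n i \<nu>"
  shows "weight n \<nu>' = weight n \<nu>"
proof -
  have "sum (lookup \<nu>') ({1..n} - {i, Suc i}) = sum (lookup \<nu>) ({1..n} - {i, Suc i})"
    using assms(3) by (intro sum.cong) (auto simp: segment_def)
  then show ?thesis
    using assms(3) unfolding weight_def sum_split_pair[OF assms(1,2)] by (simp add: segment_def)
qed

text \<open>For j different from i the positions i and i + 1 lie on the same side of the threshold.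
  The count is then a sum of the same convex function at both entries, which is largest at the ends
  of the segment.\<close>

lemma segment_Nf_le:
  assumes "1 \<le> i" "i < n" "\<nu>' \<in> segment n i \<nu>" "j \<noteq> i"
  shows "Nf n j h \<nu>' \<le> Nf n j h \<nu>"
proof -
  have "Nr n i j h \<nu>' = Nr n i j h \<nu>" using assms(3) by (intro Nr_cong) (auto simp: segment_def)
  moreover have "(Suc i \<le> j) = (i \<le> j)" using assms(4) by auto
  ultimately show ?thesis
    unfolding Nf_split[OF assms(1,2)] using assms(3) by (auto simp: segment_def max_def min_def split: if_splits)
qed

lemma perm_sref_lookups:
  assumes "1 \<le> i" "i < n" "\<mu> \<in> Zn n"
  shows "lookup (perm_vec n (sref i) \<mu>) i = lookup \<mu> (Suc i)"
    "lookup (perm_vec n (sref i) \<mu>) (Suc i) = lookup \<mu> i"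
    "r \<noteq> i \<Longrightarrow> r \<noteq> Suc i \<Longrightarrow> lookup (perm_vec n (sref i) \<mu>) r = lookup \<mu> r"
  using assms lookup_perm_sref[of r n i \<mu>] Zn_lookup_0[of \<mu> n r] Zn_lookup_0[of "perm_vec n (sref i) \<mu>" n r]
  by (cases "r \<in> {1..n}"; simp add: lookup_perm_sref)+

lemma perm_sref_segment:
  "1 \<le> i \<Longrightarrow> i < n \<Longrightarrow> \<mu> \<in> Zn n \<Longrightarrow> perm_vec n (sref i) \<mu> \<in> segment n i \<mu>"
  by (auto simp: segment_def perm_sref_lookups)

lemma self_segment: "\<mu> \<in> Zn n \<Longrightarrow> \<mu> \<in> segment n i \<mu>"
  by (auto simp: segment_def)

lemma below_refl: "\<mu> \<in> Zn n \<Longrightarrow> \<mu> \<in> below n \<mu>" by (simp add: below_def)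

text \<open>Swapping changes only the counts with threshold i. For every vector N_i is at most
  N_{i-1} and at most N_{i+1} + 1. For the swapped \<mu> one of the two, depending on the level h,
  is an equality with the neighbouring count of \<mu>, so nothing has to be assumed at j =
  i.\<close>

lemma below_lift:
  assumes i: "1 \<le> i" "i < n" and \<mu>: "\<mu> \<in> Zn n" "lookup \<mu> (Suc i) < lookup \<mu> i"
    and \<nu>: "\<nu> \<in> Zn n" "weight n \<nu> = weight n \<mu>"
    and le: "\<And>j h. j \<le> n \<Longrightarrow> j \<noteq> i \<Longrightarrow> Nf n j h \<nu> \<le> Nf n j h \<mu>"
  shows "\<nu> \<in> below n (perm_vec n (sref i) \<mu>)"
proof -
  let ?\<mu>' = "perm_vec n (sref i) \<mu>"
  have Nr: "Nr n i j h ?\<mu>' = Nr n i j h \<mu>" for j h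
    by (rule Nr_cong) (use i \<mu> in \<open>auto simp: perm_sref_lookups\<close>)
  have L: "lookup ?\<mu>' i = lookup \<mu> (Suc i)" "lookup ?\<mu>' (Suc i) = lookup \<mu> i"
    using i \<mu> by (auto simp: perm_sref_lookups)
  have w: "weight n ?\<mu>' = weight n \<mu>"
    by (rule segment_weight[OF i perm_sref_segment]) (use i \<mu> in auto)
  have "Nf n j h \<nu> \<le> Nf n j h ?\<mu>'" if "j \<le> n" for j h
  proof (cases "j = i")
    case False
    then have "(Suc i \<le> j) = (i \<le> j)" by auto
    then have "Nf n j h ?\<mu>' = Nf n j h \<mu>"
      unfolding Nf_split[OF i] by (simp add: Nr L)
    then show ?thesis using le[OF that False] by simp
  next
    case True
    show ?thesis
    proof (cases "lookup \<mu> (Suc i) \<le> h")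
      case True
      have "Nf n i h \<nu> \<le> Nf n (i - 1) h \<nu>" using i
        unfolding Nf_split[OF i] Nr_shift by auto
      also have "\<dots> \<le> Nf n (i - 1) h \<mu>" using i by (intro le) auto
      also have "\<dots> = Nf n i h ?\<mu>'" using i True
        unfolding Nf_split[OF i] Nr_shift by (simp add: Nr L)
      finally show ?thesis using \<open>j = i\<close> by simp
    next
      case False
      have "Nf n i h \<nu> \<le> Nf n (Suc i) h \<nu> + 1" using i
        unfolding Nf_split[OF i] Nr_shift by auto
      also have "\<dots> \<le> Nf n (Suc i) h \<mu> + 1" using i le[of "Suc i" h] by auto
      also have "\<dots> = Nf n i h ?\<mu>'" using i False \<mu>
        unfolding Nf_split[OF i] Nr_shift by (simp add: Nr L)
      finally show ?thesis using \<open>j = i\<close> by simp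
    qed
  qed
  then show ?thesis using \<nu> w by (simp add: below_def)
qed

lemma perm_sref_neq: "1 \<le> i \<Longrightarrow> i < n \<Longrightarrow> \<mu> \<in> Zn n \<Longrightarrow> lookup \<mu> (Suc i) \<noteq> lookup \<mu> i \<Longrightarrow> perm_vec n (sref i) \<mu> \<noteq> \<mu>"
  using perm_sref_lookups(1) by metis

lemma segment_below_self:
  assumes "1 \<le> i" "i < n" "\<mu> \<in> Zn n" "lookup \<mu> (Suc i) < lookup \<mu> i"
  shows "segment n i \<mu> \<subseteq> below n (perm_vec n (sref i) \<mu>)"
proof
  fix \<nu> assume "\<nu> \<in> segment n i \<mu>"
  then show "\<nu> \<in> below n (perm_vec n (sref i) \<mu>)"
    using assms by (intro below_lift) (auto simp: segment_in_Zn segment_weight segment_Nf_le)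
qed

text \<open>The lifting property of the Bruhat order in the form needed for triangularity. The count
  part is \<open>below_lift\<close>; strictness holds because reaching the swapped \<mu> from \<nu>
  would force \<nu> = \<mu>.\<close>

lemma segment_below:
  assumes i: "1 \<le> i" "i < n" and \<mu>: "\<mu> \<in> Zn n" "lookup \<mu> (Suc i) < lookup \<mu> i"
    and \<nu>: "\<nu> \<in> below n \<mu>" "\<nu> \<noteq> \<mu>"
  shows "segment n i \<nu> \<subseteq> below n (perm_vec n (sref i) \<mu>) - {perm_vec n (sref i) \<mu>}"
proof
  fix \<nu>' assume \<nu>': "\<nu>' \<in> segment n i \<nu>"
  let ?\<mu>' = "perm_vec n (sref i) \<mu>"
  have Zn: "\<nu> \<in> Zn n" using \<nu> by (simp add: below_def)
  have "\<nu>' \<in> below n ?\<mu>'"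
  proof (rule below_lift[OF i \<mu>])
    fix j h assume "j \<le> n" "j \<noteq> i"
    then show "Nf n j h \<nu>' \<le> Nf n j h \<mu>"
      using segment_Nf_le[OF i \<nu>', of j h] \<nu> unfolding below_def mem_Collect_eq by (meson order_trans)
  qed (use \<nu> \<nu>' i segment_weight segment_in_Zn in \<open>auto simp: below_def\<close>)
  moreover have "\<nu>' \<noteq> ?\<mu>'"
  proof
    assume eq: "\<nu>' = ?\<mu>'"
    have off: "lookup \<nu> r = lookup \<mu> r" if "r \<noteq> i" "r \<noteq> Suc i" for r
      using that \<nu>' eq i \<mu> by (auto simp: segment_def perm_sref_lookups)
    have pair: "lookup \<nu> i + lookup \<nu> (Suc i) = lookup \<mu> i + lookup \<mu> (Suc i)"
      "min (lookup \<nu> i) (lookup \<nu> (Suc i)) \<le> lookup \<mu> (Suc i)"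
      using \<nu>' eq i \<mu> by (auto simp: segment_def perm_sref_lookups)
    have Nr: "Nr n i j h \<nu> = Nr n i j h \<mu>" for j h by (rule Nr_cong) (simp add: off)
    have "Nf n (i - 1) (lookup \<mu> i) \<nu> \<le> Nf n (i - 1) (lookup \<mu> i) \<mu>"
      using \<nu> i by (simp add: below_def)
    moreover have "\<not> i \<le> i - 1" "\<not> Suc i \<le> i - 1" using i by auto
    ultimately have mx: "lookup \<nu> i \<le> lookup \<mu> i" "lookup \<nu> (Suc i) \<le> lookup \<mu> i"
      unfolding Nf_split[OF i] using \<mu> by (auto simp: Nr)
    \<comment> \<open>Of the two pairs that remain possible, this threshold and level exclude the
      reflected one: its larger entry sits at i + 1, beyond the threshold, and would be counted once
      too often.\<close>
    have "Nf n i (lookup \<mu> (Suc i)) \<nu> \<le> Nf n i (lookup \<mu> (Suc i)) \<mu>"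
      using \<nu> i by (simp add: below_def)
    then have "lookup \<nu> (Suc i) < lookup \<mu> i"
      unfolding Nf_split[OF i] using i \<mu> pair by (auto simp: Nr)
    then have "lookup \<nu> i = lookup \<mu> i" "lookup \<nu> (Suc i) = lookup \<mu> (Suc i)"
      using pair mx by auto
    then have "\<nu> = \<mu>" using off by (intro poly_mapping_eqI) metis
    then show False using \<nu> by simp
  qed
  ultimately show "\<nu>' \<in> below n ?\<mu>' - {?\<mu>'}" by simp
qed

definition cycvec :: "nat \<Rightarrow> (nat \<Rightarrow>\<^sub>0 int) \<Rightarrow> (nat \<Rightarrow>\<^sub>0 int)" where
  "cycvec n \<mu> = zvec n (\<lambda>i. if i = 1 then lookup \<mu> n + 1 else lookup \<mu> (i - 1))"

lemma cycvec_in_Zn [simp]: "cycvec n \<mu> \<in> Zn n" by (simp add: cycvec_def)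

lemma lookup_cycvec:
  "1 \<le> i \<Longrightarrow> i \<le> n \<Longrightarrow> lookup (cycvec n \<mu>) i = (if i = 1 then lookup \<mu> n + 1 else lookup \<mu> (i - 1))"
  by (simp add: cycvec_def lookup_zvec)

lemma sum_cycvec:
  fixes f :: "nat \<Rightarrow> int \<Rightarrow> int"
  assumes "n \<ge> 1"
  shows "(\<Sum>r\<in>{1..n}. f r (lookup (cycvec n \<mu>) r)) =
    f 1 (lookup \<mu> n + 1) + (\<Sum>r\<in>{1..<n}. f (Suc r) (lookup \<mu> r))"
proof -
  have "sum g {1..n} = g 1 + (\<Sum>r\<in>{1..<n}. g (Suc r))" for g :: "nat \<Rightarrow> int"
    using sum.atLeast_Suc_atMost[of 1 n g] assms
    by (simp only: sum.shift_bounds_Suc_ivl flip: atLeastLessThanSuc_atLeastAtMost)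
  then have "(\<Sum>r\<in>{1..n}. f r (lookup (cycvec n \<mu>) r))
      = f 1 (lookup (cycvec n \<mu>) 1) + (\<Sum>r\<in>{1..<n}. f (Suc r) (lookup (cycvec n \<mu>) (Suc r)))" .
  also have "\<dots> = f 1 (lookup \<mu> n + 1) + (\<Sum>r\<in>{1..<n}. f (Suc r) (lookup \<mu> r))"
    using assms by (simp add: lookup_cycvec)
  finally show ?thesis .
qed

lemma sum_last:
  fixes f :: "nat \<Rightarrow> int"
  assumes "n \<ge> 1" shows "sum f {1..n} = f n + sum f {1..<n}"
proof -
  have "{1..n} = insert n {1..<n}" using assms by auto
  then show ?thesis by simp
qed

text \<open>Rotation translates the extended vector by one place. The threshold j = 0 wraps around
  to n - 1, and the level drops by one to compensate for the increment in \<mu>(r - n) = \<mu>(r) +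
  1.\<close>

lemma Nf_cycvec:
  assumes "n \<ge> 1" "j \<le> n"
  shows "Nf n j h (cycvec n \<mu>) = (if j = 0 then Nf n (n - 1) (h - 1) \<mu> else Nf n (j - 1) h \<mu>)"
  using assms
  unfolding Nf_def
    sum_cycvec[OF assms(1), of "\<lambda>r v. max 0 (v - h - (if r \<le> j then 1 else 0))"]
    sum_last[OF assms(1)]
  by (auto intro!: sum.cong arg_cong2[where f = "(+)"] simp: Suc_le_eq)

lemma cycvec_below:
  assumes "n \<ge> 1" "\<nu> \<in> below n \<mu>"
  shows "cycvec n \<nu> \<in> below n (cycvec n \<mu>)"
proof -
  have "weight n (cycvec n \<kappa>) = weight n \<kappa> + 1" for \<kappa>
    unfolding weight_def using sum_cycvec[OF assms(1), of "\<lambda>r v. v"] sum_last[OF assms(1)] by simp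
  then show ?thesis using assms by (auto simp: below_def Nf_cycvec)
qed

lemma cycvec_inj:
  assumes "n \<ge> 1" "\<mu> \<in> Zn n" "\<nu> \<in> Zn n" "cycvec n \<mu> = cycvec n \<nu>"
  shows "\<mu> = \<nu>"
proof (rule Zn_eqI[OF assms(2,3)])
  fix i assume i: "1 \<le> i" "i \<le> n"
  show "lookup \<mu> i = lookup \<nu> i"
  proof (cases "i = n")
    case True
    then show ?thesis using lookup_cycvec[of 1 n \<mu>] lookup_cycvec[of 1 n \<nu>] assms by simp
  next
    case False
    then show ?thesis using lookup_cycvec[of "Suc i" n \<mu>] lookup_cycvec[of "Suc i" n \<nu>] assms i by simp
  qed
qed

definition ones :: "nat \<Rightarrow> int \<Rightarrow> (nat \<Rightarrow>\<^sub>0 int)" where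
  "ones n k = zvec n (\<lambda>_. k)"

lemma ones_in_Zn [simp]: "ones n k \<in> Zn n" by (simp add: ones_def)
lemma lookup_ones: "lookup (ones n k) i = (if i \<in> {1..n} then k else 0)" by (simp add: ones_def lookup_zvec)

lemma ones_add: "ones n (j + k) = ones n j + ones n k"
  by (rule poly_mapping_eqI) (simp add: lookup_ones lookup_add)
lemma ones_0 [simp]: "ones n 0 = 0"
  by (rule poly_mapping_eqI) (simp add: lookup_ones)
lemma ones_uminus: "ones n (- k) = - ones n k"
  by (rule poly_mapping_eqI) (simp add: lookup_ones)

lemma Nf_ones: "Nf n j h (ones n k + \<mu>) = Nf n j (h - k) \<mu>"
  unfolding Nf_def by (auto intro!: sum.cong simp: lookup_add lookup_ones)

lemma ones_below: "\<nu> \<in> below n \<mu> \<Longrightarrow> ones n k + \<nu> \<in> below n (ones n k + \<mu>)"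
  by (auto simp: below_def Zn_add Nf_ones weight_def lookup_add sum.distrib)

text \<open>Threshold 0 at level k bounds all entries by k; the equal weight leaves no room for
  smaller ones.\<close>

lemma below_ones:
  assumes "\<nu> \<in> below n (ones n k)" shows "\<nu> = ones n k"
proof (rule Zn_eqI[of _ n])
  have Nf: "Nf n 0 k \<nu> \<le> Nf n 0 k (ones n k)" and w: "weight n \<nu> = weight n (ones n k)"
    using assms by (auto simp: below_def)
  have "Nf n 0 k (ones n k) = 0" by (simp add: Nf_def lookup_ones)
  moreover have "0 \<le> Nf n 0 k \<nu>" unfolding Nf_def by (intro sum_nonneg) simp
  ultimately have "Nf n 0 k \<nu> = 0" using Nf by simp
  then have "\<forall>r\<in>{1..n}. max 0 (lookup \<nu> r - k - (if r \<le> 0 then 1 else 0)) = 0"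
    unfolding Nf_def by (subst (asm) sum_nonneg_eq_0_iff) auto
  then have le: "lookup \<nu> r \<le> k" if "r \<in> {1..n}" for r using that by force
  have "(\<Sum>r\<in>{1..n}. k - lookup \<nu> r) = 0"
    using w by (simp add: weight_def lookup_ones sum_subtractf)
  then have "\<forall>r\<in>{1..n}. k - lookup \<nu> r = 0"
    by (subst (asm) sum_nonneg_eq_0_iff) (use le in auto)
  then show "lookup \<nu> i = lookup (ones n k) i" if "1 \<le> i" "i \<le> n" for i
    using that by (simp add: lookup_ones)
qed (use assms in \<open>auto simp: below_def\<close>)

section \<open>Dominant vectors: from the Bruhat order to the lexicographic order\<close>

lemma dominant_mono:
  fixes lam :: "nat \<Rightarrow>\<^sub>0 int"
  assumes "\<forall>i\<in>{1..<n}. lookup lam (i + 1) \<le> lookup lam i" "1 \<le> i" "i \<le> j" "j \<le> n"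
  shows "lookup lam j \<le> lookup lam i"
  using assms(3,4)
proof (induction j rule: dec_induct)
  case (step m)
  then have "lookup lam (m + 1) \<le> lookup lam m" using assms(1,2) by auto
  then show ?case using step by simp
qed simp

lemma Nf_pmap:
  assumes v: "v permutes {1..n}"
  shows "Nf n 0 h (pmap v \<nu>) = Nf n 0 h \<nu>"
proof -
  have "Nf n 0 h \<nu> = (\<Sum>r\<in>{1..n}. max 0 (lookup \<nu> (inv v r) - h - (if r \<le> 0 then 1 else 0)))"
    unfolding Nf_def using sum.permute[OF permutes_inv[OF v], of "\<lambda>r. max 0 (lookup \<nu> r - h)"]
    by (simp add: o_def)
  then show ?thesis by (simp add: Nf_def lookup_pmap permutes_bij[OF v])
qed

text \<open>The order on exponents is lexicographic, smallest index first. Counts with threshold 0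
  do not change under permutations. If the first difference, at k, were in favour of the permuted
  \<nu>, its count at level lam_k would exceed that of lam, where only the entries before k
  contribute.\<close>

lemma below_dominant_le:
  assumes dom: "\<forall>i\<in>{1..<n}. lookup lam (i + 1) \<le> lookup lam i" and lam: "lam \<in> Zn n"
    and \<nu>: "\<nu> \<in> below n lam" and v: "v permutes {1..n}"
  shows "pmap v \<nu> \<le> lam"
proof (cases "pmap v \<nu> = lam")
  case ne: False
  have Zn: "\<nu> \<in> Zn n" using \<nu> by (simp add: below_def)
  let ?\<xi> = "pmap v \<nu>"
  obtain k where k: "lookup ?\<xi> k \<noteq> lookup lam k" "\<And>k'. k' < k \<Longrightarrow> lookup ?\<xi> k' = lookup lam k'"
    using ne exists_least_iff[of "\<lambda>k. lookup ?\<xi> k \<noteq> lookup lam k"]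
    by (auto simp: poly_mapping_eq_iff fun_eq_iff)
  have kn: "k \<in> {1..n}"
    using k(1) Zn_lookup_0[OF lam, of k] Zn_lookup_0[OF pmap_in_Zn[OF v Zn], of k] by fastforce
  have "lookup ?\<xi> k < lookup lam k"
  proof (rule ccontr)
    assume "\<not> lookup ?\<xi> k < lookup lam k"
    then have gt: "lookup ?\<xi> k > lookup lam k" using k(1) by simp
    let ?h = "lookup lam k"
    have "Nf n 0 ?h lam = (\<Sum>r\<in>{1..n}. if r < k then lookup lam r - ?h else 0)"
      unfolding Nf_def
    proof (rule sum.cong)
      fix r assume r: "r \<in> {1..n}"
      have "r < k \<Longrightarrow> ?h \<le> lookup lam r" "k \<le> r \<Longrightarrow> lookup lam r \<le> ?h"
        using dominant_mono[OF dom, of r k] dominant_mono[OF dom, of k r] kn r by auto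
      then show "max 0 (lookup lam r - ?h - (if r \<le> 0 then 1 else 0)) = (if r < k then lookup lam r - ?h else 0)"
        using r by (cases "r < k") auto
    qed simp
    also have "\<dots> < (\<Sum>r\<in>{1..n}. max 0 (lookup ?\<xi> r - ?h - (if r \<le> 0 then 1 else 0)))"
    proof (rule sum_strict_mono_ex1)
      show "\<exists>r\<in>{1..n}. (if r < k then lookup lam r - ?h else 0) < max 0 (lookup ?\<xi> r - ?h - (if r \<le> 0 then 1 else 0))"
        using kn gt by (intro bexI[of _ k]) auto
    qed (use k(2) in auto)
    also have "\<dots> = Nf n 0 ?h \<nu>" using Nf_pmap[OF v] by (simp add: Nf_def)
    finally show False using \<nu> unfolding below_def mem_Collect_eq by (meson leD zero_le)
  qed
  then have "?\<xi> < lam" using k(2) by (auto simp: less_poly_mapping.rep_eq less_fun_def)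
  then show ?thesis by simp
qed simp

text \<open>It remains to exclude a proper rearrangement \<nu> of lam, that is, to see that a
  dominant vector is minimal in its orbit. Passing from threshold 0 to threshold k loses one for
  each of the first k entries above the level; lam loses k, and \<nu> fewer.\<close>

lemma below_dominant_less:
  assumes dom: "\<forall>i\<in>{1..<n}. lookup lam (i + 1) \<le> lookup lam i" and lam: "lam \<in> Zn n"
    and \<nu>: "\<nu> \<in> below n lam" "\<nu> \<noteq> lam" and w: "w permutes {1..n}"
  shows "pmap w \<nu> < lam"
proof -
  have Zn: "\<nu> \<in> Zn n" using \<nu> by (simp add: below_def)
  have "pmap w \<nu> \<noteq> lam"
  proof
    assume eq: "pmap w \<nu> = lam"
    have idp: "pmap id \<nu> = \<nu>" using lookup_pmap'[of id \<nu>] by (intro poly_mapping_eqI) simp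
    have "\<nu> < lam" using below_dominant_le[OF dom lam \<nu>(1) permutes_id] idp \<nu>(2) by simp
    then obtain k where k: "lookup \<nu> k < lookup lam k" "\<And>k'. k' < k \<Longrightarrow> lookup \<nu> k' = lookup lam k'"
      by (auto simp: less_poly_mapping.rep_eq less_fun_def)
    have kn: "k \<in> {1..n}" using k(1) Zn_lookup_0[OF lam, of k] Zn_lookup_0[OF Zn, of k] by fastforce
    \<comment> \<open>One less than lam_k, so that entries equal to lam_k still lie above the
      level.\<close>
    let ?h = "lookup lam k - 1"
    have ge: "lookup lam r > ?h" if "1 \<le> r" "r \<le> k" for r
      using dominant_mono[OF dom, of r k] that kn by auto
    have drop: "Nf n k ?h \<kappa> = Nf n 0 ?h \<kappa> - (\<Sum>r\<in>{1..n}. if r \<le> k \<and> lookup \<kappa> r > ?h then 1 else 0)" for \<kappa>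
      unfolding Nf_def sum_subtractf[symmetric] by (intro sum.cong) (auto simp: max_def)
    have "(\<Sum>r\<in>{1..n}. if r \<le> k \<and> lookup \<nu> r > ?h then 1 else 0)
        < (\<Sum>r\<in>{1..n}. if r \<le> k \<and> lookup lam r > ?h then 1 else (0::int))"
    proof (rule sum_strict_mono_ex1)
      show "\<exists>r\<in>{1..n}. (if r \<le> k \<and> lookup \<nu> r > ?h then 1 else 0)
          < (if r \<le> k \<and> lookup lam r > ?h then 1 else (0::int))"
        using kn k(1) by (intro bexI[of _ k]) auto
    qed (use ge in auto)
    moreover have "Nf n 0 ?h \<nu> = Nf n 0 ?h lam" using Nf_pmap[OF w] eq by metis
    ultimately have "Nf n k ?h \<nu> > Nf n k ?h lam" by (simp add: drop)
    then show False using \<nu> kn unfolding below_def mem_Collect_eq atLeastAtMost_iff by (meson leD)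
  qed
  then show ?thesis using below_dominant_le[OF dom lam \<nu>(1) w] by simp
qed

section \<open>Triangularity of the operators\<close>

context hecke
begin

lemma T_power:
  "T i (xvar i ^ m) = xvar (Suc i) ^ m
     + (\<Sum>k<m. cst (1 - t) * (xvar i ^ Suc k * xvar (Suc i) ^ (m - Suc k)))"
  (is "?L = _ + ?R")
proof -
  let ?x = "xvar i :: 'k ratfun" and ?y = "xvar (Suc i) :: 'k ratfun"
  let ?S = "\<Sum>k<m. ?y ^ (m - Suc k) * ?x ^ k"
  have S: "?x ^ m - ?y ^ m = (?x - ?y) * ?S" by (rule power_diff_sumr2)
  have "?L = ?y ^ m + ca ?x ?y * (?x ^ m - ?y ^ m)"
  proof -
    have "?L = (ca ?x ?y + cb ?x ?y) * ?y ^ m + ca ?x ?y * (?x ^ m - ?y ^ m)"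
      by (simp add: T_def s_hom algebra_simps)
    then show ?thesis by (simp add: ca_plus_cb)
  qed
  also have "ca ?x ?y * (?x ^ m - ?y ^ m) = (1 - cst t) * ?x * ?S"
    unfolding S ca_def by (simp add: divide_simps)
  also have "\<dots> = ?R" by (simp add: sum_distrib_left cst_diff mult_ac)
  finally show ?thesis .
qed

lemma T_power_Suc:
  "T i (xvar (Suc i) ^ m) = xvar (Suc i) ^ m
     + (\<Sum>k<m. cst t * (xvar i ^ Suc k * xvar (Suc i) ^ (m - Suc k)))
     - (\<Sum>k<m. xvar i ^ k * xvar (Suc i) ^ (m - k))"
  (is "?L = _ + ?R - ?R'")
proof -
  let ?x = "xvar i :: 'k ratfun" and ?y = "xvar (Suc i) :: 'k ratfun"
  let ?S = "\<Sum>k<m. ?y ^ (m - Suc k) * ?x ^ k"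
  have S: "?x ^ m - ?y ^ m = (?x - ?y) * ?S" by (rule power_diff_sumr2)
  have "?L = ?y ^ m + cb ?x ?y * (?x ^ m - ?y ^ m)"
  proof -
    have "?L = (ca ?x ?y + cb ?x ?y) * ?y ^ m + cb ?x ?y * (?x ^ m - ?y ^ m)"
      by (simp add: T_def s_hom algebra_simps)
    then show ?thesis by (simp add: ca_plus_cb)
  qed
  also have "cb ?x ?y * (?x ^ m - ?y ^ m) = cst t * ?x * ?S - ?y * ?S"
    unfolding S cb_def by (simp add: divide_simps) (simp add: algebra_simps)
  also have "cst t * ?x * ?S = ?R" by (simp add: sum_distrib_left mult_ac)
  also have "?y * ?S = ?R'"
  proof -
    have "?y * (?y ^ (m - Suc k) * ?x ^ k) = ?x ^ k * ?y ^ (m - k)" if "k < m" for k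
    proof -
      have "m - k = Suc (m - Suc k)" using that by simp
      then show ?thesis by simp
    qed
    then show ?thesis unfolding sum_distrib_left by (intro sum.cong) auto
  qed
  finally show ?thesis by simp
qed

text \<open>Dividing x^\<nu> by the \<open>s i\<close>-invariant monomial x^\<kappa>, whose entries
  at i and i + 1 both equal the smaller one, leaves a pure power of x_i or of x_{i+1}. The action of
  T_i is thus reduced to \<open>T_power\<close> and \<open>T_power_Suc\<close>.\<close>

context
  fixes i :: nat and \<nu> :: "nat \<Rightarrow>\<^sub>0 int" and lo :: int and \<kappa> and mm :: nat
  assumes i: "1 \<le> i" "i < n" and \<nu>: "\<nu> \<in> Zn n"
  defines "lo \<equiv> min (lookup \<nu> i) (lookup \<nu> (Suc i))"
  defines "\<kappa> \<equiv> \<nu> - single i (lookup \<nu> i - lo) - single (Suc i) (lookup \<nu> (Suc i) - lo)"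
  defines "mm \<equiv> nat \<bar>lookup \<nu> i - lookup \<nu> (Suc i)\<bar>"
begin

lemma kappa_lookup: "lookup \<kappa> i = lo" "lookup \<kappa> (Suc i) = lo"
  "r \<noteq> i \<Longrightarrow> r \<noteq> Suc i \<Longrightarrow> lookup \<kappa> r = lookup \<nu> r"
  by (simp_all add: \<kappa>_def lookup_minus lookup_single)

lemma kappa_Zn: "\<kappa> \<in> Zn n"
  using \<nu> i by (auto simp: Zn_iff \<kappa>_def lookup_minus lookup_single when_def)

lemma kappa_s: "s i (xmon \<kappa>) = xmon \<kappa>"
proof -
  have "perm_vec n (sref i) \<kappa> = \<kappa>"
    using perm_sref_lookups[OF i kappa_Zn] kappa_lookup by (metis poly_mapping_eqI)
  then show ?thesis using s_xmon_perm[OF i kappa_Zn] by simp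
qed

lemma kappa_xmon: "xmon \<kappa> * (xvar i ^ a * xvar (Suc i) ^ b) =
    xmon (\<kappa> + single i (int a) + single (Suc i) (int b))"
  by (simp add: xmon_add xmon_single mult_ac)

lemma kappa_segment:
  "a + b = mm \<Longrightarrow> \<kappa> + single i (int a) + single (Suc i) (int b) \<in> segment n i \<nu>"
  using i \<nu> by (auto simp: segment_def Zn_iff lookup_add lookup_single when_def kappa_lookup mm_def lo_def
      Zn_iff[THEN iffD1, OF kappa_Zn] split: if_splits)

lemma kappa_lspan: "a + b = mm \<Longrightarrow> xmon \<kappa> * (xvar i ^ a * xvar (Suc i) ^ b) \<in> lspan (segment n i \<nu>)"
  unfolding kappa_xmon by (rule lspan_xmon[OF kappa_segment])

lemma kappa_nu:
  "\<nu> = \<kappa> + single i (if lookup \<nu> i \<ge> lookup \<nu> (Suc i) then int mm else 0)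
     + single (Suc i) (if lookup \<nu> i \<ge> lookup \<nu> (Suc i) then 0 else int mm)"
  by (rule poly_mapping_eqI) (auto simp: lookup_add lookup_single when_def kappa_lookup lo_def mm_def)

lemma T_xmon_segment: "T i (xmon \<nu>) \<in> lspan (segment n i \<nu>)"
proof (cases "lookup \<nu> i \<ge> lookup \<nu> (Suc i)")
  case True
  then have "T i (xmon \<nu>) = xmon \<kappa> * T i (xvar i ^ mm)"
    by (subst kappa_nu) (simp add: xmon_add xmon_single T_sym kappa_s)
  also have "\<dots> = xmon \<kappa> * (xvar i ^ 0 * xvar (Suc i) ^ mm)
      + (\<Sum>k<mm. cst (1 - t) * (xmon \<kappa> * (xvar i ^ Suc k * xvar (Suc i) ^ (mm - Suc k))))"
    unfolding T_power by (simp add: distrib_left sum_distrib_left mult_ac)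
  also have "\<dots> \<in> lspan (segment n i \<nu>)"
    by (intro lspan_add lspan_sum lspan_cst kappa_lspan) auto
  finally show ?thesis .
next
  case False
  then have "T i (xmon \<nu>) = xmon \<kappa> * T i (xvar (Suc i) ^ mm)"
    by (subst kappa_nu) (simp add: xmon_add xmon_single T_sym kappa_s)
  also have "\<dots> = xmon \<kappa> * (xvar i ^ 0 * xvar (Suc i) ^ mm)
      + (\<Sum>k<mm. cst t * (xmon \<kappa> * (xvar i ^ Suc k * xvar (Suc i) ^ (mm - Suc k))))
      - (\<Sum>k<mm. xmon \<kappa> * (xvar i ^ k * xvar (Suc i) ^ (mm - k)))"
    unfolding T_power_Suc by (simp add: distrib_left right_diff_distrib sum_distrib_left mult_ac)
  also have "\<dots> \<in> lspan (segment n i \<nu>)"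
    by (intro lspan_add lspan_diff lspan_sum lspan_cst kappa_lspan) auto
  finally show ?thesis .
qed

text \<open>For a descent the remaining factor is a power of x_i, and T_i x_i^m contains x_{i+1}^m
  with coefficient exactly 1.\<close>

lemma T_xmon_leading:
  assumes "lookup \<nu> i > lookup \<nu> (Suc i)"
  shows "T i (xmon \<nu>) - xmon (perm_vec n (sref i) \<nu>) \<in> lspan (segment n i \<nu> - {perm_vec n (sref i) \<nu>})"
proof -
  let ?\<nu>' = "perm_vec n (sref i) \<nu>"
  have "T i (xmon \<nu>) = xmon \<kappa> * T i (xvar i ^ mm)"
    by (subst kappa_nu) (use assms in \<open>simp add: xmon_add xmon_single T_sym kappa_s\<close>)
  also have "\<dots> = xmon \<kappa> * (xvar i ^ 0 * xvar (Suc i) ^ mm)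
      + (\<Sum>k<mm. cst (1 - t) * (xmon \<kappa> * (xvar i ^ Suc k * xvar (Suc i) ^ (mm - Suc k))))"
    unfolding T_power by (simp add: distrib_left sum_distrib_left mult_ac)
  also have "\<kappa> + single i (int 0) + single (Suc i) (int mm) = ?\<nu>'"
  proof (rule poly_mapping_eqI)
    fix r show "lookup (\<kappa> + single i (int 0) + single (Suc i) (int mm)) r = lookup ?\<nu>' r"
      using assms i \<nu> by (cases "r = i"; cases "r = Suc i")
        (auto simp: lookup_add lookup_single when_def kappa_lookup perm_sref_lookups lo_def mm_def)
  qed
  then have "xmon \<kappa> * (xvar i ^ 0 * xvar (Suc i) ^ mm) = xmon ?\<nu>'" by (simp only: kappa_xmon)
  finally have "T i (xmon \<nu>) - xmon ?\<nu>' =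
      (\<Sum>k<mm. cst (1 - t) * (xmon \<kappa> * (xvar i ^ Suc k * xvar (Suc i) ^ (mm - Suc k))))" by simp
  also have "\<dots> \<in> lspan (segment n i \<nu> - {?\<nu>'})"
  proof (intro lspan_sum lspan_cst)
    fix k assume k: "k \<in> {..<mm}"
    let ?m = "\<kappa> + single i (int (Suc k)) + single (Suc i) (int (mm - Suc k))"
    have "lookup ?m i \<noteq> lookup ?\<nu>' i"
      using assms i \<nu> by (simp add: lookup_add lookup_single when_def kappa_lookup perm_sref_lookups lo_def)
    then have "?m \<noteq> ?\<nu>'" by metis
    then show "xmon \<kappa> * (xvar i ^ Suc k * xvar (Suc i) ^ (mm - Suc k)) \<in> lspan (segment n i \<nu> - {?\<nu>'})"
      unfolding kappa_xmon using k kappa_segment[of "Suc k" "mm - Suc k"] by (intro lspan_xmon) auto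
  qed
  finally show ?thesis .
qed

end

lemma T_lspan_Zn:
  assumes "1 \<le> i" "i < n" "f \<in> lspan (Zn n)" shows "T i f \<in> lspan (Zn n)"
proof (rule lspan_map[OF assms(3), of "T i"])
  fix \<nu> assume "\<nu> \<in> Zn n"
  then have "T i (xmon \<nu>) \<in> lspan (segment n i \<nu>)" by (intro T_xmon_segment assms)
  then show "T i (xmon \<nu>) \<in> lspan (Zn n)"
    by (rule lspan_mono) (auto simp: segment_in_Zn)
qed (simp_all add: T_add T_cst)

definition monic_at :: "(nat \<Rightarrow>\<^sub>0 int) \<Rightarrow> 'k ratfun \<Rightarrow> bool" where
  "monic_at \<mu> f \<longleftrightarrow> f - xmon \<mu> \<in> lspan (below n \<mu> - {\<mu>})"

text \<open>Lower monomials stay strictly below by \<open>segment_below\<close>, and x^\<mu> itself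
  falls below the swapped monomial. Hence the scalar term of \<open>tau\<close> does not affect the
  leading coefficient, whatever a is.\<close>

lemma tau_monic:
  assumes i: "1 \<le> i" "i < n" and \<mu>: "\<mu> \<in> Zn n" "lookup \<mu> (Suc i) < lookup \<mu> i" and f: "monic_at \<mu> f"
  shows "monic_at (perm_vec n (sref i) \<mu>) (tau i a f)"
proof -
  let ?\<mu>' = "perm_vec n (sref i) \<mu>" 
  let ?g = "f - xmon \<mu>" and ?V = "lspan (below n ?\<mu>' - {?\<mu>'}) :: 'k ratfun set"
  have g: "?g \<in> lspan (below n \<mu> - {\<mu>})" using f by (simp add: monic_at_def)
  have sub: "segment n i \<nu> \<subseteq> below n ?\<mu>' - {?\<mu>'}" if "\<nu> \<in> below n \<mu> - {\<mu>}" for \<nu>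
    using segment_below[OF i \<mu>, of \<nu>] that by simp
  have "T i ?g \<in> ?V"
  proof (rule lspan_map[OF g, of "T i"])
    fix \<nu> assume \<nu>: "\<nu> \<in> below n \<mu> - {\<mu>}"
    then have "T i (xmon \<nu>) \<in> lspan (segment n i \<nu>)"
      by (intro T_xmon_segment i) (simp add: below_def)
    then show "T i (xmon \<nu>) \<in> ?V" by (rule lspan_mono) (rule sub[OF \<nu>])
  qed (simp_all add: T_add T_cst)
  moreover have "?g \<in> ?V"
  proof (rule lspan_mono[OF g], rule subsetI)
    fix \<nu> assume \<nu>: "\<nu> \<in> below n \<mu> - {\<mu>}"
    then have "\<nu> \<in> segment n i \<nu>" by (intro self_segment) (simp add: below_def)
    then show "\<nu> \<in> below n ?\<mu>' - {?\<mu>'}" using sub[OF \<nu>] by blast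
  qed
  moreover have "T i (xmon \<mu>) - xmon ?\<mu>' \<in> ?V"
    by (rule lspan_mono[OF T_xmon_leading]) (use i \<mu> segment_below_self in auto)
  moreover have "xmon \<mu> \<in> ?V"
    using segment_below_self[OF i \<mu>] self_segment[of \<mu> n i] perm_sref_neq[OF i \<mu>(1)] \<mu>
    by (intro lspan_xmon) auto
  ultimately have "T i ?g + (T i (xmon \<mu>) - xmon ?\<mu>') + cst (kap a) * (?g + xmon \<mu>) \<in> ?V"
    by (intro lspan_add lspan_cst)
  then show ?thesis by (simp add: monic_at_def tau_def T_diff algebra_simps)
qed

lemma Phi_xmon:
  assumes "\<nu> \<in> Zn n"
  shows "Phi (xmon \<nu>) = cst (q powi (- lookup \<nu> n)) * xmon (cycvec n \<nu>)"
proof -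
  have "cval qn \<nu> = (\<Prod>i\<in>{1..n}. qn i powi lookup \<nu> i)"
    using assms by (intro cval_superset) (auto simp: Zn_def)
  also have "\<dots> = (\<Prod>i\<in>{1..n}. if i = n then inverse q powi lookup \<nu> i else 1)"
    by (intro prod.cong) (auto simp: qn_def)
  also have "\<dots> = q powi (- lookup \<nu> n)"
    using n_pos by (simp add: power_int_minus power_int_inverse)
  finally have c: "cval qn \<nu> = q powi (- lookup \<nu> n)" .
  have "single 1 1 + pmap cyc \<nu> = cycvec n \<nu>"
  proof (rule poly_mapping_eqI)
    fix j
    have inv: "lookup (pmap cyc \<nu>) j = lookup \<nu> k" if "j = cyc k" for k
      using that lookup_pmap'[OF bij_cyc] by simp
    show "lookup (single 1 1 + pmap cyc \<nu>) j = lookup (cycvec n \<nu>) j"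
    proof (cases "j \<in> {1..n}")
      case False
      then have "j = cyc j" using n_pos by (auto simp: cyc_def)
      then show ?thesis using False inv[of j] n_pos Zn_lookup_0[OF assms False] Zn_lookup_0[OF cycvec_in_Zn False]
        by (auto simp: lookup_add lookup_single when_def)
    next
      case True
      show ?thesis
      proof (cases "j = 1")
        case True
        then show ?thesis using n_pos inv[of n]
          by (auto simp: lookup_add lookup_single when_def lookup_cycvec cyc_def)
      next
        case False
        then have "j = cyc (j - 1)" using True by (auto simp: cyc_def)
        then show ?thesis using True False inv[of "j - 1"]
          by (auto simp: lookup_add lookup_single when_def lookup_cycvec)
      qed
    qed
  qed
  then show ?thesis unfolding Phi_def om_def om.msub_xmon c xvar_xmon
    by (metis mult.left_commute xmon_add)
qed

text \<open>This is the purpose of the scalar in (E1): it cancels the power of q created by the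
  rotation of x^\<mu>.\<close>

lemma Phi_monic:
  assumes "\<mu> \<in> Zn n" "monic_at \<mu> f"
  shows "monic_at (cycvec n \<mu>) (cst (q powi lookup \<mu> n) * Phi f)"
proof -
  have "Phi (f - xmon \<mu>) \<in> lspan (below n (cycvec n \<mu>) - {cycvec n \<mu>})"
  proof (rule lspan_map[of _ "below n \<mu> - {\<mu>}" Phi])
    show "f - xmon \<mu> \<in> lspan (below n \<mu> - {\<mu>})" using assms by (simp add: monic_at_def)
    fix \<nu> assume \<nu>: "\<nu> \<in> below n \<mu> - {\<mu>}"
    then have "\<nu> \<in> Zn n" by (simp add: below_def)
    moreover from this have "cycvec n \<nu> \<noteq> cycvec n \<mu>" using \<nu> cycvec_inj[OF n_pos] assms by auto
    ultimately show "Phi (xmon \<nu>) \<in> lspan (below n (cycvec n \<mu>) - {cycvec n \<mu>})"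
      using \<nu> cycvec_below[OF n_pos] by (simp add: Phi_xmon) (rule lspan_cst_xmon, simp)
  qed (simp_all add: Phi_add Phi_cst, simp add: Phi_def)
  then have "cst (q powi lookup \<mu> n) * Phi (f - xmon \<mu>) \<in> lspan (below n (cycvec n \<mu>) - {cycvec n \<mu>})"
    by (rule lspan_cst)
  moreover have "cst (q powi lookup \<mu> n) * Phi (f - xmon \<mu>) =
      cst (q powi lookup \<mu> n) * Phi f - xmon (cycvec n \<mu>)"
  proof -
    have "Phi (f - xmon \<mu>) = Phi f - Phi (xmon \<mu>)"
      using Phi_add[of "f - xmon \<mu>" "xmon \<mu>"] by simp
    moreover have "cst (q powi lookup \<mu> n) * Phi (xmon \<mu>) = xmon (cycvec n \<mu>)"
      by (simp add: Phi_xmon assms power_int_minus cst_inverse cst_powi flip: mult.assoc)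
    ultimately show ?thesis by (simp add: right_diff_distrib)
  qed
  ultimately show ?thesis by (simp add: monic_at_def)
qed

end

section \<open>Spectral vectors\<close>

text \<open>Positions ordered by value and, among equal values, from left to right.
  \<open>vperm\<close> is the rank in this order, so it is transported by every bijection that
  respects the order.\<close>

definition vbefore :: "(nat \<Rightarrow>\<^sub>0 int) \<Rightarrow> nat \<Rightarrow> nat \<Rightarrow> bool" where
  "vbefore \<mu> r' r \<longleftrightarrow> lookup \<mu> r' < lookup \<mu> r \<or> lookup \<mu> r' = lookup \<mu> r \<and> r' < r"

lemma vperm_vbefore: "vperm n \<mu> r = 1 + card {r' \<in> {1..n}. vbefore \<mu> r' r}"
proof -
  have "{r' \<in> {1..n}. vbefore \<mu> r' r} =
      {r' \<in> {1..n}. r' < r \<and> lookup \<mu> r' \<le> lookup \<mu> r} \<union> {r' \<in> {1..n}. r' > r \<and> lookup \<mu> r' < lookup \<mu> r}"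
  proof (rule set_eqI)
    fix x show "x \<in> {r' \<in> {1..n}. vbefore \<mu> r' r} \<longleftrightarrow> x \<in> {r' \<in> {1..n}. r' < r \<and> lookup \<mu> r' \<le> lookup \<mu> r} \<union> {r' \<in> {1..n}. r' > r \<and> lookup \<mu> r' < lookup \<mu> r}"
      by (cases x r rule: linorder_cases) (auto simp: vbefore_def)
  qed
  then show ?thesis unfolding vperm_def by (simp add: card_Un_disjoint disjoint_iff)
qed

lemma vperm_transport:
  assumes b: "bij_betw g {1..n} {1..n}" and r: "r \<in> {1..n}"
    and v: "\<And>r'. r' \<in> {1..n} \<Longrightarrow> vbefore \<nu> (g r') (g r) \<longleftrightarrow> vbefore \<mu> r' r"
  shows "vperm n \<nu> (g r) = vperm n \<mu> r"
proof -
  have "{r' \<in> {1..n}. vbefore \<nu> r' (g r)} = g ` {r' \<in> {1..n}. vbefore \<mu> r' r}"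
  proof (intro equalityI subsetI)
    fix x assume x: "x \<in> {r' \<in> {1..n}. vbefore \<nu> r' (g r)}"
    then have "x \<in> g ` {1..n}" using bij_betw_imp_surj_on[OF b] by simp
    then obtain y where "y \<in> {1..n}" "x = g y" by blast
    then show "x \<in> g ` {r' \<in> {1..n}. vbefore \<mu> r' r}" using x v by auto
  next
    fix x assume "x \<in> g ` {r' \<in> {1..n}. vbefore \<mu> r' r}"
    then show "x \<in> {r' \<in> {1..n}. vbefore \<nu> r' (g r)}" using v bij_betw_apply[OF b] by blast
  qed
  moreover have "inj_on g {r' \<in> {1..n}. vbefore \<mu> r' r}"
    using bij_betw_imp_inj_on[OF b] by (rule inj_on_subset) auto
  ultimately show ?thesis unfolding vperm_vbefore by (simp add: card_image)
qed

lemma vperm_sref: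
  assumes i: "1 \<le> i" "i < n" and ne: "lookup \<mu> i \<noteq> lookup \<mu> (Suc i)" and r: "r \<in> {1..n}"
  shows "vperm n (perm_vec n (sref i) \<mu>) (sref i r) = vperm n \<mu> r"
proof (rule vperm_transport[OF _ r])
  show "bij_betw (sref i) {1..n} {1..n}"
    using sref_permutes[OF i] by (rule permutes_imp_bij)
  fix r' assume r': "r' \<in> {1..n}"
  have lk: "lookup (perm_vec n (sref i) \<mu>) (sref i k) = lookup \<mu> k" if "k \<in> {1..n}" for k
    using that sref_range[OF i, of k] by (simp add: lookup_perm_sref) (simp add: sref_def)
  show "vbefore (perm_vec n (sref i) \<mu>) (sref i r') (sref i r) \<longleftrightarrow> vbefore \<mu> r' r"
    unfolding vbefore_def lk[OF r] lk[OF r'] using ne by (auto simp: sref_def transpose_def)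
qed

text \<open>Makes the exponent of t in the parameter a of (E2) positive at a descent.\<close>

lemma vperm_less:
  assumes "1 \<le> i" "i < n" "lookup \<mu> (Suc i) < lookup \<mu> i"
  shows "vperm n \<mu> (Suc i) < vperm n \<mu> i"
  unfolding vperm_vbefore
proof (intro add_strict_left_mono psubset_card_mono psubsetI)
  show "{r' \<in> {1..n}. vbefore \<mu> r' (Suc i)} \<subseteq> {r' \<in> {1..n}. vbefore \<mu> r' i}"
    using assms by (auto simp: vbefore_def)
  have "Suc i \<in> {r' \<in> {1..n}. vbefore \<mu> r' i}" "Suc i \<notin> {r' \<in> {1..n}. vbefore \<mu> r' (Suc i)}"
    using assms by (auto simp: vbefore_def)
  then show "{r' \<in> {1..n}. vbefore \<mu> r' (Suc i)} \<noteq> {r' \<in> {1..n}. vbefore \<mu> r' i}" by blast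
qed simp

lemma vperm_0:
  assumes "r \<in> {1..n}" shows "vperm n 0 r = r"
proof -
  have "{r' \<in> {1..n}. vbefore 0 r' r} = {1..<r}" using assms by (auto simp: vbefore_def)
  then show ?thesis using assms by (simp add: vperm_vbefore)
qed

definition nonneg :: "nat \<Rightarrow> (nat \<Rightarrow>\<^sub>0 int) \<Rightarrow> bool" where
  "nonneg n \<mu> \<longleftrightarrow> \<mu> \<in> Zn n \<and> (\<forall>j\<in>{1..n}. 0 \<le> lookup \<mu> j)"

lemma nonneg_Zn: "nonneg n \<mu> \<Longrightarrow> \<mu> \<in> Zn n" by (simp add: nonneg_def)

lemma nonneg_0 [simp]: "nonneg n 0" by (simp add: nonneg_def)

abbreviation swap :: "nat \<Rightarrow> nat \<Rightarrow> (nat \<Rightarrow>\<^sub>0 int) \<Rightarrow> (nat \<Rightarrow>\<^sub>0 int)" where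
  "swap n i \<equiv> perm_vec n (sref i)"

lemma swap_swap: "1 \<le> i \<Longrightarrow> i < n \<Longrightarrow> \<mu> \<in> Zn n \<Longrightarrow> swap n i (swap n i \<mu>) = \<mu>"
  by (rule poly_mapping_eqI) (metis perm_sref_lookups perm_vec_in_Zn)

lemma nonneg_swap: "1 \<le> i \<Longrightarrow> i < n \<Longrightarrow> nonneg n \<mu> \<Longrightarrow> nonneg n (swap n i \<mu>)"
  unfolding nonneg_def using sref_range[of i n] by (auto simp: lookup_perm_sref)

lemma weight_swap: "1 \<le> i \<Longrightarrow> i < n \<Longrightarrow> \<mu> \<in> Zn n \<Longrightarrow> weight n (swap n i \<mu>) = weight n \<mu>"
  using segment_weight perm_sref_segment by metis

lemma nonneg_cycvec: "n \<ge> 1 \<Longrightarrow> nonneg n \<mu> \<Longrightarrow> nonneg n (cycvec n \<mu>)"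
proof -
  assume n: "n \<ge> 1" "nonneg n \<mu>"
  have "0 \<le> lookup (cycvec n \<mu>) j" if "j \<in> {1..n}" for j
  proof -
    have "n \<in> {1..n}" "j \<noteq> 1 \<Longrightarrow> j - 1 \<in> {1..n}" using n that by auto
    then have "0 \<le> lookup \<mu> n" "j \<noteq> 1 \<Longrightarrow> 0 \<le> lookup \<mu> (j - 1)"
      using n(2) unfolding nonneg_def by blast+
    then show ?thesis using that by (simp add: lookup_cycvec)
  qed
  then show ?thesis by (simp add: nonneg_def)
qed

lemma weight_cycvec: "n \<ge> 1 \<Longrightarrow> weight n (cycvec n \<mu>) = weight n \<mu> + 1"
  unfolding weight_def using sum_cycvec[of n "\<lambda>r v. v"] sum_last[of n] by simp

lemma weight_nonneg: "nonneg n \<mu> \<Longrightarrow> 0 \<le> weight n \<mu>"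
  unfolding weight_def nonneg_def by (auto intro: sum_nonneg)

definition dcycvec :: "nat \<Rightarrow> (nat \<Rightarrow>\<^sub>0 int) \<Rightarrow> (nat \<Rightarrow>\<^sub>0 int)" where
  "dcycvec n \<mu> = zvec n (\<lambda>i. if i = n then lookup \<mu> 1 - 1 else lookup \<mu> (Suc i))"

lemma lookup_dcycvec:
  "1 \<le> i \<Longrightarrow> i \<le> n \<Longrightarrow> lookup (dcycvec n \<mu>) i = (if i = n then lookup \<mu> 1 - 1 else lookup \<mu> (Suc i))"
  by (simp add: dcycvec_def lookup_zvec)

lemma dcycvec_in_Zn [simp]: "dcycvec n \<mu> \<in> Zn n" by (simp add: dcycvec_def)

lemma cycvec_dcycvec: "n \<ge> 1 \<Longrightarrow> \<mu> \<in> Zn n \<Longrightarrow> cycvec n (dcycvec n \<mu>) = \<mu>"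
  by (rule Zn_eqI[of _ n]) (auto simp: lookup_cycvec lookup_dcycvec)

lemma dcycvec_cycvec: "n \<ge> 1 \<Longrightarrow> \<mu> \<in> Zn n \<Longrightarrow> dcycvec n (cycvec n \<mu>) = \<mu>"
  by (rule Zn_eqI[of _ n]) (auto simp: lookup_cycvec lookup_dcycvec)

lemma nonneg_dcycvec: "n \<ge> 1 \<Longrightarrow> nonneg n \<mu> \<Longrightarrow> lookup \<mu> 1 > 0 \<Longrightarrow> nonneg n (dcycvec n \<mu>)"
  unfolding nonneg_def by (auto simp: lookup_dcycvec)

lemma weight_dcycvec: "n \<ge> 1 \<Longrightarrow> \<mu> \<in> Zn n \<Longrightarrow> weight n (dcycvec n \<mu>) = weight n \<mu> - 1"
  using weight_cycvec[of n "dcycvec n \<mu>"] by (simp add: cycvec_dcycvec)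

lemma swap_cycvec:
  assumes "1 \<le> i" "Suc i < n" "\<mu> \<in> Zn n"
  shows "swap n (Suc i) (cycvec n \<mu>) = cycvec n (swap n i \<mu>)"
proof (rule Zn_eqI[of _ n])
  fix j assume j: "1 \<le> j" "j \<le> n"
  show "lookup (swap n (Suc i) (cycvec n \<mu>)) j = lookup (cycvec n (swap n i \<mu>)) j"
    using j assms sref_range[of "Suc i" n j]
    by (cases "j = 1")
       (simp_all add: lookup_perm_sref lookup_cycvec, auto simp: sref_def transpose_def)
qed auto

lemma swap_cycvec_cycvec:
  assumes "n \<ge> 2" "\<mu> \<in> Zn n"
  shows "swap n 1 (cycvec n (cycvec n \<mu>)) = cycvec n (cycvec n (swap n (n - 1) \<mu>))"
proof (rule Zn_eqI[of _ n])
  fix j assume j: "1 \<le> j" "j \<le> n"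
  show "lookup (swap n 1 (cycvec n (cycvec n \<mu>))) j = lookup (cycvec n (cycvec n (swap n (n - 1) \<mu>))) j"
  proof -
    have cc: "lookup (cycvec n (cycvec n \<kappa>)) k =
        (if k = 1 then lookup \<kappa> (n - 1) + 1 else if k = 2 then lookup \<kappa> n + 1 else lookup \<kappa> (k - 2))"
      if "1 \<le> k" "k \<le> n" for k \<kappa>
      using that assms by (auto simp: lookup_cycvec numeral_2_eq_2)
    have L: "lookup (swap n 1 (cycvec n (cycvec n \<mu>))) j = lookup (cycvec n (cycvec n \<mu>)) (sref 1 j)"
      using j by (rule lookup_perm_sref)
    have n1: "lookup (swap n (n - 1) \<mu>) (n - 1) = lookup \<mu> n" "lookup (swap n (n - 1) \<mu>) n = lookup \<mu> (n - 1)"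
      using perm_sref_lookups(1,2)[of "n - 1" n \<mu>] assms by auto
    have n2: "lookup (swap n (n - 1) \<mu>) (j - 2) = lookup \<mu> (j - 2)"
      using perm_sref_lookups(3)[of "n - 1" n \<mu> "j - 2"] assms j by auto
    consider "j = 1" | "j = 2" | "3 \<le> j" using j by linarith
    then show ?thesis
    proof cases
      case 1
      then have "sref 1 j = 2" by (simp add: sref_def)
      then show ?thesis unfolding L using 1 assms by (simp add: cc n1[simplified])
    next
      case 2
      then have "sref 1 j = 1" by (simp add: sref_def transpose_def)
      then show ?thesis unfolding L using 2 assms by (simp add: cc n1[simplified])
    next
      case 3
      then have "sref 1 j = j" by simp
      then show ?thesis unfolding L using 3 j by (simp add: cc n2[simplified])
    qed
  qed
qed auto

definition fpos :: "(nat \<Rightarrow>\<^sub>0 int) \<Rightarrow> nat" where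
  "fpos \<mu> = (LEAST j. 1 \<le> j \<and> lookup \<mu> j > 0)"

lemma fpos_eqI:
  assumes "1 \<le> p" "lookup \<mu> p > 0" "\<And>j. 1 \<le> j \<Longrightarrow> j < p \<Longrightarrow> lookup \<mu> j \<le> 0"
  shows "fpos \<mu> = p"
  unfolding fpos_def using assms by (intro Least_equality) (auto simp: not_less[symmetric])

lemma fpos_props:
  assumes "nonneg n \<mu>" "\<mu> \<noteq> 0"
  shows "1 \<le> fpos \<mu>" "fpos \<mu> \<le> n" "lookup \<mu> (fpos \<mu>) > 0"
    "\<And>j. 1 \<le> j \<Longrightarrow> j < fpos \<mu> \<Longrightarrow> lookup \<mu> j = 0"
proof -
  have "\<exists>j. 1 \<le> j \<and> lookup \<mu> j > 0"
  proof (rule ccontr)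
    assume "\<not> ?thesis"
    then have "\<mu> = 0" using assms(1) by (intro Zn_eqI[of _ n]) (force simp: nonneg_def)+
    then show False using assms by simp
  qed
  then have L: "1 \<le> fpos \<mu> \<and> lookup \<mu> (fpos \<mu>) > 0" unfolding fpos_def by (rule LeastI_ex)
  then show "1 \<le> fpos \<mu>" "lookup \<mu> (fpos \<mu>) > 0" by auto
  show le: "fpos \<mu> \<le> n"
    using L Zn_lookup_0[OF nonneg_Zn[OF assms(1)], of "fpos \<mu>"] by fastforce
  fix j assume "1 \<le> j" "j < fpos \<mu>"
  then have "\<not> lookup \<mu> j > 0" using not_less_Least[of j "\<lambda>j. 1 \<le> j \<and> lookup \<mu> j > 0"]
    by (auto simp: fpos_def)
  moreover have "0 \<le> lookup \<mu> j" using assms(1) le \<open>1 \<le> j\<close> \<open>j < fpos \<mu>\<close> by (simp add: nonneg_def)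
  ultimately show "lookup \<mu> j = 0" by simp
qed

text \<open>Exactly the powers that occur as a in the denominators 1 - a of (E2)
  (\<open>ratio_generic\<close>). The locale is instantiated both at (q, t) and at (q, q t).\<close>

locale macdonald = hecke +
  assumes generic: "m > 0 \<Longrightarrow> k > 0 \<Longrightarrow> q ^ m * t ^ k \<noteq> 1"
begin

text \<open>The spectral vector: the eigenvalue of \<open>Y m\<close> on E_\<mu> is t divided by the
  entry of index m + 1, and the parameter a of (E2) is a quotient of neighbouring entries.\<close>

definition sp :: "(nat \<Rightarrow>\<^sub>0 int) \<Rightarrow> nat \<Rightarrow> 'a" where
  "sp \<mu> r = q powi lookup \<mu> r * t powi int (vperm n \<mu> r)"

definition ratio :: "nat \<Rightarrow> (nat \<Rightarrow>\<^sub>0 int) \<Rightarrow> 'a" where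
  "ratio i \<mu> = sp \<mu> i / sp \<mu> (Suc i)"

lemma sp_nonzero [simp]: "sp \<mu> r \<noteq> 0" by (simp add: sp_def)

lemma ratio_eq:
  "ratio i \<mu> = q powi (lookup \<mu> i - lookup \<mu> (Suc i)) * t powi (int (vperm n \<mu> i) - int (vperm n \<mu> (Suc i)))"
  unfolding ratio_def sp_def by (simp add: power_int_diff)

lemma ratio_generic:
  assumes "1 \<le> i" "i < n" "lookup \<mu> (Suc i) < lookup \<mu> i"
  shows "ratio i \<mu> \<noteq> 1"
proof -
  have "ratio i \<mu> = q ^ nat (lookup \<mu> i - lookup \<mu> (Suc i)) * t ^ (vperm n \<mu> i - vperm n \<mu> (Suc i))"
    unfolding ratio_eq using assms vperm_less[OF assms]
    by (simp add: power_int_def nat_diff_distrib)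
  then show ?thesis using generic assms vperm_less[OF assms] by simp
qed

lemma sp_swap:
  assumes "1 \<le> i" "i < n" "\<mu> \<in> Zn n" "lookup \<mu> i \<noteq> lookup \<mu> (Suc i)"
  shows "sp (swap n i \<mu>) i = sp \<mu> (Suc i)" "sp (swap n i \<mu>) (Suc i) = sp \<mu> i"
    "1 \<le> r \<Longrightarrow> r \<le> n \<Longrightarrow> r \<noteq> i \<Longrightarrow> r \<noteq> Suc i \<Longrightarrow> sp (swap n i \<mu>) r = sp \<mu> r"
  using assms vperm_sref[OF assms(1,2,4), of "Suc i"] vperm_sref[OF assms(1,2,4), of i]
    vperm_sref[OF assms(1,2,4), of r]
  by (auto simp: sp_def perm_sref_lookups)

lemma sp_cycvec:
  assumes "\<mu> \<in> Zn n" "r \<in> {1..n}"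
  shows "sp (cycvec n \<mu>) (cyc r) = (if r = n then q * sp \<mu> n else sp \<mu> r)"
proof -
  have "vperm n (cycvec n \<mu>) (cyc r) = vperm n \<mu> r"
  proof (rule vperm_transport[OF _ assms(2)])
    have "cyc permutes {1..n}"
      using n_pos bij_cyc by (auto simp: permutes_def cyc_def bij_iff)
    then show "bij_betw cyc {1..n} {1..n}" by (rule permutes_imp_bij)
    fix r' assume r': "r' \<in> {1..n}"
    show "vbefore (cycvec n \<mu>) (cyc r') (cyc r) \<longleftrightarrow> vbefore \<mu> r' r"
      using assms(2) r' n_pos by (auto simp: vbefore_def cyc_def lookup_cycvec)
  qed
  then show ?thesis
    using assms n_pos by (auto simp: sp_def lookup_cycvec cyc_def power_int_add)
qed

lemma sp_cycvec_Suc: "\<mu> \<in> Zn n \<Longrightarrow> 1 \<le> r \<Longrightarrow> r < n \<Longrightarrow> sp (cycvec n \<mu>) (Suc r) = sp \<mu> r"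
  using sp_cycvec[of \<mu> r] by (simp add: cyc_def)

lemma sp_cycvec_1: "\<mu> \<in> Zn n \<Longrightarrow> sp (cycvec n \<mu>) 1 = q * sp \<mu> n"
  using sp_cycvec[of \<mu> n] n_pos by (simp add: cyc_def)

section \<open>Construction of the electronic polynomials\<close>

text \<open>One preferred path to each nonnegative vector: if the first entry is positive, (E1) is
  undone; otherwise the first positive entry moves one place to the left. The weight, and then the
  position \<open>fpos\<close>, decrease. The value 1 outside the nonnegative vectors is a
  default.\<close>

function elec :: "(nat \<Rightarrow>\<^sub>0 int) \<Rightarrow> 'a ratfun" where
  "elec \<mu> = (if \<not> nonneg n \<mu> \<or> \<mu> = 0 then 1
     else if lookup \<mu> 1 > 0 then cst (q powi (lookup \<mu> 1 - 1)) * Phi (elec (dcycvec n \<mu>))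
     else let k = fpos \<mu> - 1 in tau k (ratio k (swap n k \<mu>)) (elec (swap n k \<mu>)))"
  by pat_completeness auto

lemma fpos_swap:
  assumes "nonneg n \<mu>" "\<mu> \<noteq> 0" "\<not> lookup \<mu> 1 > 0"
  defines "k \<equiv> fpos \<mu> - 1"
  shows "1 \<le> k" "k < n" "fpos \<mu> = Suc k" "fpos (swap n k \<mu>) = k"
proof -
  note fp = fpos_props[OF assms(1,2)]
  have "fpos \<mu> \<noteq> 1" using fp assms by metis
  then show k: "1 \<le> k" "k < n" "fpos \<mu> = Suc k" using fp by (auto simp: k_def)
  show "fpos (swap n k \<mu>) = k"
    using fp k nonneg_Zn[OF assms(1)] by (intro fpos_eqI) (auto simp: perm_sref_lookups)
qed

termination elec
proof (relation "measures [\<lambda>\<mu>. nat (weight n \<mu>), fpos]")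
  show "wf (measures [\<lambda>\<mu>. nat (weight n \<mu>), fpos])" by simp
next
  fix \<mu> assume "\<not> (\<not> nonneg n \<mu> \<or> \<mu> = 0)" "lookup \<mu> 1 > 0"
  then have "nonneg n (dcycvec n \<mu>)" and "\<mu> \<in> Zn n" using nonneg_dcycvec n_pos nonneg_Zn by auto
  then show "(dcycvec n \<mu>, \<mu>) \<in> measures [\<lambda>\<mu>. nat (weight n \<mu>), fpos]"
    using weight_nonneg[of n "dcycvec n \<mu>"] weight_dcycvec[OF n_pos, of \<mu>] by simp
next
  fix \<mu> k assume *: "\<not> (\<not> nonneg n \<mu> \<or> \<mu> = 0)" "\<not> lookup \<mu> 1 > 0" "k = fpos \<mu> - 1"
  then show "(swap n k \<mu>, \<mu>) \<in> measures [\<lambda>\<mu>. nat (weight n \<mu>), fpos]"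
    using fpos_swap[of \<mu>] weight_swap[of k n \<mu>] nonneg_Zn[of n \<mu>] by auto
qed

declare elec.simps [simp del]

lemma elec_0 [simp]: "elec 0 = 1" by (simp add: elec.simps)

lemma cycvec_first: "nonneg n \<mu> \<Longrightarrow> lookup (cycvec n \<mu>) 1 > 0"
  using n_pos by (auto simp: lookup_cycvec nonneg_def)

lemma elec_cycvec:
  assumes "nonneg n \<mu>"
  shows "elec (cycvec n \<mu>) = cst (q powi lookup \<mu> n) * Phi (elec \<mu>)"
proof -
  have "cycvec n \<mu> \<noteq> 0" using cycvec_first[OF assms] by auto
  then show ?thesis
    using assms n_pos nonneg_cycvec[OF n_pos assms] cycvec_first[OF assms]
    by (subst elec.simps) (simp add: dcycvec_cycvec nonneg_Zn lookup_cycvec)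
qed

text \<open>The steps of type (E2) on the preferred path: the first positive entry, at k, is
  exchanged with a zero directly to its right.\<close>

definition canonical :: "nat \<Rightarrow> (nat \<Rightarrow>\<^sub>0 int) \<Rightarrow> bool" where
  "canonical k \<mu> \<longleftrightarrow> nonneg n \<mu> \<and> 1 \<le> k \<and> k < n \<and> lookup \<mu> k > 0 \<and> lookup \<mu> (Suc k) = 0 \<and>
     (\<forall>j. 1 \<le> j \<longrightarrow> j < k \<longrightarrow> lookup \<mu> j = 0)"

lemma elec_canonical:
  assumes "canonical k \<mu>"
  shows "elec (swap n k \<mu>) = tau k (ratio k \<mu>) (elec \<mu>)" "fpos \<mu> = k" "fpos (swap n k \<mu>) = Suc k"
proof -
  have k: "nonneg n \<mu>" "1 \<le> k" "k < n" and Zn: "\<mu> \<in> Zn n"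
    using assms nonneg_Zn by (auto simp: canonical_def)
  show fp: "fpos (swap n k \<mu>) = Suc k" 
    using assms k Zn by (intro fpos_eqI) (auto simp: canonical_def perm_sref_lookups less_Suc_eq)
  show "fpos \<mu> = k" using assms by (intro fpos_eqI) (auto simp: canonical_def)
  have "lookup (swap n k \<mu>) 1 \<le> 0"
    using assms k Zn by (cases "k = 1") (auto simp: canonical_def perm_sref_lookups)
  moreover have "swap n k \<mu> \<noteq> 0"
    using perm_sref_lookups(2)[OF k(2,3) Zn] assms by (auto simp: canonical_def)
  ultimately show "elec (swap n k \<mu>) = tau k (ratio k \<mu>) (elec \<mu>)"
    using k fp by (subst elec.simps) (simp add: nonneg_swap swap_swap Zn)
qed

lemma nonneg_cases:
  assumes "nonneg n \<mu>"
  obtains "\<mu> = 0"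
  | \<nu> where "nonneg n \<nu>" "\<mu> = cycvec n \<nu>" "nat (weight n \<nu>) < nat (weight n \<mu>)"
  | k \<nu> where "canonical k \<nu>" "\<mu> = swap n k \<nu>" "weight n \<nu> = weight n \<mu>" "fpos \<nu> = k" "fpos \<mu> = Suc k"
proof -
  have Zn: "\<mu> \<in> Zn n" using assms by (rule nonneg_Zn)
  consider "\<mu> = 0" | "\<mu> \<noteq> 0" "lookup \<mu> 1 > 0" | "\<mu> \<noteq> 0" "\<not> lookup \<mu> 1 > 0" by blast
  then show thesis
  proof cases
    case 2
    have "nonneg n (dcycvec n \<mu>)" using nonneg_dcycvec[OF n_pos assms] 2 by simp
    then show thesis
      using that(2)[OF _ cycvec_dcycvec[OF n_pos Zn, symmetric]] weight_nonneg[of n "dcycvec n \<mu>"]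
        weight_dcycvec[OF n_pos Zn]
      by simp
  next
    case 3
    define k where "k = fpos \<mu> - 1"
    note fp = fpos_props[OF assms 3(1)]
    note k = fpos_swap[OF assms 3, folded k_def]
    have "canonical k (swap n k \<mu>)"
      using fp k assms Zn unfolding canonical_def by (auto simp: nonneg_swap perm_sref_lookups)
    then show thesis
      using that(3)[of k "swap n k \<mu>"] k Zn by (simp add: swap_swap weight_swap)
  qed (use that in blast)
qed

lemma nonneg_induct [consumes 1, case_names zero cycvec canonical]:
  assumes "nonneg n \<mu>"
    and "P 0" and "\<And>\<nu>. nonneg n \<nu> \<Longrightarrow> P \<nu> \<Longrightarrow> P (cycvec n \<nu>)"
    and "\<And>k \<nu>. canonical k \<nu> \<Longrightarrow> P \<nu> \<Longrightarrow> P (swap n k \<nu>)"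
  shows "P \<mu>"
proof -
  have "wf (measures [\<lambda>\<mu>. nat (weight n \<mu>), fpos])" by simp
  then show ?thesis using assms(1)
  proof (induction \<mu>)
    case (less \<mu>)
    from \<open>nonneg n \<mu>\<close> show ?case
    proof (cases rule: nonneg_cases)
      case (2 \<nu>)
      then show ?thesis using less assms(3) by simp
    next
      case (3 k \<nu>)
      then have "nonneg n \<nu>" by (simp add: canonical_def)
      then show ?thesis using less assms(4) 3 by simp
    qed (simp add: assms(2))
  qed
qed

lemma canonicalD:
  assumes "canonical k \<nu>"
  shows "nonneg n \<nu>" "\<nu> \<in> Zn n" "1 \<le> k" "k < n" "lookup \<nu> (Suc k) < lookup \<nu> k"
  using assms nonneg_Zn by (auto simp: canonical_def)

lemma elec_monic: "nonneg n \<mu> \<Longrightarrow> monic_at \<mu> (elec \<mu>)"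
proof (induction rule: nonneg_induct)
  case zero
  then show ?case by (simp add: monic_at_def)
next
  case (cycvec \<nu>)
  then show ?case by (simp add: elec_cycvec Phi_monic nonneg_Zn)
next
  case (canonical k \<nu>)
  then show ?case using canonicalD[OF canonical(1)] by (simp add: elec_canonical tau_monic)
qed

definition joint_eigen :: "(nat \<Rightarrow>\<^sub>0 int) \<Rightarrow> 'a ratfun \<Rightarrow> bool" where
  "joint_eigen \<mu> f \<longleftrightarrow> (\<forall>m<n. Y m f = cst (t / sp \<mu> (Suc m)) * f)"

lemma tau_eigen:
  assumes "1 \<le> i" "i < n" "\<mu> \<in> Zn n" "lookup \<mu> (Suc i) < lookup \<mu> i" "joint_eigen \<mu> f"
  shows "joint_eigen (swap n i \<mu>) (tau i (ratio i \<mu>) f)"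
  unfolding joint_eigen_def
proof (intro allI impI)
  obtain k where k: "i = Suc k" using assms(1) by (cases i) auto
  fix m assume m: "m < n"
  let ?y = "t / sp \<mu> i" and ?y' = "t / sp \<mu> (Suc i)"
  have Y: "Y k f = cst ?y * f" "Y (Suc k) f = cst ?y' * f"
    using assms k by (auto simp: joint_eigen_def)
  have r: "ratio i \<mu> \<noteq> 1" using ratio_generic assms by blast
  then have "sp \<mu> i \<noteq> sp \<mu> (Suc i)" by (simp add: ratio_def)
  then have ne: "?y \<noteq> ?y'" by (simp add: field_simps)
  \<comment> \<open>The constant in (E2) is the one that \<open>T_intertwine\<close> forces, because
    a is the quotient y'/y of the two eigenvalues.\<close>
  have "kap (ratio i \<mu>) * (?y - ?y') = (1 - t) * ?y'"
    using r \<open>sp \<mu> i \<noteq> sp \<mu> (Suc i)\<close> by (simp add: kap_def ratio_def divide_simps) (simp add: algebra_simps)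
  note I = T_intertwine[OF Y ne this, folded k tau_def]
  consider "m = k" | "m = i" | "i \<noteq> m" "i \<noteq> Suc m" using k by blast
  then show "Y m (tau i (ratio i \<mu>) f) = cst (t / sp (swap n i \<mu>) (Suc m)) * tau i (ratio i \<mu>) f"
  proof cases
    case 1
    then show ?thesis using I(1) assms k by (simp add: sp_swap)
  next
    case 2
    then show ?thesis using I(2) assms by (simp add: sp_swap)
  next
    case 3
    then have "Y m (T i f) = T i (Y m f)" using Y_T_comm assms m by simp
    moreover have "Y m f = cst (t / sp \<mu> (Suc m)) * f" using assms m by (simp add: joint_eigen_def)
    moreover have "sp (swap n i \<mu>) (Suc m) = sp \<mu> (Suc m)" using assms m 3 by (intro sp_swap) auto
    ultimately show ?thesis unfolding tau_def Y_add Y_cst by (simp add: T_cst) (simp add: algebra_simps)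
  qed
qed

lemma Phi_eigen:
  assumes "\<mu> \<in> Zn n" "joint_eigen \<mu> f"
  shows "joint_eigen (cycvec n \<mu>) (cst c * Phi f)"
  unfolding joint_eigen_def
proof (intro allI impI)
  fix m assume m: "m < n"
  have Y: "Y k f = cst (t / sp \<mu> (Suc k)) * f" if "k < n" for k using that assms by (simp add: joint_eigen_def)
  have "Y m (Phi f) = cst (t / sp (cycvec n \<mu>) (Suc m)) * Phi f"
  proof (cases m)
    case 0
    have "n - 1 < n" "Suc (n - 1) = n" using n_pos by auto
    then have "Y 0 (Phi f) = cst (inverse q) * (cst (t / sp \<mu> n) * Phi f)"
      by (simp only: Phi_Y_last Phi_cst Y)
    also have "\<dots> = cst (t / sp (cycvec n \<mu>) 1) * Phi f"
      using assms by (simp add: sp_cycvec_1 cst_divide cst_mult cst_inverse divide_inverse del: One_nat_def)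
    finally show ?thesis using 0 by simp
  next
    case (Suc k)
    then show ?thesis using m assms Phi_Y[of k f] Y[of k] by (simp add: Phi_cst sp_cycvec_Suc)
  qed
  then show "Y m (cst c * Phi f) = cst (t / sp (cycvec n \<mu>) (Suc m)) * (cst c * Phi f)"
    by (simp only: Y_cst mult.left_commute)
qed

lemma elec_eigen: "nonneg n \<mu> \<Longrightarrow> joint_eigen \<mu> (elec \<mu>)"
proof (induction rule: nonneg_induct)
  case zero
  have "Y m 1 = cst (inverse t ^ m)" if "m < n" for m
  proof -
    have "up m 1 = 1" by (induction m) simp_all
    then show ?thesis using that by (subst Y_fix) simp_all
  qed
  moreover have "sp 0 (Suc m) = t ^ Suc m" if "m < n" for m
    unfolding sp_def using vperm_0[of "Suc m" n] that by (simp add: power_int_of_nat del: of_nat_Suc)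
  ultimately show ?case by (simp add: joint_eigen_def power_inverse field_simps)
next
  case (cycvec \<nu>)
  then show ?case by (simp add: elec_cycvec Phi_eigen nonneg_Zn)
next
  case (canonical k \<nu>)
  then show ?case using canonicalD[OF canonical(1)] by (simp add: elec_canonical tau_eigen)
qed

end

lemma lookup_swap_sref:
  "1 \<le> i \<Longrightarrow> i < n \<Longrightarrow> \<mu> \<in> Zn n \<Longrightarrow> lookup (swap n i \<mu>) j = lookup \<mu> (sref i j)"
  by (cases "j = i"; cases "j = Suc i") (simp_all add: perm_sref_lookups)

lemma swap_braid:
  assumes "1 \<le> i" "Suc i < n" "\<mu> \<in> Zn n"
  shows "swap n (Suc i) (swap n i (swap n (Suc i) \<mu>)) = swap n i (swap n (Suc i) (swap n i \<mu>))"
proof (rule poly_mapping_eqI)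
  fix j
  have "sref (Suc i) (sref i (sref (Suc i) j)) = sref i (sref (Suc i) (sref i j))"
    by (auto simp: sref_def transpose_def)
  then show "lookup (swap n (Suc i) (swap n i (swap n (Suc i) \<mu>))) j = lookup (swap n i (swap n (Suc i) (swap n i \<mu>))) j"
    using assms by (simp add: lookup_swap_sref)
qed

lemma swap_comm:
  assumes "1 \<le> i" "Suc i < j" "j < n" "\<mu> \<in> Zn n"
  shows "swap n i (swap n j \<mu>) = swap n j (swap n i \<mu>)"
proof (rule poly_mapping_eqI)
  fix k
  have "sref j (sref i k) = sref i (sref j k)"
    using assms by (auto simp: sref_def transpose_def)
  then show "lookup (swap n i (swap n j \<mu>)) k = lookup (swap n j (swap n i \<mu>)) k"
    using assms by (simp add: lookup_swap_sref)
qed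

lemma nonneg_ones: "k \<ge> 0 \<Longrightarrow> nonneg n \<mu> \<Longrightarrow> nonneg n (ones n k + \<mu>)"
  by (simp add: nonneg_def Zn_add lookup_add lookup_ones)

lemma cycvec_ones: "cycvec n (ones n k + \<mu>) = ones n k + cycvec n \<mu>" if "n \<ge> 1"
  by (rule Zn_eqI[of _ n]) (use that in \<open>auto simp: Zn_add lookup_add lookup_ones lookup_cycvec\<close>)

lemma swap_ones:
  assumes "1 \<le> i" "i < n" "\<mu> \<in> Zn n"
  shows "swap n i (ones n k + \<mu>) = ones n k + swap n i \<mu>"
  using assms sref_range[of i n]
  by (intro Zn_eqI[of _ n]) (auto simp: Zn_add lookup_add lookup_ones lookup_swap_sref)

lemma vperm_ones: 
  assumes "r \<in> {1..n}" shows "vperm n (ones n k + \<mu>) r = vperm n \<mu> r"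
  using vperm_transport[OF bij_betw_id[of "{1..n}"] assms, of "ones n k + \<mu>" \<mu>] assms
  by (simp add: vbefore_def lookup_add lookup_ones)

lemma s_xmon_ones: "1 \<le> i \<Longrightarrow> i < n \<Longrightarrow> s i (xmon (ones n k)) = xmon (ones n k)"
proof -
  assume i: "1 \<le> i" "i < n"
  have "swap n i 0 = 0" by (rule poly_mapping_eqI) (use i in \<open>simp add: lookup_swap_sref\<close>)
  then have "swap n i (ones n k) = ones n k" using swap_ones[OF i, of 0 k] by simp
  then show ?thesis using s_xmon_perm[OF i ones_in_Zn, of k] by simp
qed

lemma lspan_empty: "f \<in> lspan {} \<Longrightarrow> f = 0"
  by (auto simp: lspan_def)

context macdonald
begin

lemma ratio_cycvec: "\<nu> \<in> Zn n \<Longrightarrow> 1 \<le> i \<Longrightarrow> Suc i < n \<Longrightarrow> ratio (Suc i) (cycvec n \<nu>) = ratio i \<nu>"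
  by (simp add: ratio_def sp_cycvec_Suc)

lemma ratio_cycvec_cycvec:
  assumes "n \<ge> 2" "\<kappa> \<in> Zn n"
  shows "ratio 1 (cycvec n (cycvec n \<kappa>)) = ratio (n - 1) \<kappa>"
proof -
  have "sp (cycvec n (cycvec n \<kappa>)) 1 = q * sp \<kappa> (n - 1)"
    using assms sp_cycvec_1[of "cycvec n \<kappa>"] sp_cycvec_Suc[of \<kappa> "n - 1"] by simp
  moreover have "sp (cycvec n (cycvec n \<kappa>)) (Suc 1) = q * sp \<kappa> n"
    using assms sp_cycvec_Suc[of "cycvec n \<kappa>" 1] sp_cycvec_1[of \<kappa>] by simp
  moreover have "Suc (n - 1) = n" using assms by simp
  ultimately show ?thesis unfolding ratio_def by simp
qed

lemma ratio_ones:
  assumes "1 \<le> i" "i < n"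
  shows "ratio i (ones n k + \<mu>) = ratio i \<mu>"
  using assms by (simp add: ratio_eq vperm_ones lookup_add lookup_ones)

text \<open>(E2) for every descent, not only for those on the preferred path. The induction runs
  along the recursion of \<open>elec\<close>: a step is moved past the last step of the path by
  \<open>Phi_tau\<close>, \<open>Phi_Phi_tau\<close>, \<open>tau_comm\<close> or \<open>YB\<close>,
  according to how they overlap.\<close>

lemma elec_swap:
  assumes "nonneg n \<mu>" "1 \<le> i" "i < n" "lookup \<mu> (Suc i) < lookup \<mu> i"
  shows "elec (swap n i \<mu>) = tau i (ratio i \<mu>) (elec \<mu>)"
proof -
  have "wf (measures [\<lambda>\<mu>. nat (weight n \<mu>), fpos])" by simp
  then show ?thesis using assms
  proof (induction \<mu> arbitrary: i)
    case (less \<mu>)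
    note i = less.prems(2-4)
    from \<open>nonneg n \<mu>\<close> show ?case
    proof (cases rule: nonneg_cases)
      case 1
      then show ?thesis using i by simp
    next
      case (2 \<nu>)
      note \<nu>Zn = nonneg_Zn[OF 2(1)]
      show ?thesis
      proof (cases "i = 1")
        case False
        then obtain k where k: "i = Suc k" "1 \<le> k" "Suc k < n" using i by (cases i) auto
        have "lookup \<nu> (Suc k) < lookup \<nu> k" using i(3) k by (simp add: 2(2) lookup_cycvec)
        then have IH: "elec (swap n k \<nu>) = tau k (ratio k \<nu>) (elec \<nu>)"
          using less.IH[of \<nu> k] 2 k by simp
        have "lookup (swap n k \<nu>) n = lookup \<nu> n" using k \<nu>Zn by (simp add: perm_sref_lookups)
        then show ?thesis
          using k 2(1) \<nu>Zn IH
          by (simp add: 2(2) swap_cycvec elec_cycvec nonneg_swap Phi_tau ratio_cycvec tau_cst)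
      next
        case True
        then have n2: "n \<ge> 2" using i by simp
        show ?thesis
        proof (cases "lookup \<mu> 2 > 0")
          case False
          then have "lookup \<mu> (Suc 1) = 0" using less.prems(1) n2 by (force simp: nonneg_def numeral_2_eq_2)
          then have "canonical 1 \<mu>"
            using less.prems True by (auto simp: canonical_def)
          then show ?thesis using elec_canonical True by simp
        next
          \<comment> \<open>Both of the first two entries are positive, so \<mu> arises from
            \<kappa> by two rotations. These turn the swap of the last two entries of \<kappa> into
            the swap of the first two entries of \<mu>.\<close>
          case pos: True
          have "lookup \<nu> 1 > 0" using pos n2 by (simp add: 2(2) lookup_cycvec)
          define \<kappa> where "\<kappa> = dcycvec n \<nu>"
          have \<kappa>: "nonneg n \<kappa>" "\<nu> = cycvec n \<kappa>" "\<kappa> \<in> Zn n"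
            using nonneg_dcycvec[OF n_pos 2(1)] \<open>lookup \<nu> 1 > 0\<close> cycvec_dcycvec[OF n_pos \<nu>Zn] by (auto simp: \<kappa>_def)
          have n1: "1 \<le> n - 1" "n - 1 < n" "Suc (n - 1) = n" using n2 by auto
          have "weight n \<mu> = weight n \<kappa> + 2" by (simp add: 2(2) \<kappa>(2) weight_cycvec[OF n_pos])
          then have "nat (weight n \<kappa>) < nat (weight n \<mu>)" using weight_nonneg[OF \<kappa>(1)] by simp
          moreover have "lookup \<kappa> n < lookup \<kappa> (n - 1)"
            using i(3) n2 True by (simp add: 2(2) \<kappa>(2) lookup_cycvec)
          ultimately have IH: "elec (swap n (n - 1) \<kappa>) = tau (n - 1) (ratio (n - 1) \<kappa>) (elec \<kappa>)"
            using less.IH[of \<kappa> "n - 1"] \<kappa>(1) n1 by simp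
          have e: "elec (cycvec n (cycvec n \<xi>)) =
            cst (q powi lookup \<xi> (n - 1) * q powi lookup \<xi> n) * Phi (Phi (elec \<xi>))" if "nonneg n \<xi>" for \<xi>
          proof -
            have "lookup (cycvec n \<xi>) n = lookup \<xi> (n - 1)" using n2 by (simp add: lookup_cycvec)
            then show ?thesis using that
              by (simp add: elec_cycvec nonneg_cycvec n_pos[simplified] Phi_cst cst_mult mult.assoc)
          qed
          have "lookup (swap n (n - 1) \<kappa>) (n - 1) = lookup \<kappa> n" "lookup (swap n (n - 1) \<kappa>) n = lookup \<kappa> (n - 1)"
            using perm_sref_lookups(1,2)[OF n1(1,2) \<kappa>(3)] unfolding n1 by auto
          then have "elec (cycvec n (cycvec n (swap n (n - 1) \<kappa>))) =
              cst (q powi lookup \<kappa> n * q powi lookup \<kappa> (n - 1)) * tau 1 (ratio (n - 1) \<kappa>) (Phi (Phi (elec \<kappa>)))"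
            using e[OF nonneg_swap[OF n1(1,2) \<kappa>(1)]] Phi_Phi_tau[OF n2] by (simp only: IH)
          also have "\<dots> = tau 1 (ratio 1 \<mu>) (elec \<mu>)"
            unfolding 2(2) \<kappa>(2) e[OF \<kappa>(1)] ratio_cycvec_cycvec[OF n2 \<kappa>(3)] tau_cst
            by (simp add: mult.commute)
          finally show ?thesis
            using swap_cycvec_cycvec[OF n2 \<kappa>(3)] True by (simp add: 2(2) \<kappa>(2))
        qed
      qed
    next
      case (3 k \<nu>)
      note c = canonicalD[OF 3(1)]
      define l where "l = Suc k"
      have \<mu>: "lookup \<mu> j = 0" if "1 \<le> j" "j < l" for j
        using that 3(1) c by (cases "j = k") (auto simp: 3(2) canonical_def perm_sref_lookups l_def)
      have il: "i \<ge> l"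
      proof (rule ccontr)
        assume "\<not> i \<ge> l"
        then have "lookup \<mu> i = 0" using \<mu> i by simp
        moreover have "0 \<le> lookup \<mu> (Suc i)" using less.prems(1) i by (simp add: nonneg_def)
        ultimately show False using i(3) by simp
      qed
      have e\<mu>: "elec \<mu> = tau k (ratio k \<nu>) (elec \<nu>)"
        unfolding 3(2) by (rule elec_canonical(1)[OF 3(1)])
      have IH: "elec (swap n j \<alpha>) = tau j (ratio j \<alpha>) (elec \<alpha>)"
        if "nonneg n \<alpha>" "weight n \<alpha> = weight n \<mu>" "fpos \<alpha> = k" "1 \<le> j" "j < n" "lookup \<alpha> (Suc j) < lookup \<alpha> j"
        for \<alpha> j using less.IH[of \<alpha> j] that 3(5) by simp
      show ?thesis
      proof (cases "i = l")
        case False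
        then have ik: "Suc k < i" using il by (simp add: l_def)
        have \<nu>i: "lookup \<nu> (Suc i) < lookup \<nu> i"
          using i ik c by (simp add: 3(2) perm_sref_lookups)
        have "canonical k (swap n i \<nu>)"
          using 3(1) c i ik by (simp add: canonical_def nonneg_swap perm_sref_lookups)
        then have "elec (swap n k (swap n i \<nu>)) = tau k (ratio k (swap n i \<nu>)) (elec (swap n i \<nu>))"
          by (rule elec_canonical)
        also have "elec (swap n i \<nu>) = tau i (ratio i \<nu>) (elec \<nu>)"
          using IH[of \<nu> i] 3 c i \<nu>i by simp
        also have "ratio k (swap n i \<nu>) = ratio k \<nu>"
          using c i ik \<nu>i unfolding ratio_def by (simp add: sp_swap)
        also have "tau k (ratio k \<nu>) (tau i (ratio i \<nu>) (elec \<nu>)) = tau i (ratio i \<nu>) (elec \<mu>)"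
          unfolding e\<mu> using ik by (intro tau_comm) simp
        also have "ratio i \<nu> = ratio i \<mu>"
          using c i ik unfolding ratio_def 3(2) by (simp add: sp_swap)
        also have "swap n k (swap n i \<nu>) = swap n i \<mu>"
          unfolding 3(2) by (rule swap_comm) (use c i ik in auto)
        finally show ?thesis .
      next
        case True
        then have l: "1 \<le> l" "l < n" "l = Suc k" using i by (auto simp: l_def)
        show ?thesis
        proof (cases "lookup \<mu> (Suc l) > 0")
          case False
          moreover have "0 \<le> lookup \<mu> (Suc l)" using less.prems(1) l(2) by (simp add: nonneg_def)
          ultimately have "lookup \<mu> (Suc l) = 0" by simp
          then have "canonical l \<mu>"
            using \<mu> less.prems i True by (auto simp: canonical_def)
          then show ?thesis using elec_canonical True by simp
        next
          case pos: True
          \<comment> \<open>With A > B > 0 the entries at k, l, l + 1 are (0, A, B) in \<mu>, (A, 0,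
            B) in \<nu>, (A, B, 0) in \<alpha>, (B, A, 0) in \<beta> and (B, 0, A) in \<gamma>. The
            two paths from \<alpha> to (0, B, A), through \<nu> and \<mu> or through \<beta> and
            \<gamma>, form the Yang-Baxter hexagon. The induction hypothesis applies to \<alpha> and
            \<beta>, whose first positive entry is at k rather than at l.\<close>
          define \<alpha> where "\<alpha> = swap n l \<nu>"
          define \<beta> where "\<beta> = swap n k \<alpha>"
          define \<gamma> where "\<gamma> = swap n l \<beta>"
          have Zn: "\<alpha> \<in> Zn n" "\<beta> \<in> Zn n" "\<gamma> \<in> Zn n" by (simp_all add: \<alpha>_def \<beta>_def \<gamma>_def)
          have \<nu>\<alpha>: "\<nu> = swap n l \<alpha>" using l c by (simp add: \<alpha>_def swap_swap)
          have nn: "nonneg n \<alpha>" "nonneg n \<beta>" "nonneg n \<gamma>"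
            using l c by (simp_all add: \<alpha>_def \<beta>_def \<gamma>_def nonneg_swap)
          have w: "weight n \<alpha> = weight n \<mu>" "weight n \<beta> = weight n \<mu>"
            using l c 3(3) by (simp_all add: \<alpha>_def \<beta>_def weight_swap)
          have ab: "lookup \<mu> (Suc l) < lookup \<mu> l" using i True by simp
          have lk\<nu>: "lookup \<nu> k = lookup \<mu> l" "lookup \<nu> l = 0" "lookup \<nu> (Suc l) = lookup \<mu> (Suc l)"
            using c l 3(1) by (simp_all add: 3(2) perm_sref_lookups canonical_def)
          have lk\<alpha>: "lookup \<alpha> k = lookup \<mu> l" "lookup \<alpha> l = lookup \<mu> (Suc l)" "lookup \<alpha> (Suc l) = 0"
            using c l by (simp_all add: \<alpha>_def perm_sref_lookups lk\<nu>[unfolded l] )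
          have lk\<beta>: "lookup \<beta> k = lookup \<mu> (Suc l)" "lookup \<beta> l = lookup \<mu> l" "lookup \<beta> (Suc l) = 0"
            using c l Zn by (simp_all add: \<beta>_def perm_sref_lookups lk\<alpha>[unfolded l])
          have lk\<gamma>: "lookup \<gamma> k = lookup \<mu> (Suc l)" "lookup \<gamma> l = 0" "lookup \<gamma> (Suc l) = lookup \<mu> l"
            using c l Zn by (simp_all add: \<gamma>_def perm_sref_lookups lk\<beta>[unfolded l])
          have z: "lookup \<nu> j = 0" "lookup \<alpha> j = 0" "lookup \<beta> j = 0" "lookup \<gamma> j = 0" if "1 \<le> j" "j < k" for j
            using that c l 3(1) Zn by (simp_all add: \<alpha>_def \<beta>_def \<gamma>_def perm_sref_lookups canonical_def)
          have fp: "fpos \<alpha> = k" "fpos \<beta> = k"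
            using c pos ab z by (auto intro!: fpos_eqI simp: lk\<alpha> lk\<beta>)
          have can: "canonical k \<gamma>"
            using nn c pos z lk\<gamma> l by (simp add: canonical_def)
          have e\<beta>: "elec \<beta> = tau k (ratio k \<alpha>) (elec \<alpha>)"
            unfolding \<beta>_def by (rule IH[OF nn(1) w(1) fp(1)]) (use c l ab lk\<alpha> in auto)
          have e\<gamma>: "elec \<gamma> = tau l (ratio l \<beta>) (elec \<beta>)"
            unfolding \<gamma>_def by (rule IH[OF nn(2) w(2) fp(2)]) (use l ab pos lk\<beta> in auto)
          have e\<nu>: "elec \<nu> = tau l (ratio l \<alpha>) (elec \<alpha>)"
            unfolding \<nu>\<alpha> by (rule IH[OF nn(1) w(1) fp(1)]) (use l pos lk\<alpha> in auto)
          have "swap n l \<mu> = swap n k \<gamma>"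
            unfolding 3(2) \<nu>\<alpha> \<gamma>_def \<beta>_def using swap_braid[of k n \<alpha>] c l Zn by simp
          then have L: "elec (swap n l \<mu>) = tau k (ratio k \<gamma>) (elec \<gamma>)"
            using elec_canonical(1)[OF can] by simp
          let ?A = "sp \<alpha> k" and ?B = "sp \<alpha> l" and ?Z = "sp \<alpha> (Suc l)"
          have sp\<beta>: "sp \<beta> k = ?B" "sp \<beta> l = ?A" "sp \<beta> (Suc l) = ?Z"
            using c l Zn ab unfolding \<beta>_def by (simp_all add: sp_swap lk\<alpha>[unfolded l])
          have sp\<gamma>: "sp \<gamma> k = ?B" "sp \<gamma> l = ?Z"
            using c l Zn ab pos unfolding \<gamma>_def by (simp_all add: sp_swap lk\<beta>[unfolded l] sp\<beta>[unfolded l])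
          have sp\<nu>: "sp \<nu> k = ?A" "sp \<nu> l = ?Z" "sp \<nu> (Suc l) = ?B"
            using c l Zn pos unfolding \<nu>\<alpha> by (simp_all add: sp_swap lk\<alpha>[unfolded l])
          have sp\<mu>: "sp \<mu> l = ?A" "sp \<mu> (Suc l) = ?B"
            using c l pos ab unfolding 3(2) by (simp_all add: sp_swap lk\<nu>[unfolded l] sp\<nu>[unfolded l])
          have ratios: "ratio k \<alpha> = ?A / ?B" "ratio l \<alpha> = ?B / ?Z" "ratio l \<beta> = (?B / ?Z) * (?A / ?B)"
            "ratio k \<gamma> = ?B / ?Z" "ratio k \<nu> = (?B / ?Z) * (?A / ?B)" "ratio l \<mu> = ?A / ?B"
            using sp\<beta> sp\<gamma> sp\<nu> sp\<mu> by (simp_all add: ratio_def l(3)[symmetric])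
          have ne: "?B / ?Z \<noteq> 1" "?A / ?B \<noteq> 1" "(?B / ?Z) * (?A / ?B) \<noteq> 1"
            using ratio_generic[of l \<alpha>] ratio_generic[of k \<alpha>] ratio_generic[of l \<beta>] lk\<alpha> lk\<beta> c l pos ab
            unfolding ratios by simp_all
          show ?thesis
            unfolding True L e\<gamma> e\<beta> e\<mu> e\<nu> ratios
            by (rule YB[OF ne, of k, folded l_def, symmetric])
        qed
      qed
    qed
  qed
qed

section \<open>Multiplication by powers of x_1 ... x_n and the extension to all integer
  vectors\<close>

lemma om_xmon_ones: "om (xmon (ones n k)) = cst (q powi (- k)) * xmon (ones n k)"
proof -
  have "single 1 1 + ones n k \<in> Zn n"
    using n_pos by (simp add: Zn_iff lookup_add lookup_ones lookup_single when_def)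
  then have "cycvec n (ones n k) = single 1 1 + ones n k"
    by (rule Zn_eqI[OF cycvec_in_Zn])
       (use n_pos in \<open>auto simp: lookup_cycvec lookup_add lookup_ones lookup_single when_def\<close>)
  then have "xvar 1 * om (xmon (ones n k)) = xvar 1 * (cst (q powi (- k)) * xmon (ones n k))"
    using Phi_xmon[of "ones n k"] n_pos by (simp add: Phi_def lookup_ones xmon_add xvar_xmon mult_ac)
  then show ?thesis by simp
qed

lemma Phi_ones: "Phi (xmon (ones n k) * f) = cst (q powi (- k)) * (xmon (ones n k) * Phi f)"
  unfolding Phi_def om.msub_mult[folded om_def] om_xmon_ones by (simp add: mult_ac)

text \<open>The preferred path to (1, ..., 1) is long, but that vector has nothing strictly below
  it, so monicity alone gives the base case. In the other steps the factor passes through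
  \<open>tau\<close> unchanged and through \<open>Phi\<close> with a factor q^{-1}, which the
  exponent of q in (E1) absorbs.\<close>

lemma elec_ones_1:
  assumes "nonneg n \<mu>"
  shows "elec (ones n 1 + \<mu>) = xmon (ones n 1) * elec \<mu>"
  using assms
proof (induction rule: nonneg_induct)
  case zero
  have "monic_at (ones n 1) (elec (ones n 1))"
    using nonneg_ones[of 1 n 0] elec_monic by simp
  moreover have "below n (ones n 1) - {ones n 1} = {}" using below_ones by blast
  ultimately show ?case by (auto simp: monic_at_def dest: lspan_empty)
next
  case (cycvec \<nu>)
  have nn: "nonneg n (ones n 1 + \<nu>)" using cycvec nonneg_ones by simp
  have "elec (ones n 1 + cycvec n \<nu>) = cst (q powi (1 + lookup \<nu> n)) * Phi (elec (ones n 1 + \<nu>))"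
    using elec_cycvec[OF nn] cycvec_ones[OF n_pos, of 1 \<nu>] n_pos by (simp add: lookup_add lookup_ones)
  also have "\<dots> = cst (q powi (1 + lookup \<nu> n) * q powi (- 1)) * (xmon (ones n 1) * Phi (elec \<nu>))"
    unfolding cycvec.IH Phi_ones cst_mult by (simp add: mult_ac)
  also have "q powi (1 + lookup \<nu> n) * q powi (- 1) = q powi lookup \<nu> n"
    by (simp add: power_int_add power_int_minus)
  finally show ?case using cycvec by (simp add: elec_cycvec mult_ac)
next
  case (canonical k \<nu>)
  note c = canonicalD[OF canonical(1)]
  have nn: "nonneg n (ones n 1 + \<nu>)" using c nonneg_ones by simp
  have "elec (swap n k (ones n 1 + \<nu>)) = tau k (ratio k (ones n 1 + \<nu>)) (elec (ones n 1 + \<nu>))"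
    using c by (intro elec_swap nn) (auto simp: lookup_add lookup_ones)
  also have "\<dots> = xmon (ones n 1) * tau k (ratio k \<nu>) (elec \<nu>)"
    using c canonical.IH by (simp add: ratio_ones tau_sym s_xmon_ones)
  finally show ?case using c elec_canonical(1)[OF canonical(1)] by (simp add: swap_ones)
qed

lemma elec_ones:
  assumes "nonneg n \<mu>"
  shows "elec (ones n (int k) + \<mu>) = xmon (ones n (int k)) * elec \<mu>"
proof (induction k)
  case (Suc k)
  have "ones n (int (Suc k)) = ones n 1 + ones n (int k)" by (simp flip: ones_add)
  then show ?case
    using elec_ones_1[OF nonneg_ones[of "int k", OF _ assms]] Suc by (simp add: add.assoc xmon_add mult.assoc)
qed simp

text \<open>(E3) reduces the construction on \<open>\<int>\<^sup>n\<close> to nonnegative vectors.\<close>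

definition shift :: "(nat \<Rightarrow>\<^sub>0 int) \<Rightarrow> nat" where
  "shift \<mu> = nat (\<Sum>r\<in>{1..n}. \<bar>lookup \<mu> r\<bar>)"

definition elecZ :: "(nat \<Rightarrow>\<^sub>0 int) \<Rightarrow> 'a ratfun" where
  "elecZ \<mu> = xmon (ones n (- int (shift \<mu>))) * elec (ones n (int (shift \<mu>)) + \<mu>)"

lemma nonneg_shift: "\<mu> \<in> Zn n \<Longrightarrow> nonneg n (ones n (int (shift \<mu>)) + \<mu>)"
proof -
  assume \<mu>: "\<mu> \<in> Zn n"
  have "\<bar>lookup \<mu> j\<bar> \<le> (\<Sum>r\<in>{1..n}. \<bar>lookup \<mu> r\<bar>)" if "j \<in> {1..n}" for j
    by (rule member_le_sum[OF that]) auto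
  then have "0 \<le> int (shift \<mu>) + lookup \<mu> j" if "j \<in> {1..n}" for j
    using that by (force simp: shift_def sum_nonneg)
  then show ?thesis using \<mu> by (simp add: nonneg_def Zn_add lookup_add lookup_ones)
qed

text \<open>Independence of the amount of shifting: two admissible shifts are compared at their sum
  by \<open>elec_ones\<close>.\<close>

lemma elecZ_eq:
  assumes "\<mu> \<in> Zn n" "nonneg n (ones n (int k) + \<mu>)"
  shows "elecZ \<mu> = xmon (ones n (- int k)) * elec (ones n (int k) + \<mu>)"
proof -
  let ?m = "shift \<mu>"
  have "xmon (ones n (int k)) * elec (ones n (int ?m) + \<mu>) = xmon (ones n (int ?m)) * elec (ones n (int k) + \<mu>)"
    using elec_ones[OF nonneg_shift[OF assms(1)], of k] elec_ones[OF assms(2), of ?m]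
    by (simp add: add.left_commute)
  then show ?thesis unfolding elecZ_def by (simp add: ones_uminus xmon_uminus field_simps)
qed

lemma elecZ_nonneg: "nonneg n \<mu> \<Longrightarrow> elecZ \<mu> = elec \<mu>"
  using elecZ_eq[of \<mu> 0] nonneg_Zn by simp

lemma elec_elecZ: "\<mu> \<in> Zn n \<Longrightarrow> elec (ones n (int (shift \<mu>)) + \<mu>) = xmon (ones n (int (shift \<mu>))) * elecZ \<mu>"
  unfolding elecZ_def by (simp add: ones_uminus xmon_uminus)

lemma elecZ_cycvec:
  assumes "\<mu> \<in> Zn n"
  shows "elecZ (cycvec n \<mu>) = cst (q powi lookup \<mu> n) * Phi (elecZ \<mu>)"
proof -
  let ?k = "shift \<mu>" and ?m = "int (shift \<mu>)"
  note nn = nonneg_shift[OF assms]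
  have eq: "cycvec n (ones n ?m + \<mu>) = ones n ?m + cycvec n \<mu>" by (rule cycvec_ones[OF n_pos])
  have "elecZ (cycvec n \<mu>) = xmon (ones n (- ?m)) * elec (cycvec n (ones n ?m + \<mu>))"
    using elecZ_eq[of "cycvec n \<mu>" ?k] nonneg_cycvec[OF n_pos nn] eq by simp
  also have "\<dots> = xmon (ones n (- ?m)) * xmon (ones n ?m) * cst (q powi (?m + lookup \<mu> n) * q powi (- ?m)) * Phi (elecZ \<mu>)"
    unfolding elec_cycvec[OF nn] elec_elecZ[OF assms] Phi_ones cst_mult
    using n_pos by (simp add: lookup_add lookup_ones mult_ac)
  also have "xmon (ones n (- ?m)) * xmon (ones n ?m) = 1" by (simp flip: xmon_add ones_add)
  also have "q powi (?m + lookup \<mu> n) * q powi (- ?m) = q powi lookup \<mu> n"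
    by (simp flip: power_int_add)
  finally show ?thesis by simp
qed

lemma elecZ_ones:
  assumes "\<mu> \<in> Zn n"
  shows "elecZ (\<mu> - ones n 1) = xmon (ones n (- 1)) * elecZ \<mu>"
proof -
  let ?k = "Suc (shift \<mu>)"
  have Zn: "\<mu> - ones n 1 \<in> Zn n" using assms by (simp add: Zn_iff lookup_minus lookup_ones)
  have eq: "ones n (int ?k) + (\<mu> - ones n 1) = ones n (int (shift \<mu>)) + \<mu>"
    by (rule poly_mapping_eqI) (simp add: lookup_add lookup_minus lookup_ones)
  have "ones n (- int ?k) = ones n (- 1) + ones n (- int (shift \<mu>))" by (simp flip: ones_add)
  then show ?thesis
    using elecZ_eq[OF Zn, of ?k] nonneg_shift[OF assms] unfolding eq elecZ_def[of \<mu>] by (simp add: xmon_add mult.assoc)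
qed

lemma elecZ_monic:
  assumes "\<mu> \<in> Zn n" shows "monic_at \<mu> (elecZ \<mu>)"
proof -
  let ?m = "int (shift \<mu>)" let ?\<mu> = "ones n ?m + \<mu>"
  have shift: "ones n (- ?m) + (ones n ?m + \<nu>) = \<nu>" for \<nu>
    by (simp add: ones_uminus)
  have "elec ?\<mu> - xmon ?\<mu> \<in> lspan (below n ?\<mu> - {?\<mu>})"
    using elec_monic[OF nonneg_shift[OF assms]] by (simp add: monic_at_def)
  then have "xmon (ones n (- ?m)) * (elec ?\<mu> - xmon ?\<mu>) \<in> lspan (below n \<mu> - {\<mu>})"
  proof (rule lspan_xmon_mult)
    fix \<nu> assume \<nu>: "\<nu> \<in> below n ?\<mu> - {?\<mu>}"
    then have "ones n (- ?m) + \<nu> \<in> below n (ones n (- ?m) + ?\<mu>)" by (intro ones_below) simp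
    moreover have "ones n (- ?m) + \<nu> \<noteq> ones n (- ?m) + ?\<mu>" using \<nu> by simp
    ultimately show "ones n (- ?m) + \<nu> \<in> below n \<mu> - {\<mu>}" unfolding shift by blast
  qed
  then show ?thesis
    by (simp add: monic_at_def elecZ_def right_diff_distrib shift flip: xmon_add)
qed

lemma elecZ_lspan: "\<mu> \<in> Zn n \<Longrightarrow> elecZ \<mu> \<in> lspan (Zn n)"
proof -
  assume \<mu>: "\<mu> \<in> Zn n"
  have "elecZ \<mu> - xmon \<mu> \<in> lspan (Zn n)"
    using elecZ_monic[OF \<mu>] unfolding monic_at_def by (rule lspan_mono) (auto simp: below_def)
  then have "(elecZ \<mu> - xmon \<mu>) + xmon \<mu> \<in> lspan (Zn n)" by (rule lspan_add) (rule lspan_xmon[OF \<mu>])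
  then show ?thesis by simp
qed

lemma elecZ_eigen:
  assumes "\<mu> \<in> Zn n"
  obtains c where "C (elecZ \<mu>) = cst c * elecZ \<mu>"
proof -
  let ?m = "int (shift \<mu>)" let ?\<mu> = "ones n ?m + \<mu>"
  have "Y k (elecZ \<mu>) = cst (q powi ?m * (t / sp ?\<mu> (Suc k))) * elecZ \<mu>" if "k < n" for k
  proof -
    have "Y k (elecZ \<mu>) = cst (q powi ?m) * xmon (ones n (- ?m)) * Y k (elec ?\<mu>)"
      unfolding elecZ_def by (rule Y_sym[OF _ _ that]) (use s_xmon_ones om_xmon_ones[of "- ?m"] in auto)
    also have "Y k (elec ?\<mu>) = cst (t / sp ?\<mu> (Suc k)) * elec ?\<mu>"
      using elec_eigen[OF nonneg_shift[OF assms]] that by (simp add: joint_eigen_def)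
    finally show ?thesis unfolding elecZ_def cst_mult by (simp only: mult_ac)
  qed
  then have "C (elecZ \<mu>) = cst (\<Sum>k<n. q powi ?m * (t / sp ?\<mu> (Suc k))) * elecZ \<mu>"
    by (simp add: C_def cst_sum sum_distrib_right)
  then show thesis by (rule that)
qed

section \<open>Existence and uniqueness of the electronic polynomials\<close>

definition elecL :: "(nat \<Rightarrow>\<^sub>0 int) \<Rightarrow> 'a laurent" where
  "elecL \<mu> = (if \<mu> \<in> Zn n then SOME p. to_fract p = elecZ \<mu> else 0)"

lemma to_fract_elecL: "\<mu> \<in> Zn n \<Longrightarrow> to_fract (elecL \<mu>) = elecZ \<mu>"
proof -
  assume \<mu>: "\<mu> \<in> Zn n"
  then have "\<exists>p. to_fract p = elecZ \<mu>" using elecZ_lspan[of \<mu>] by (auto simp: lspan_def)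
  then have "to_fract (SOME p. to_fract p = elecZ \<mu>) = elecZ \<mu>" by (rule someI_ex)
  then show ?thesis using \<mu> by (simp add: elecL_def)
qed

lemma elecL_laurent: "\<mu> \<in> Zn n \<Longrightarrow> elecL \<mu> \<in> laurent_ring n"
  using elecZ_lspan[of \<mu>] to_fract_elecL[of \<mu>] by (auto simp: lspan_def laurent_ring_def)

lemma subst_laurent_cong:
  assumes "f \<in> laurent_ring n" "\<And>i. i \<in> {1..n} \<Longrightarrow> g i = h i"
  shows "subst_laurent g f = subst_laurent h f"
  unfolding subst_laurent_def
  using assms by (intro sum.cong prod.cong arg_cong2[where f = "(*)"] refl) (auto simp: laurent_ring_def Zn_def subset_iff)

text \<open>The substitution in (E1) and \<open>om\<close> treat variables with index outside {1..n}
  differently; they agree on Laurent polynomials in x_1, ..., x_n.\<close>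

lemma E1_subst:
  assumes "f \<in> laurent_ring n"
  shows "subst_laurent (\<lambda>i. if i = n then cst (inverse q) * xvar 1 else xvar (i + 1)) f = om (to_fract f)"
  unfolding om_def om.msub_to_fract
  by (rule subst_laurent_cong[OF assms]) (use n_pos in \<open>auto simp: gsub_def qn_def cyc_def\<close>)

lemma tau_ddiff:
  "tau i (ratio i \<mu>) f = (let a = q powi (lookup \<mu> i - lookup \<mu> (i + 1)) *
       t powi (int (vperm n \<mu> i) - int (vperm n \<mu> (i + 1)))
     in ddiff i (xvar i * f) - cst t * xvar i * ddiff i f + cst ((1 - t) * a / (1 - a)) * f)"
  unfolding tau_def kap_def T_ddiff ratio_eq Let_def by simp

lemma prod_inverse_xvar: "(\<Prod>i\<in>{1..n}. inverse (xvar i)) = xmon (ones n (- 1))"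
  unfolding ones_def zvec_def xmon_sum xmon_single by (simp add: power_int_minus)

lemma is_electronic_elecL: "is_electronic n q t elecL"
proof -
  have E0: "elecL 0 = 1"
    using to_fract_elecL[of 0] elecZ_nonneg[of 0] by (metis Zn_0 elec_0 nonneg_0 to_fract_1 to_fract_eq_iff)
  have E1: "to_fract (elecL (cycvec n \<mu>)) = cst (q powi lookup \<mu> n) * xvar 1 *
      subst_laurent (\<lambda>i. if i = n then cst (inverse q) * xvar 1 else xvar (i + 1)) (elecL \<mu>)" if "\<mu> \<in> Zn n" for \<mu>
    using that by (simp add: to_fract_elecL E1_subst elecL_laurent elecZ_cycvec Phi_def mult.assoc del: One_nat_def)
  have E2: "to_fract (elecL (swap n i \<mu>)) = tau i (ratio i \<mu>) (to_fract (elecL \<mu>))"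
    if "\<mu> \<in> Zn n" "i \<in> {1..<n}" "\<forall>j\<in>{1..n}. 0 \<le> lookup \<mu> j" "lookup \<mu> (i + 1) < lookup \<mu> i" for \<mu> i
  proof -
    have "nonneg n \<mu>" using that by (simp add: nonneg_def)
    then show ?thesis using that
      by (simp add: to_fract_elecL elecZ_nonneg nonneg_swap elec_swap)
  qed
  have E3: "to_fract (elecL (\<mu> - zvec n (\<lambda>_. 1))) = (\<Prod>i\<in>{1..n}. inverse (xvar i)) * to_fract (elecL \<mu>)"
    if "\<mu> \<in> Zn n" for \<mu>
  proof -
    have "\<mu> - ones n 1 \<in> Zn n" using that by (simp add: Zn_iff lookup_minus lookup_ones)
    then show ?thesis unfolding prod_inverse_xvar using that elecZ_ones by (simp add: to_fract_elecL flip: ones_def)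
  qed
  show ?thesis
    unfolding is_electronic_def
    using E0 E1[unfolded cycvec_def] E2[unfolded tau_ddiff] E3 elecL_laurent
    by (auto simp: elecL_def)
qed

text \<open>(E0), (E1) and (E2) determine the values along the preferred path of
  \<open>elec\<close>, and (E3) carries them to vectors with negative entries.\<close>

lemma is_electronic_unique:
  assumes "is_electronic n q t E"
  shows "E = elecL"
proof -
  have laurent: "E \<mu> \<in> laurent_ring n" if "\<mu> \<in> Zn n" for \<mu> using assms that by (simp add: is_electronic_def)
  have E1: "to_fract (E (cycvec n \<mu>)) = cst (q powi lookup \<mu> n) * Phi (to_fract (E \<mu>))" if "\<mu> \<in> Zn n" for \<mu>
  proof -
    have "to_fract (E (cycvec n \<mu>)) = cst (q powi lookup \<mu> n) * xvar 1 *
        subst_laurent (\<lambda>i. if i = n then cst (inverse q) * xvar 1 else xvar (i + 1)) (E \<mu>)"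
      using assms that unfolding is_electronic_def cycvec_def by blast
    then show ?thesis using laurent[OF that] by (simp only: E1_subst Phi_def mult.assoc)
  qed
  have E2: "to_fract (E (swap n i \<mu>)) = tau i (ratio i \<mu>) (to_fract (E \<mu>))"
    if "nonneg n \<mu>" "1 \<le> i" "i < n" "lookup \<mu> (Suc i) < lookup \<mu> i" for \<mu> i
  proof -
    have "\<forall>\<mu>\<in>Zn n. \<forall>i\<in>{1..<n}. (\<forall>j\<in>{1..n}. 0 \<le> lookup \<mu> j) \<longrightarrow> lookup \<mu> i > lookup \<mu> (i + 1) \<longrightarrow>
        to_fract (E (swap n i \<mu>)) = tau i (ratio i \<mu>) (to_fract (E \<mu>))"
      using assms unfolding is_electronic_def tau_ddiff Let_def by (elim conjE)
    then show ?thesis using that by (auto simp: nonneg_def)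
  qed
  have nn: "to_fract (E \<mu>) = elec \<mu>" if "nonneg n \<mu>" for \<mu>
    using that
  proof (induction rule: nonneg_induct)
    case zero
    then show ?case using assms by (simp add: is_electronic_def)
  next
    case (cycvec \<nu>)
    then show ?case by (simp add: E1 elec_cycvec nonneg_Zn)
  next
    case (canonical k \<nu>)
    then show ?case using canonicalD[OF canonical(1)] by (simp add: E2 elec_canonical)
  qed
  have E3: "to_fract (E (\<mu> - ones n (int k))) = xmon (ones n (- int k)) * to_fract (E \<mu>)" if "\<mu> \<in> Zn n" for \<mu> k
  proof (induction k)
    case (Suc k)
    have Zn: "\<mu> - ones n (int k) \<in> Zn n" using that by (simp add: Zn_iff lookup_minus lookup_ones)
    have "\<mu> - ones n (int (Suc k)) = (\<mu> - ones n (int k)) - zvec n (\<lambda>_. 1)"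
      by (rule poly_mapping_eqI) (simp add: lookup_minus lookup_ones lookup_zvec)
    then have "to_fract (E (\<mu> - ones n (int (Suc k)))) = (\<Prod>i\<in>{1..n}. inverse (xvar i)) * to_fract (E (\<mu> - ones n (int k)))"
      using assms Zn unfolding is_electronic_def by metis
    moreover have "ones n (- int (Suc k)) = ones n (- 1) + ones n (- int k)" by (simp flip: ones_add)
    ultimately show ?case unfolding prod_inverse_xvar Suc by (simp add: xmon_add mult.assoc)
  qed simp
  show ?thesis
  proof
    fix \<mu> show "E \<mu> = elecL \<mu>"
    proof (cases "\<mu> \<in> Zn n")
      case True
      let ?\<mu> = "ones n (int (shift \<mu>)) + \<mu>"
      have "?\<mu> - ones n (int (shift \<mu>)) = \<mu>" by simp
      then have "to_fract (E \<mu>) = elecZ \<mu>"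
        using E3[of ?\<mu> "shift \<mu>"] nn[OF nonneg_shift[OF True]] True by (simp add: elecZ_def Zn_add)
      then have "to_fract (E \<mu>) = to_fract (elecL \<mu>)" using True by (simp add: to_fract_elecL)
      then show ?thesis by simp
    next
      case False
      then show ?thesis using assms by (simp add: is_electronic_def elecL_def)
    qed
  qed
qed

lemma electronic_elecZ: "\<mu> \<in> Zn n \<Longrightarrow> to_fract (electronic n q t \<mu>) = elecZ \<mu>"
proof -
  have "electronic n q t = elecL"
    unfolding electronic_def using is_electronic_elecL is_electronic_unique by (rule the_equality)
  then show "\<mu> \<in> Zn n \<Longrightarrow> to_fract (electronic n q t \<mu>) = elecZ \<mu>" by (simp add: to_fract_elecL)
qed

end

section \<open>Symmetrizers\<close>

lemma perm_act_hom:
  fixes f g :: "'k::field ratfun" and h :: "'i \<Rightarrow> 'k ratfun"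
  assumes "bij w"
  shows "perm_act w (f + g) = perm_act w f + perm_act w g"
    "perm_act w (f * g) = perm_act w f * perm_act w g"
    "perm_act w (- f) = - perm_act w f"
    "perm_act w (f - g) = perm_act w f - perm_act w g"
    "perm_act w (f / g) = perm_act w f / perm_act w g"
    "perm_act w (inverse f) = inverse (perm_act w f)"
    "perm_act w (sum h A) = (\<Sum>i\<in>A. perm_act w (h i))"
    "perm_act w (prod h A) = (\<Prod>i\<in>A. perm_act w (h i))"
    "perm_act w (cst c) = (cst c :: 'k ratfun)" "perm_act w (xvar i) = (xvar (w i) :: 'k ratfun)"
    "perm_act w 1 = (1 :: 'k ratfun)" "perm_act w 0 = (0 :: 'k ratfun)"
    "perm_act w (xmon \<mu>) = (xmon (pmap w \<mu>) :: 'k ratfun)"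
proof -
  interpret monsub "\<lambda>_. 1 :: 'k" w by (rule monsub_perm[OF assms])
  show "perm_act w (f + g) = perm_act w f + perm_act w g"
    "perm_act w (f * g) = perm_act w f * perm_act w g"
    "perm_act w (- f) = - perm_act w f"
    "perm_act w (f - g) = perm_act w f - perm_act w g"
    "perm_act w (f / g) = perm_act w f / perm_act w g"
    "perm_act w (inverse f) = inverse (perm_act w f)"
    "perm_act w (sum h A) = (\<Sum>i\<in>A. perm_act w (h i))"
    "perm_act w (prod h A) = (\<Prod>i\<in>A. perm_act w (h i))"
    "perm_act w (cst c) = (cst c :: 'k ratfun)" "perm_act w (xvar i) = (xvar (w i) :: 'k ratfun)"
    "perm_act w 1 = (1 :: 'k ratfun)" "perm_act w 0 = (0 :: 'k ratfun)"
    "perm_act w (xmon \<mu>) = (xmon (pmap w \<mu>) :: 'k ratfun)"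
    unfolding perm_act_msub by (simp_all add: msub_hom msub_sum msub_prod msub_xmon)
qed

lemma perm_act_id [simp]: "perm_act id f = f" "perm_act (\<lambda>x. x) f = f"
  by (simp_all add: perm_act_msub msub_id id_def)

text \<open>One family for three symmetrizations: (a, b) = (1, t) gives the factors of the bosonic
  sum, (t, 1) those of the fermionic one up to sign, and (1, 0) the factors x_i / (x_i -
  x_j).\<close>

definition rr :: "'k::field \<Rightarrow> 'k \<Rightarrow> nat \<Rightarrow> nat \<Rightarrow> 'k ratfun" where
  "rr a b i j = (cst a * xvar i - cst b * xvar j) / (xvar i - xvar j)"

definition RR :: "'k::field \<Rightarrow> 'k \<Rightarrow> nat \<Rightarrow> 'k ratfun \<Rightarrow> 'k ratfun" where
  "RR a b i f = rr a b i (Suc i) * f + s i (rr a b i (Suc i) * f)"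

lemma perm_act_rr: "bij w \<Longrightarrow> perm_act w (rr a b i j) = rr a b (w i) (w j)"
  by (simp add: rr_def perm_act_hom)

lemma RR_eq: "RR a b i f = rr a b i (Suc i) * f + rr a b (Suc i) i * s i f"
  by (simp add: RR_def perm_act_hom perm_act_rr)

lemma rr_three:
  assumes "i \<noteq> j" "j \<noteq> k" "i \<noteq> k"
  shows "rr a b j k * rr a b i j + rr a b k j * rr a b i k - cst (a * b) = rr a b i j * rr a b i k"
proof -
  have "(xvar i :: 'a ratfun) - xvar j \<noteq> 0" "(xvar i :: 'a ratfun) - xvar k \<noteq> 0"
    "(xvar j :: 'a ratfun) - xvar k \<noteq> 0" "(xvar k :: 'a ratfun) - xvar j \<noteq> 0"
    using assms by auto
  then show ?thesis
    by (simp add: rr_def cst_mult divide_simps) (simp add: algebra_simps)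
qed

lemma RR_fix:
  assumes "s i f = f" shows "RR a b i f = cst (a + b) * f"
proof -
  have "rr a b i (Suc i) + rr a b (Suc i) i = cst (a + b)"
    by (simp add: rr_def cst_add divide_simps) (simp add: algebra_simps)
  then show ?thesis unfolding RR_eq assms by (simp flip: distrib_right)
qed

lemma RR_cst: "RR a b i (cst c * f) = cst c * RR a b i f"
  by (simp add: RR_eq perm_act_hom algebra_simps)
lemma RR_diff: "RR a b i (f - g) = RR a b i f - RR a b i g"
  by (simp add: RR_eq perm_act_hom algebra_simps)

text \<open>Symmetrization over {p..n} of a function already symmetric in the variables after p. The
  cosets are represented by the transpositions of p and k.\<close>

locale coset_sum =
  fixes n p :: nat and a b :: "'k::field" and \<psi> :: "'k ratfun"
  assumes p: "1 \<le> p" and \<psi>_sym: "p < i \<Longrightarrow> i < n \<Longrightarrow> s i \<psi> = \<psi>"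
begin

definition psi :: "nat \<Rightarrow> 'k ratfun" where "psi k = perm_act (transpose p k) \<psi>"

definition cc :: "nat \<Rightarrow> nat \<Rightarrow> 'k ratfun" where
  "cc m k = (\<Prod>i\<in>{p..<m} - {k}. rr a b k i)"

text \<open>Partial coset sums, in the variables p, ..., m - 1 only; \<open>H (Suc n)\<close> is the
  full sum. Truncating both the sum and the products is what makes a recursion in m
  possible.\<close>

definition H :: "nat \<Rightarrow> 'k ratfun" where "H m = (\<Sum>k\<in>{p..<m}. psi k * cc m k)"

lemma psi_p: "psi p = \<psi>" by (simp add: psi_def transpose_same id_def[symmetric])

lemma s_psi: 
  assumes "p \<le> k" "k < m" "m < n"
  shows "s m (psi k) = psi k"
proof -
  have "sref m \<circ> transpose p k = transpose p k \<circ> sref m"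
    using assms by (auto simp: fun_eq_iff sref_def transpose_def)
  then have "s m (psi k) = perm_act (transpose p k) (s m \<psi>)"
    by (simp add: psi_def perm_act_comp)
  then show ?thesis using assms by (simp add: \<psi>_sym psi_def)
qed

lemma s_psi_self:
  assumes "p \<le> m" "m < n"
  shows "s m (psi m) = psi (Suc m)"
proof (cases "m = p")
  case True
  then show ?thesis by (simp add: psi_p) (simp add: psi_def sref_def)
next
  case False
  then have "sref m \<circ> transpose p m = transpose p (Suc m) \<circ> sref m"
    using assms by (auto simp: fun_eq_iff sref_def transpose_def)
  then have "s m (psi m) = perm_act (transpose p (Suc m)) (s m \<psi>)"
    by (simp add: psi_def perm_act_comp)
  then show ?thesis using assms False by (simp add: \<psi>_sym psi_def)
qed

lemma s_cc: "k < m \<Longrightarrow> s m (cc m k) = cc m k" 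
  unfolding cc_def by (simp add: perm_act_hom perm_act_rr)

lemma s_cc_self: "s m (cc m m) = cc m (Suc m)"
proof -
  have "{p..<m} - {m} = {p..<m}" "{p..<m} - {Suc m} = {p..<m}" by auto
  then show ?thesis unfolding cc_def by (simp add: perm_act_hom perm_act_rr)
qed

lemma H_p [simp]: "H p = 0" by (simp add: H_def)

lemma H_Suc_p: "H (Suc p) = \<psi>" by (simp add: H_def psi_p cc_def)

lemma s_H: "p \<le> m \<Longrightarrow> m < n \<Longrightarrow> s m (H m) = H m"
  unfolding H_def by (simp add: perm_act_hom s_psi s_cc)

lemma cc_Suc: "p \<le> m \<Longrightarrow> k \<noteq> m \<Longrightarrow> cc (Suc m) k = rr a b k m * cc m k"
proof -
  assume "p \<le> m" "k \<noteq> m"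
  then have "{p..<Suc m} - {k} = insert m ({p..<m} - {k})" by auto
  then show ?thesis unfolding cc_def by simp
qed

lemma cc_Suc_self: "cc (Suc m) m = cc m m"
proof -
  have "{p..<Suc m} - {m} = {p..<m} - {m}" by auto
  then show ?thesis unfolding cc_def by simp
qed

text \<open>For k < m the summands agree by the three-variable identity \<open>rr_three\<close>; the
  terms k = m and k = m + 1 are exchanged by \<open>s m\<close>.\<close>

lemma H_rec:
  assumes m: "p \<le> m" "m < n"
  shows "H (Suc (Suc m)) = RR a b m (H (Suc m)) - cst (a * b) * H m"
proof -
  let ?r = "rr a b :: nat \<Rightarrow> nat \<Rightarrow> 'k ratfun"
  have H1: "H (Suc m) = (\<Sum>k\<in>{p..<m}. ?r k m * (psi k * cc m k)) + psi m * cc m m"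
    unfolding H_def using m by (simp add: cc_Suc cc_Suc_self mult_ac)
  have "cc (Suc (Suc m)) k = ?r k (Suc m) * (?r k m * cc m k)" if "k < m" for k
    using m that by (simp add: cc_Suc)
  moreover have "cc (Suc (Suc m)) m = ?r m (Suc m) * cc m m"
    "cc (Suc (Suc m)) (Suc m) = ?r (Suc m) m * cc m (Suc m)"
    using m by (simp_all add: cc_Suc cc_Suc_self)
  ultimately have H2: "H (Suc (Suc m)) = (\<Sum>k\<in>{p..<m}. ?r k m * ?r k (Suc m) * (psi k * cc m k))
      + ?r m (Suc m) * (psi m * cc m m) + ?r (Suc m) m * (psi (Suc m) * cc m (Suc m))"
    unfolding H_def using m by (simp add: mult_ac)
  have sH: "s m (H (Suc m)) = (\<Sum>k\<in>{p..<m}. ?r k (Suc m) * (psi k * cc m k)) + psi (Suc m) * cc m (Suc m)"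
    unfolding H1 using m by (simp add: perm_act_hom perm_act_rr s_psi s_psi_self s_cc s_cc_self)
  have "RR a b m (H (Suc m)) - cst (a * b) * H m =
      (\<Sum>k\<in>{p..<m}. (?r m (Suc m) * ?r k m + ?r (Suc m) m * ?r k (Suc m) - cst (a * b)) * (psi k * cc m k))
      + ?r m (Suc m) * (psi m * cc m m) + ?r (Suc m) m * (psi (Suc m) * cc m (Suc m))"
    unfolding RR_eq sH unfolding H1 H_def[of m]
    by (simp add: sum.distrib sum_subtractf sum_distrib_left algebra_simps)
  also have "\<dots> = H (Suc (Suc m))"
    unfolding H2 by (simp add: rr_three)
  finally show ?thesis ..
qed

end

text \<open>The only property of a space needed for it to contain full symmetrizations
  (\<open>symm_closed\<close>). It holds for eigenspaces of \<open>C\<close> as well as for the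
  Laurent polynomials.\<close>

definition RR_closed :: "nat \<Rightarrow> 'k::field \<Rightarrow> 'k \<Rightarrow> 'k ratfun set \<Rightarrow> bool" where
  "RR_closed n a b V \<longleftrightarrow> 0 \<in> V \<and> (\<forall>f\<in>V. \<forall>g\<in>V. f + g \<in> V) \<and> (\<forall>c. \<forall>f\<in>V. cst c * f \<in> V) \<and>
     (\<forall>i f. 1 \<le> i \<longrightarrow> i < n \<longrightarrow> f \<in> V \<longrightarrow> RR a b i f \<in> V)"

lemma (in coset_sum) H_closed:
  assumes "RR_closed n a b V" "\<psi> \<in> V" "p \<le> m" "m \<le> n"
  shows "H m \<in> V \<and> H (Suc m) \<in> V"
  using assms(3,4)
proof (induction m rule: dec_induct)
  case base
  then show ?case using assms by (simp add: H_Suc_p RR_closed_def)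
next
  case (step m)
  have "RR a b m (H (Suc m)) + cst (- (a * b)) * H m \<in> V"
    using assms(1) step p unfolding RR_closed_def by auto
  then have "H (Suc (Suc m)) \<in> V" using H_rec[of m] step by (simp add: cst_uminus)
  then show ?case using step by simp
qed

definition prs :: "nat \<Rightarrow> nat \<Rightarrow> (nat \<times> nat) set" where
  "prs p n = {(i, j). p \<le> i \<and> i < j \<and> j \<le> n}"

lemma prs_index_pairs: "index_pairs n = prs 1 n" by (simp add: prs_def index_pairs_def)

lemma finite_prs [simp]: "finite (prs p n)"
  by (rule finite_subset[of _ "{..n} \<times> {..n}"]) (auto simp: prs_def)

definition symm :: "nat \<Rightarrow> 'k::field \<Rightarrow> 'k \<Rightarrow> nat \<Rightarrow> 'k ratfun \<Rightarrow> 'k ratfun" where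
  "symm n a b p f = (\<Sum>w | w permutes {p..n}. perm_act w (f * (\<Prod>(i, j)\<in>prs p n. rr a b i j)))"

lemma perm_act_sum_permutations:
  assumes "v permutes A"
  shows "perm_act v (\<Sum>w | w permutes A. perm_act w f) = (\<Sum>w | w permutes A. perm_act w f)"
proof -
  have "perm_act v (\<Sum>w | w permutes A. perm_act w f) = (\<Sum>w | w permutes A. perm_act (v \<circ> w) f)"
    using permutes_bij[OF assms] by (simp add: perm_act_hom perm_act_comp permutes_bij)
  also have "\<dots> = (\<Sum>w | w permutes A. perm_act w f)"
    by (rule sum.reindex_bij_witness[of _ "\<lambda>w. inv v \<circ> w" "\<lambda>w. v \<circ> w"])
       (auto simp: permutes_compose permutes_inv assms permutes_inv_o[OF assms] comp_assoc[symmetric])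
  finally show ?thesis .
qed

lemma symm_sym: "v permutes {p..n} \<Longrightarrow> perm_act v (symm n a b p f) = symm n a b p f"
  unfolding symm_def by (rule perm_act_sum_permutations)

lemma prs_split: "p \<le> n \<Longrightarrow> prs p n = prs (Suc p) n \<union> (\<lambda>j. (p, j)) ` {Suc p..n}"
  by (auto simp: prs_def image_iff)

lemma symm_Suc:
  assumes "1 \<le> p" "p \<le> n"
  shows "symm n a b p f = (\<Sum>k\<in>{p..n}. perm_act (transpose p k)
      ((\<Prod>j\<in>{Suc p..n}. rr a b p j) * symm n a b (Suc p) f))"
proof -
  let ?P = "\<Prod>j\<in>{Suc p..n}. rr a b p j" and ?Q = "\<Prod>(i, j)\<in>prs (Suc p) n. rr a b i j"
  have "(\<Prod>(i, j)\<in>prs p n. rr a b i j) = ?Q * (\<Prod>(i, j)\<in>(\<lambda>j. (p, j)) ` {Suc p..n}. rr a b i j)"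
    unfolding prs_split[OF assms(2)] by (rule prod.union_disjoint) (simp_all, auto simp: prs_def)
  also have "(\<Prod>(i, j)\<in>(\<lambda>j. (p, j)) ` {Suc p..n}. rr a b i j) = ?P"
    by (subst prod.reindex) (auto simp: inj_on_def)
  finally have PQ: "(\<Prod>(i, j)\<in>prs p n. rr a b i j) = ?P * ?Q" by (simp add: mult.commute)
  have ins: "{p..n} = insert p {Suc p..n}" using assms by auto
  have Pinv: "perm_act w ?P = ?P" if w: "w permutes {Suc p..n}" for w
  proof -
    have "w p = p" using w by (simp add: permutes_def)
    then have "perm_act w ?P = (\<Prod>j\<in>{Suc p..n}. rr a b p (w j))"
      by (simp add: perm_act_hom perm_act_rr permutes_bij[OF w])
    also have "\<dots> = ?P" using prod.permute[OF w, of "rr a b p"] by (simp add: o_def)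
    finally show ?thesis .
  qed
  have "symm n a b p f = (\<Sum>k\<in>{p..n}. \<Sum>w | w permutes {Suc p..n}.
      perm_act (transpose p k \<circ> w) (f * (?P * ?Q)))"
    unfolding symm_def PQ unfolding ins by (rule sum_over_permutations_insert) auto
  also have "\<dots> = (\<Sum>k\<in>{p..n}. perm_act (transpose p k)
      (\<Sum>w | w permutes {Suc p..n}. perm_act w (f * (?P * ?Q))))"
    by (simp add: perm_act_hom(7) perm_act_comp permutes_bij)
  also have "(\<Sum>w | w permutes {Suc p..n}. perm_act w (f * (?P * ?Q))) =
      (\<Sum>w | w permutes {Suc p..n}. ?P * perm_act w (f * ?Q))"
    by (rule sum.cong) (simp_all add: perm_act_hom(2) permutes_bij Pinv mult_ac)
  finally show ?thesis by (simp add: symm_def sum_distrib_left)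
qed

text \<open>Downward induction on p: the symmetrization over {p + 1..n} serves as \<psi>, and its
  coset sum is \<open>H (Suc n)\<close>, which \<open>H_rec\<close> keeps inside V.\<close>

lemma symm_closed:
  assumes V: "RR_closed n a b V" and f: "f \<in> V" and "p \<le> Suc n" "1 \<le> p"
  shows "symm n a b p f \<in> V"
  using assms(3,4)
proof (induction p rule: inc_induct)
  case base
  have "prs (Suc n) n = {}" by (auto simp: prs_def)
  then show ?case using f by (simp add: symm_def)
next
  case (step p)
  let ?\<psi> = "symm n a b (Suc p) f"
  interpret coset_sum n p a b ?\<psi>
  proof
    show "1 \<le> p" using step by simp
    fix i assume "p < i" "i < n"
    then have "sref i permutes {Suc p..n}" by (simp add: sref_def permutes_swap_id)
    then show "s i ?\<psi> = ?\<psi>" by (rule symm_sym)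
  qed
  have "perm_act (transpose p k) ((\<Prod>j\<in>{Suc p..n}. rr a b p j) * ?\<psi>) = psi k * cc (Suc n) k"
    if k: "k \<in> {p..n}" for k
  proof -
    have t: "transpose p k permutes {p..n}" using k by (simp add: permutes_swap_id)
    have "perm_act (transpose p k) (\<Prod>j\<in>{Suc p..n}. rr a b p j) = (\<Prod>j\<in>{Suc p..n}. rr a b k (transpose p k j))"
      by (simp add: perm_act_hom(8) perm_act_rr)
    also have "\<dots> = (\<Prod>j\<in>transpose p k ` {Suc p..n}. rr a b k j)"
      by (subst prod.reindex) (auto intro!: inj_onI dest!: injD[OF bij_is_inj[OF permutes_bij[OF t]]])
    also have "transpose p k ` {Suc p..n} = {p..<Suc n} - {k}"
    proof -
      have "{Suc p..n} = {p..n} - {p}" by auto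
      then have "transpose p k ` {Suc p..n} = transpose p k ` {p..n} - {transpose p k p}"
        by (simp add: image_set_diff[of "transpose p k"])
      then show ?thesis using permutes_image[OF t] by (simp add: atLeastLessThanSuc_atLeastAtMost)
    qed
    finally show ?thesis by (simp add: perm_act_hom(2) psi_def cc_def mult.commute)
  qed
  then have "symm n a b p f = H (Suc n)"
    using step p symm_Suc[of p n a b f] by (simp add: H_def atLeastLessThanSuc_atLeastAtMost)
  then show ?case using H_closed[OF V step.IH] step p by auto
qed

section \<open>Macdonald's operator\<close>

definition qshift :: "'k::field \<Rightarrow> nat \<Rightarrow> 'k ratfun \<Rightarrow> 'k ratfun" where
  "qshift q k = msub (\<lambda>i. if i = k then inverse q else 1) (\<lambda>x. x)"

text \<open>For t nonzero, t^{n-1} times the usual first-order Macdonald operator with parameters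
  q^{-1} and t^{-1}.\<close>

definition macop :: "nat \<Rightarrow> 'k::field \<Rightarrow> 'k \<Rightarrow> 'k ratfun \<Rightarrow> 'k ratfun" where
  "macop n q t f = (\<Sum>k\<in>{1..n}. qshift q k f * (\<Prod>i\<in>{1..n} - {k}. rr 1 t k i))"

lemma monsub_qshift: "q \<noteq> 0 \<Longrightarrow> monsub (\<lambda>i. if i = k then inverse q else 1) (\<lambda>x. x)"
  by standard (auto simp: bij_betw_def)

text \<open>
  For \<open>a + b = c + c'\<close> and \<open>a b = c c'\<close> the recursion for \<open>H\<close> factors, so that the products of
  the operators \<open>RR i - c\<close> telescope.
\<close>

lemma (in coset_sum) telescope:
  assumes p1: "p = 1" and c: "c = a \<or> c = b"
    and U0: "U 0 = \<psi>" and U: "\<And>m. Suc m < n \<Longrightarrow> U (Suc m) = RR a b (Suc m) (U m) - cst c * U m"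
    and c0: "c \<noteq> 0" and n: "n \<ge> 1"
  shows "(\<Sum>m<n. cst (inverse c ^ m) * U m) = cst (inverse c ^ (n - 1)) * H (Suc n)"
proof -
  define c' where "c' = a + b - c"
  have cc': "a * b = c * c'" "a + b = c + c'" using c by (auto simp: c'_def algebra_simps)
  have U_H: "U m = H (Suc (Suc m)) - cst c * H (Suc m)" if "m < n" for m
    using that
  proof (induction m)
    case 0
    then show ?case using U0 H_Suc_p H_p p1 by simp
  next
    case (Suc m)
    have "RR a b (Suc m) (H (Suc m)) = cst (a + b) * H (Suc m)"
      using Suc p1 by (intro RR_fix s_H) auto
    moreover have "H (Suc (Suc (Suc m))) = RR a b (Suc m) (H (Suc (Suc m))) - cst (a * b) * H (Suc m)"
      using Suc p1 by (intro H_rec) auto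
    ultimately have E: "RR a b (Suc m) (H (Suc m)) = cst (c + c') * H (Suc m)"
      "RR a b (Suc m) (H (Suc (Suc m))) = H (Suc (Suc (Suc m))) + cst (c * c') * H (Suc m)"
      by (simp_all add: cc')
    have "U m = H (Suc (Suc m)) - cst c * H (Suc m)" using Suc by simp
    then have "U (Suc m) = H (Suc (Suc (Suc m))) + cst (c * c') * H (Suc m) - cst c * (cst (c + c') * H (Suc m))
        - cst c * (H (Suc (Suc m)) - cst c * H (Suc m))"
      by (simp only: U[OF Suc.prems] RR_diff RR_cst E)
    then show ?case by (simp add: cst_mult cst_add algebra_simps)
  qed
  have "(\<Sum>m<k. cst (inverse c ^ m) * U m) = cst (c * inverse c ^ k) * H (Suc k)" if "k \<le> n" for k
    using that
  proof (induction k)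
    case 0
    then show ?case using H_p p1 by simp
  next
    case (Suc k)
    have "(\<Sum>m<Suc k. cst (inverse c ^ m) * U m) = cst (inverse c ^ k * c) * H (Suc k)
        + cst (inverse c ^ k) * (H (Suc (Suc k)) - cst c * H (Suc k))"
      using Suc by (simp add: U_H mult.commute)
    also have "\<dots> = cst (inverse c ^ k) * H (Suc (Suc k))"
      by (simp only: cst_mult) (simp add: algebra_simps)
    also have "inverse c ^ k = c * inverse c ^ Suc k" using c0 by simp
    finally show ?case .
  qed
  from this[of n] show ?thesis using n c0 by (cases n) auto
qed

lemma xvar_diff_cst_nonzero:
  fixes c :: "'k::field"
  shows "i \<noteq> j \<Longrightarrow> xvar j - cst c * xvar i \<noteq> 0"
  using xvar_scaled_neq[of 1 j i c] by auto

context hecke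
begin

text \<open>\<open>om\<close> is a cyclic permutation followed by the q-shift of x_1, and on
  symmetric functions only the shift remains visible.\<close>

lemma om_perm_sym:
  assumes "\<And>w. w permutes {1..n} \<Longrightarrow> perm_act w g = g"
  shows "om g = qshift q 1 g"
    and "k \<in> {1..n} \<Longrightarrow> perm_act (transpose 1 k) (om g) = qshift q k g"
proof -
  have cyc: "cyc permutes {1..n}"
    using n_pos bij_cyc by (auto simp: permutes_def cyc_def bij_iff)
  have "qshift q 1 (perm_act cyc g) = om g"
  proof -
    have "(\<lambda>i. 1 * (if cyc i = 1 then inverse q else 1)) = qn"
      using n_pos by (auto simp: fun_eq_iff cyc_def qn_def)
    then show ?thesis unfolding qshift_def perm_act_msub om_def
      by (subst msub_msub) (auto simp: monsub_qshift monsub_perm bij_cyc o_def)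
  qed
  then show 1: "om g = qshift q 1 g" using assms[OF cyc] by simp
  assume k: "k \<in> {1..n}"
  have t: "transpose 1 k permutes {1..n}" using k n_pos by (simp add: permutes_swap_id)
  have "perm_act (transpose 1 k) (qshift q 1 g) = qshift q k (perm_act (transpose 1 k) g)"
  proof -
    have "(\<lambda>i. (if i = 1 then inverse q else 1) * 1) = (\<lambda>i. 1 * (if transpose 1 k i = k then inverse q else 1))"
      by (auto simp: fun_eq_iff transpose_def)
    then show ?thesis
      using msub_msub[OF monsub_perm[OF permutes_bij[OF t]] monsub_qshift[OF q_nonzero, of 1], of g]
        msub_msub[OF monsub_qshift[OF q_nonzero, of k] monsub_perm[OF permutes_bij[OF t]], of g]
      unfolding qshift_def perm_act_msub by (simp add: o_def)
  qed
  then show "perm_act (transpose 1 k) (om g) = qshift q k g" using 1 assms[OF t] by simp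
qed

lemma s_om_sym:
  assumes "\<And>w. w permutes {1..n} \<Longrightarrow> perm_act w g = g" "1 < i" "i < n"
  shows "s i (om g) = om g"
proof -
  obtain k where k: "i = Suc k" "1 \<le> k" "Suc k < n" using assms by (cases i) auto
  have "s k g = g" using k by (intro assms sref_permutes) auto
  then show ?thesis using om_s[of k g] k by simp
qed

lemma T_RR: "T i f = RR 1 t i f - cst t * f"
proof -
  have "ca x y = (x - cst t * y) / (x - y) - cst t" "cb x y = (y - cst t * x) / (y - x)" if "x \<noteq> y" for x y
    using that by (simp_all add: ca_def cb_def divide_simps) (simp_all add: algebra_simps)
  then show ?thesis
    by (simp add: T_def RR_eq rr_def left_diff_distrib)
qed

lemma C_sym:
  assumes sym: "\<And>w. w permutes {1..n} \<Longrightarrow> perm_act w g = g"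
  shows "C g = cst (inverse t ^ (n - 1)) * macop n q t g"
proof -
  interpret coset_sum n 1 1 t "om g"
    by standard (use s_om_sym[OF sym] in auto)
  have "C g = (\<Sum>m<n. cst (inverse t ^ m) * up m (om g))"
    unfolding C_def by (intro sum.cong refl Y_fix sym sref_permutes) auto
  also have "\<dots> = cst (inverse t ^ (n - 1)) * H (Suc n)"
    \<comment> \<open>The coefficients are (a, b) = (1, t) and the root is c = t: by
      \<open>T_RR\<close> each T_i is \<open>RR 1 t i\<close> minus t.\<close>
    by (rule telescope) (use n_pos in \<open>auto simp: T_RR\<close>)
  also have "H (Suc n) = macop n q t g"
    using om_perm_sym(2)[OF sym]
    unfolding H_def macop_def psi_def cc_def
    by (intro sum.cong arg_cong2[where f = "(*)"]) (auto intro!: prod.cong)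
  finally show ?thesis .
qed

section \<open>Conjugation by A_rho and the passage from t to q t\<close>

definition Arho :: "'k ratfun" where "Arho = (\<Prod>(i, j)\<in>prs 1 n. xvar j - cst t * xvar i)"

lemma Arho_A_rho: "A_rho n t = Arho" by (simp add: A_rho_def Arho_def prs_index_pairs)

lemma Arho_nonzero: "Arho \<noteq> 0"
proof -
  have "\<forall>x\<in>prs 1 n. (case x of (i, j) \<Rightarrow> xvar j - cst t * xvar i) \<noteq> (0 :: 'k ratfun)"
    using xvar_diff_cst_nonzero[where c = t] by (auto simp: prs_def)
  then show ?thesis unfolding Arho_def by simp
qed

end

lemma prod_prs_sref:
  fixes G :: "nat \<Rightarrow> nat \<Rightarrow> 'a::comm_monoid_mult"
  assumes "1 \<le> i" "i < n"
  shows "(\<Prod>(k, l)\<in>prs 1 n - {(i, Suc i)}. G (sref i k) (sref i l)) = (\<Prod>(k, l)\<in>prs 1 n - {(i, Suc i)}. G k l)"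
proof (rule prod.reindex_bij_witness[of _ "map_prod (sref i) (sref i)" "map_prod (sref i) (sref i)"])
  fix x assume "x \<in> prs 1 n - {(i, Suc i)}"
  then show "map_prod (sref i) (sref i) x \<in> prs 1 n - {(i, Suc i)}"
    using assms by (auto simp: prs_def sref_def transpose_def split: if_splits)
  then show "map_prod (sref i) (sref i) x \<in> prs 1 n - {(i, Suc i)}" .
qed (auto simp: sref_def)

lemma prod_prs_remove:
  assumes "1 \<le> i" "i < n"
  shows "(\<Prod>(k, l)\<in>prs 1 n. G k l) = (G i (Suc i) :: 'a::comm_monoid_mult) * (\<Prod>(k, l)\<in>prs 1 n - {(i, Suc i)}. G k l)"
proof -
  have "(i, Suc i) \<in> prs 1 n" using assms by (simp add: prs_def)
  then show ?thesis using prod.remove[of "prs 1 n" "(i, Suc i)" "\<lambda>(k, l). G k l"] by simp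
qed

context hecke
begin

lemma Arho_split:
  assumes "1 \<le> i" "i < n"
  obtains B where "Arho = (xvar (Suc i) - cst t * xvar i) * B" "s i B = B"
proof
  let ?B = "\<Prod>(k, l)\<in>prs 1 n - {(i, Suc i)}. xvar l - cst t * xvar k :: 'k ratfun"
  show "Arho = (xvar (Suc i) - cst t * xvar i) * ?B"
    unfolding Arho_def by (rule prod_prs_remove[OF assms])
  have "s i ?B = (\<Prod>(k, l)\<in>prs 1 n - {(i, Suc i)}. xvar (sref i l) - cst t * xvar (sref i k))"
    by (simp add: perm_act_hom split_def)
  also have "\<dots> = ?B" by (rule prod_prs_sref[OF assms, of "\<lambda>k l. xvar l - cst t * xvar k"])
  finally show "s i ?B = ?B" .
qed

text \<open>Conjugation by A_rho turns 1 - T_i, whose image is the eigenspace of T_i for -t, into a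
  two-term symmetrizer. Only the factor of the pair (i, i + 1) matters, the rest of A_rho being
  invariant under \<open>s i\<close>.\<close>

lemma Arho_RR:
  assumes "1 \<le> i" "i < n"
  shows "Arho * RR t 1 i f = Arho * f - T i (Arho * f)"
proof -
  obtain B where B: "Arho = (xvar (Suc i) - cst t * xvar i) * B" "s i B = B" using assms by (rule Arho_split)
  let ?x = "xvar i :: 'k ratfun" and ?y = "xvar (Suc i) :: 'k ratfun"
  have "T i (Arho * f) = B * T i ((?y - cst t * ?x) * f)"
    unfolding B using T_sym[OF B(2), of "(?y - cst t * ?x) * f"] by (simp add: mult_ac)
  moreover have "(?y - cst t * ?x) * RR t 1 i f = (?y - cst t * ?x) * f - T i ((?y - cst t * ?x) * f)"
    by (simp add: RR_eq rr_def T_def ca_def cb_def s_hom divide_simps) (simp add: algebra_simps)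
  ultimately show ?thesis unfolding B(1)
    by (simp add: mult.assoc mult.left_commute[of _ B] right_diff_distrib[symmetric] del: mult_cancel_left)
qed

text \<open>The pairs (i, n) become pairs of i + 1 with q^{-1} x_1, and the others are shifted onto
  the pairs in {2..n}, which also occur in A_rho itself.\<close>

lemma om_Arho:
  "om Arho = Arho * (\<Prod>i\<in>{2..n}. (cst (inverse q) * xvar 1 - cst t * xvar i) / (xvar i - cst t * xvar 1))"
proof -
  let ?Q = "\<Prod>(i, j)\<in>prs 2 n. xvar j - cst t * xvar i :: 'k ratfun"
  have A: "Arho = ?Q * (\<Prod>j\<in>{2..n}. xvar j - cst t * xvar 1)"
  proof -
    have "prs 1 n = prs 2 n \<union> (\<lambda>j. (1, j)) ` {2..n}" using prs_split[OF n_pos] by (simp add: numeral_2_eq_2)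
    then have "Arho = (\<Prod>(i, j)\<in>prs 2 n \<union> (\<lambda>j. (1, j)) ` {2..n}. xvar j - cst t * xvar i)"
      by (simp only: Arho_def)
    also have "\<dots> = ?Q * (\<Prod>(i, j)\<in>(\<lambda>j. (1, j)) ` {2..n}. xvar j - cst t * xvar i)"
      by (rule prod.union_disjoint) (simp_all, auto simp: prs_def)
    also have "(\<Prod>(i, j)\<in>(\<lambda>j. (1, j)) ` {2..n}. xvar j - cst t * xvar i :: 'k ratfun) = (\<Prod>j\<in>{2..n}. xvar j - cst t * xvar 1)"
      by (subst prod.reindex) (auto simp: inj_on_def)
    finally show ?thesis .
  qed
  have "om Arho = ?Q * (\<Prod>i\<in>{2..n}. cst (inverse q) * xvar 1 - cst t * xvar i)"
  proof -
    have "prs 1 n = prs 1 (n - 1) \<union> (\<lambda>i. (i, n)) ` {1..<n}" by (auto simp: prs_def)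
    then have "om Arho = (\<Prod>(i, j)\<in>prs 1 (n - 1) \<union> (\<lambda>i. (i, n)) ` {1..<n}. om (xvar j - cst t * xvar i))"
      by (simp add: Arho_def om_prod split_def)
    also have "\<dots> = (\<Prod>(i, j)\<in>prs 1 (n - 1). om (xvar j - cst t * xvar i)) *
        (\<Prod>(i, j)\<in>(\<lambda>i. (i, n)) ` {1..<n}. om (xvar j - cst t * xvar i))"
      by (rule prod.union_disjoint) (simp_all, auto simp: prs_def)
    also have "(\<Prod>(i, j)\<in>prs 1 (n - 1). om (xvar j - cst t * xvar i)) =
        (\<Prod>(i, j)\<in>prs 1 (n - 1). xvar (Suc j) - cst t * xvar (Suc i) :: 'k ratfun)"
      by (rule prod.cong) (auto simp: prs_def om.msub_diff[folded om_def] om.msub_mult[folded om_def] om_xvar)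
    also have "\<dots> = ?Q"
      by (rule prod.reindex_bij_witness[of _ "\<lambda>(i, j). (i - 1, j - 1)" "\<lambda>(i, j). (Suc i, Suc j)"])
         (auto simp: prs_def)
    also have "(\<Prod>(i, j)\<in>(\<lambda>i. (i, n)) ` {1..<n}. om (xvar j - cst t * xvar i)) =
        (\<Prod>i\<in>{1..<n}. cst (inverse q) * xvar 1 - cst t * xvar (Suc i) :: 'k ratfun)"
      by (subst prod.reindex)
         (auto simp: inj_on_def om.msub_diff[folded om_def] om.msub_mult[folded om_def] om_xvar om_xvar_n intro!: prod.cong)
    also have "\<dots> = (\<Prod>i\<in>{2..n}. cst (inverse q) * xvar 1 - cst t * xvar i)"
      by (rule prod.reindex_bij_witness[of _ "\<lambda>i. i - 1" Suc]) auto
    finally show ?thesis .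
  qed
  moreover have "(\<Prod>j\<in>{2..n}. xvar j - cst t * xvar 1) \<noteq> (0 :: 'k ratfun)"
    using xvar_diff_cst_nonzero[where c = t] by auto
  ultimately show ?thesis unfolding A prod_dividef by simp
qed

lemma C_antisym:
  assumes sym: "\<And>w. w permutes {1..n} \<Longrightarrow> perm_act w g = g"
  shows "C (Arho * g) = Arho * (cst ((inverse t * inverse q) ^ (n - 1)) * macop n q (q * t) g)"
proof -
  define fac where "fac = (\<lambda>k i. (cst (inverse q) * xvar k - cst t * xvar i) / (xvar i - cst t * xvar k) :: 'k ratfun)"
  define \<psi> where "\<psi> = (\<Prod>i\<in>{2..n}. fac 1 i) * om g"
  have om: "om (Arho * g) = Arho * \<psi>"
    by (simp only: om.msub_mult[folded om_def] om_Arho \<psi>_def fac_def mult.assoc)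
  have fac_perm: "perm_act w (\<Prod>i\<in>B. fac k i) = (\<Prod>i\<in>w ` B. fac (w k) i)" if "bij w" for w k B
  proof -
    have "inj_on w B" using that by (meson bij_is_inj inj_on_subset subset_UNIV)
    then show ?thesis using that by (simp add: prod.reindex fac_def perm_act_hom o_def)
  qed
  \<comment> \<open>Here t becomes q t. With x = x_k, y = x_i, u = t and Q = q, the denominator of
    the quotient of the A_rho products cancels the numerator of \<open>rr t 1 k i\<close>, and
    pulling out Q' = q^{-1} leaves x_k - q t x_i over x_k - x_i.\<close>
  have cancel: "(Q' * x - u * y) / (y - u * x) * ((u * x - y) / (x - y)) = - Q' * ((x - Q * u * y) / (x - y))"
    if "y - u * x \<noteq> 0" "x - y \<noteq> 0" "Q * Q' = 1" for Q Q' u x y :: "'k ratfun"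
  proof -
    have 1: "Q' * x - u * y = Q' * (x - Q * u * y)" using that(3) by algebra
    have 2: "(u * x - y) / (y - u * x) = - 1" using that(1) by (simp add: divide_simps)
    have "(Q' * x - u * y) / (y - u * x) * ((u * x - y) / (x - y)) =
        (Q' * x - u * y) * ((u * x - y) / (y - u * x)) / (x - y)" by (simp add: mult.commute)
    then show ?thesis unfolding 1 2 by simp
  qed
  interpret coset_sum n 1 t 1 \<psi>
  proof
    fix i assume i: "1 < i" "i < n"
    have "sref i permutes {2..n}" using i by (simp add: sref_def permutes_swap_id)
    then have "sref i ` {2..n} = {2..n}" by (rule permutes_image)
    moreover have "s i (om g) = om g" using i by (intro s_om_sym sym) auto
    ultimately show "s i \<psi> = \<psi>" using i by (simp add: \<psi>_def perm_act_hom(2) fac_perm)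
  qed simp
  \<comment> \<open>After division by A_rho a step of the chain is 1 - \<open>RR t 1\<close>. The
    alternating sign, which also occurs in \<open>Y_anti\<close>, turns it into
    \<open>RR t 1\<close> - 1, so \<open>telescope\<close> applies with root c = 1.\<close>
  define U where "U = (\<lambda>m. (- 1) ^ m * (up m (Arho * \<psi>) / Arho))"
  have T_anti: "T i (Arho * g) = - cst t * (Arho * g)" if "1 \<le> i" "i < n" for i
  proof -
    have "RR t 1 i g = cst (t + 1) * g" by (rule RR_fix) (use sym[OF sref_permutes[OF that]] in simp)
    then have "T i (Arho * g) = Arho * g - Arho * (cst (t + 1) * g)"
      using Arho_RR[OF that, of g] by (simp add: algebra_simps)
    then show ?thesis by (simp add: cst_add algebra_simps)
  qed
  have "C (Arho * g) = (\<Sum>m<n. cst ((- inverse t) ^ (n - 1) * (- 1) ^ m) * up m (Arho * \<psi>))"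
    unfolding C_def om[symmetric] by (intro sum.cong refl Y_anti T_anti) auto
  also have "\<dots> = cst ((- inverse t) ^ (n - 1)) * (Arho * (\<Sum>m<n. cst (inverse 1 ^ m) * U m))"
    unfolding U_def by (simp add: sum_distrib_left cst_mult cst_power cst_uminus Arho_nonzero mult_ac)
  also have "(\<Sum>m<n. cst (inverse 1 ^ m) * U m) = cst (inverse 1 ^ (n - 1)) * H (Suc n)"
  proof (rule telescope)
    show "U 0 = \<psi>" by (simp add: U_def Arho_nonzero)
    fix m assume m: "Suc m < n"
    have "up m (Arho * \<psi>) = Arho * (up m (Arho * \<psi>) / Arho)" by (simp add: Arho_nonzero)
    then have "T (Suc m) (up m (Arho * \<psi>)) =
        Arho * (up m (Arho * \<psi>) / Arho) - Arho * RR t 1 (Suc m) (up m (Arho * \<psi>) / Arho)"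
      using Arho_RR[of "Suc m" "up m (Arho * \<psi>) / Arho"] m by simp
    then have E: "up (Suc m) (Arho * \<psi>) / Arho = up m (Arho * \<psi>) / Arho - RR t 1 (Suc m) (up m (Arho * \<psi>) / Arho)"
      by (simp add: Arho_nonzero diff_divide_distrib)
    have "RR t 1 (Suc m) (U m) = (- 1) ^ m * RR t 1 (Suc m) (up m (Arho * \<psi>) / Arho)"
      unfolding U_def using RR_cst[of t 1 "Suc m" "(- 1) ^ m" "up m (Arho * \<psi>) / Arho"]
      by (simp only: cst_power cst_uminus cst_1)
    moreover have "U (Suc m) = - ((- 1) ^ m * (up m (Arho * \<psi>) / Arho - RR t 1 (Suc m) (up m (Arho * \<psi>) / Arho)))"
      unfolding U_def E by simp
    moreover have "cst 1 * U m = (- 1) ^ m * (up m (Arho * \<psi>) / Arho)" by (simp add: U_def)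
    ultimately show "U (Suc m) = RR t 1 (Suc m) (U m) - cst 1 * U m"
      by (simp only: right_diff_distrib minus_diff_eq)
  qed (use n_pos in auto)
  also have "H (Suc n) = cst ((- inverse q) ^ (n - 1)) * macop n q (q * t) g"
  proof -
    have "psi k * cc (Suc n) k = cst ((- inverse q) ^ (n - 1)) * (qshift q k g * (\<Prod>i\<in>{1..n} - {k}. rr 1 (q * t) k i))"
      if k: "k \<in> {1..n}" for k
    proof -
      have t: "transpose 1 k permutes {1..n}" using k n_pos by (simp add: permutes_swap_id)
      have img: "transpose 1 k ` {2..n} = {1..n} - {k}"
      proof -
        have "{2..n} = {1..n} - {1}" by auto
        moreover have "transpose 1 k ` ({1..n} - {1}) = transpose 1 k ` {1..n} - transpose 1 k ` {1}"
          by (rule image_set_diff) (simp add: bij_is_inj)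
        ultimately show ?thesis using permutes_image[OF t] by simp
      qed
      have "psi k = perm_act (transpose 1 k) \<psi>" by (rule psi_def)
      also have "\<dots> = (\<Prod>i\<in>{1..n} - {k}. fac k i) * qshift q k g"
        by (simp only: \<psi>_def perm_act_hom(2)[OF bij_transpose] fac_perm[OF bij_transpose]
            transpose_apply_first img om_perm_sym(2)[OF sym k])
      finally have "psi k = (\<Prod>i\<in>{1..n} - {k}. fac k i) * qshift q k g" .
      moreover have "cc (Suc n) k = (\<Prod>i\<in>{1..n} - {k}. rr t 1 k i)"
        unfolding cc_def by (simp add: atLeastLessThanSuc_atLeastAtMost)
      moreover have "(\<Prod>i\<in>{1..n} - {k}. fac k i) * (\<Prod>i\<in>{1..n} - {k}. rr t 1 k i)
          = (\<Prod>i\<in>{1..n} - {k}. cst (- inverse q) * rr 1 (q * t) k i)"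
        unfolding prod.distrib[symmetric]
      proof (rule prod.cong)
        fix i assume "i \<in> {1..n} - {k}"
        then have "xvar i - cst t * xvar k \<noteq> (0 :: 'k ratfun)" "xvar k - xvar i \<noteq> (0 :: 'k ratfun)"
          using xvar_diff_cst_nonzero[where c = t] by auto
        moreover have "cst q * cst (inverse q) = (1 :: 'k ratfun)" by (simp add: cst_inverse)
        ultimately show "fac k i * rr t 1 k i = cst (- inverse q) * rr 1 (q * t) k i"
          unfolding fac_def rr_def cst_uminus cst_mult cst_1 mult_1 by (intro cancel)
      qed simp
      moreover have "card ({1..n} - {k}) = n - 1" using k by simp
      ultimately show ?thesis by (simp add: prod.distrib cst_power mult_ac)
    qed
    then show ?thesis
      unfolding H_def macop_def sum_distrib_left by (intro sum.cong) auto
  qed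
  finally show ?thesis
    by (simp add: mult_ac flip: cst_mult power_mult_distrib)
qed

end

section \<open>Leading coefficients\<close>

text \<open>An upper bound for the exponents together with the coefficient there; c = 0 is allowed,
  so sums may lose their leading term.\<close>

definition lx :: "(nat \<Rightarrow>\<^sub>0 int) \<Rightarrow> 'k \<Rightarrow> 'k::field laurent \<Rightarrow> bool" where
  "lx \<nu> c p \<longleftrightarrow> (\<forall>\<kappa>\<in>keys p. \<kappa> \<le> \<nu>) \<and> lookup p \<nu> = c"

lemma lx_add: "lx \<nu> c p \<Longrightarrow> lx \<nu> d r \<Longrightarrow> lx \<nu> (c + d) (p + r)"
  unfolding lx_def using keys_add[of p r] by (auto simp: lookup_add)

lemma lx_mult:
  assumes "lx \<mu> c p" "lx \<nu> d r"
  shows "lx (\<mu> + \<nu>) (c * d) (p * r)"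
  unfolding lx_def
proof (intro conjI ballI)
  fix \<kappa> assume "\<kappa> \<in> keys (p * r)"
  then obtain a b where "a \<in> keys p" "b \<in> keys r" "\<kappa> = a + b" using keys_mult[of p r] by blast
  then show "\<kappa> \<le> \<mu> + \<nu>" using assms by (auto simp: lx_def intro: add_mono)
next
  \<comment> \<open>The bounds are inserted because they need not be exponents that occur when c or
    d is 0.\<close>
  let ?P = "insert \<mu> (keys p)" and ?R = "insert \<nu> (keys r)"
  have iff: "a + b = \<mu> + \<nu> \<longleftrightarrow> a = \<mu> \<and> b = \<nu>" if "a \<in> ?P" "b \<in> ?R" for a b
  proof
    assume eq: "a + b = \<mu> + \<nu>"
    have le: "a \<le> \<mu>" "b \<le> \<nu>" using that assms by (auto simp: lx_def)
    have "a = \<mu>"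
    proof (rule ccontr)
      assume "a \<noteq> \<mu>"
      then have "a + b < \<mu> + \<nu>" using le by (intro add_less_le_mono) auto
      then show False using eq by simp
    qed
    then show "a = \<mu> \<and> b = \<nu>" using eq by simp
  qed simp
  have "p * r = (\<Sum>a\<in>?P. single a (lookup p a)) * (\<Sum>b\<in>?R. single b (lookup r b))"
    by (subst poly_mapping_sum_single[of ?P p], simp, blast, subst poly_mapping_sum_single[of ?R r], simp, blast) (rule refl)
  also have "\<dots> = (\<Sum>a\<in>?P. \<Sum>b\<in>?R. single (a + b) (lookup p a * lookup r b))"
    by (simp only: sum_product mult_single)
  finally have "lookup (p * r) (\<mu> + \<nu>) = (\<Sum>a\<in>?P. \<Sum>b\<in>?R. lookup (single (a + b) (lookup p a * lookup r b)) (\<mu> + \<nu>))"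
    by (simp only: lookup_sum)
  also have "\<dots> = (\<Sum>a\<in>?P. \<Sum>b\<in>?R. if b = \<nu> then if a = \<mu> then lookup p a * lookup r b else 0 else 0)"
    using iff by (intro sum.cong refl) (auto simp: lookup_single when_def)
  also have "\<dots> = (\<Sum>a\<in>?P. if a = \<mu> then lookup p a * lookup r \<nu> else 0)"
    by (intro sum.cong refl) (simp only: sum.delta finite_insert finite_keys insert_iff simp_thms if_True)
  also have "\<dots> = lookup p \<mu> * lookup r \<nu>"
    by (simp only: sum.delta finite_insert finite_keys insert_iff simp_thms if_True)
  finally show "lookup (p * r) (\<mu> + \<nu>) = c * d" using assms by (simp add: lx_def)
qed

text \<open>\<open>PL \<nu> c f\<close>: expanded at infinity in the lexicographic order, \<open>f\<close> is \<open>c x\<^sup>\<nu>\<close> plus lower terms.\<close>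

definition PL :: "(nat \<Rightarrow>\<^sub>0 int) \<Rightarrow> 'k \<Rightarrow> 'k::field ratfun \<Rightarrow> bool" where
  "PL \<nu> c f \<longleftrightarrow> (\<exists>a b \<beta>. lx \<beta> 1 b \<and> lx (\<nu> + \<beta>) c a \<and> f = to_fract a / to_fract b)"

lemma lx_nonzero: "lx \<beta> 1 b \<Longrightarrow> b \<noteq> 0" by (auto simp: lx_def)

lemma PL_laurent: "lx \<nu> c p \<Longrightarrow> PL \<nu> c (to_fract p)"
  unfolding PL_def by (intro exI[of _ p] exI[of _ 1] exI[of _ 0]) (simp add: lx_def)

lemma PL_0: "PL \<nu> 0 0"
  using PL_laurent[of \<nu> 0 0] by (simp add: lx_def)

lemma PL_1: "PL 0 1 1"
  using PL_laurent[of 0 1 1] by (simp add: lx_def)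

lemma PL_add:
  assumes "PL \<nu> c f" "PL \<nu> d g" shows "PL \<nu> (c + d) (f + g)"
proof -
  obtain a b \<beta> where f: "lx \<beta> 1 b" "lx (\<nu> + \<beta>) c a" "f = to_fract a / to_fract b" using assms(1) by (auto simp: PL_def)
  obtain a' b' \<beta>' where g: "lx \<beta>' 1 b'" "lx (\<nu> + \<beta>') d a'" "g = to_fract a' / to_fract b'" using assms(2) by (auto simp: PL_def)
  have "lx (\<nu> + (\<beta> + \<beta>')) (c + d) (a * b' + a' * b)"
    using lx_add[OF lx_mult[OF f(2) g(1)] , of d "a' * b"] lx_mult[OF g(2) f(1)] by (simp add: ac_simps)
  moreover have "lx (\<beta> + \<beta>') 1 (b * b')" using lx_mult[OF f(1) g(1)] by simp
  moreover have "f + g = to_fract (a * b' + a' * b) / to_fract (b * b')"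
    using lx_nonzero[OF f(1)] lx_nonzero[OF g(1)] unfolding f(3) g(3) by (simp add: field_simps)
  ultimately show ?thesis unfolding PL_def by blast
qed

lemma PL_mult:
  assumes "PL \<mu> c f" "PL \<nu> d g" shows "PL (\<mu> + \<nu>) (c * d) (f * g)"
proof -
  obtain a b \<beta> where f: "lx \<beta> 1 b" "lx (\<mu> + \<beta>) c a" "f = to_fract a / to_fract b" using assms(1) by (auto simp: PL_def)
  obtain a' b' \<beta>' where g: "lx \<beta>' 1 b'" "lx (\<nu> + \<beta>') d a'" "g = to_fract a' / to_fract b'" using assms(2) by (auto simp: PL_def)
  have "lx ((\<mu> + \<nu>) + (\<beta> + \<beta>')) (c * d) (a * a')"
    using lx_mult[OF f(2) g(2)] by (simp add: ac_simps)
  moreover have "lx (\<beta> + \<beta>') 1 (b * b')" using lx_mult[OF f(1) g(1)] by simp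
  moreover have "f * g = to_fract (a * a') / to_fract (b * b')" unfolding f(3) g(3) by simp
  ultimately show ?thesis unfolding PL_def by blast
qed

lemma PL_cst: "PL \<nu> c f \<Longrightarrow> PL \<nu> (d * c) (cst d * f)"
  using PL_mult[OF PL_laurent[of 0 d "single 0 d"], of \<nu> c f] by (simp add: lx_def cst_def)

lemma PL_sum: "(\<And>i. i \<in> A \<Longrightarrow> PL \<nu> (c i) (f i)) \<Longrightarrow> PL \<nu> (sum c A) (sum f A)"
  by (induction A rule: infinite_finite_induct) (auto intro: PL_0 PL_add)

lemma PL_prod: "(\<And>i. i \<in> A \<Longrightarrow> PL (\<nu> i) (c i) (f i)) \<Longrightarrow> PL (sum \<nu> A) (prod c A) (prod f A)"
  by (induction A rule: infinite_finite_induct) (auto intro: PL_1 PL_mult)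

text \<open>The denominator is monic, so the largest exponent of p times b is the sum of the largest
  exponents. The bound on the numerator therefore descends to p.\<close>

lemma PL_laurentD:
  assumes "PL \<nu> c (to_fract p)" shows "lx \<nu> c p"
proof -
  obtain a b \<beta> where f: "lx \<beta> 1 b" "lx (\<nu> + \<beta>) c a" "to_fract p = to_fract a / to_fract b" using assms by (auto simp: PL_def)
  have "to_fract (p * b) = to_fract a" using f(3) lx_nonzero[OF f(1)] by (simp add: field_simps)
  then have a: "a = p * b" by (simp only: to_fract_eq_iff)
  have le: "\<forall>\<kappa>\<in>keys p. \<kappa> \<le> \<nu>"
  proof (cases "p = 0")
    case False
    then have ne: "keys p \<noteq> {}" by (metis keys_zero poly_mapping_eqI in_keys_iff lookup_zero empty_iff)
    let ?m = "Max (keys p)"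
    have m: "?m \<in> keys p" "\<forall>\<kappa>\<in>keys p. \<kappa> \<le> ?m" using ne by auto
    then have "lx ?m (lookup p ?m) p" by (simp add: lx_def)
    then have "lookup (p * b) (?m + \<beta>) = lookup p ?m" using lx_mult[OF _ f(1)] by (fastforce simp: lx_def)
    then have "?m + \<beta> \<in> keys a" using m by (simp add: a in_keys_iff)
    then have "?m + \<beta> \<le> \<nu> + \<beta>" using f(2) unfolding lx_def by blast
    then have "?m \<le> \<nu>" by simp
    then show ?thesis using m by (meson order_trans)
  qed simp
  then have "lx \<nu> (lookup p \<nu>) p" by (simp add: lx_def)
  then have "lx (\<nu> + \<beta>) (lookup p \<nu> * 1) (p * b)" by (rule lx_mult[OF _ f(1)])
  then show ?thesis using f(2) le by (simp add: lx_def a)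
qed

lemma single_less: "i < j \<Longrightarrow> single j (1::int) < single (i::nat) 1"
  unfolding less_poly_mapping.rep_eq less_fun_def
  by (rule exI[of _ i]) (auto simp: lookup_single when_def)

lemma lx_linear:
  assumes "i < j"
  shows "lx (single i 1) c (single (single i 1) c - single (single j 1) d)"
proof -
  have ne: "single j (1::int) \<noteq> single i 1" and lt: "single j (1::int) < single i 1"
    using single_less[OF assms] by auto
  have "keys (single (single i (1::int)) c - single (single j 1) d) \<subseteq> {single i 1, single j 1}"
    by (auto simp: in_keys_iff lookup_minus lookup_single when_def split: if_splits)
  then show ?thesis unfolding lx_def using lt ne by (auto simp: lookup_minus lookup_single when_def)
qed

lemma linear_to_fract: "cst c * xvar i - cst d * xvar j = to_fract (single (single i 1) c - single (single j 1) d)"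
  by (simp add: to_fract_single xvar_xmon)

text \<open>At infinity in the lexicographic order the variable with the smaller index
  dominates.\<close>

lemma PL_rr:
  assumes "i \<noteq> j"
  shows "PL 0 (if i < j then a else b) (rr a b i j)"
proof (cases "i < j")
  case True
  have eq: "rr a b i j = to_fract (single (single i 1) a - single (single j 1) b) / to_fract (single (single i 1) 1 - single (single j 1) 1)"
    unfolding rr_def linear_to_fract[symmetric] by simp
  show ?thesis unfolding PL_def
    using lx_linear[OF True, of 1 1] lx_linear[OF True, of a b] True
    by (intro exI[of _ "single (single i 1) a - single (single j 1) b"] exI[of _ "single (single i 1) 1 - single (single j 1) 1"] exI[of _ "single i 1"])
       (simp add: eq del: to_fract_diff)
next
  case False
  then have ji: "j < i" using assms by simp
  have eq: "rr a b i j = to_fract (single (single j 1) b - single (single i 1) a) / to_fract (single (single j 1) 1 - single (single i 1) 1)"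
    unfolding rr_def linear_to_fract[symmetric] using assms by (simp add: divide_simps) (simp add: algebra_simps)
  show ?thesis unfolding PL_def
    using lx_linear[OF ji, of 1 1] lx_linear[OF ji, of b a] False
    by (intro exI[of _ "single (single j 1) b - single (single i 1) a"] exI[of _ "single (single j 1) 1 - single (single i 1) 1"] exI[of _ "single j 1"])
       (simp add: eq del: to_fract_diff)
qed

lemma PL_inverse_linear:
  assumes "i < j"
  shows "PL (- single i 1) 1 (1 / (xvar i - xvar j) :: 'k::field ratfun)"
proof -
  have "lx (- single i 1 + single i 1) 1 (1 :: 'k laurent)" by (simp add: lx_def)
  moreover have "1 / (xvar i - xvar j) = to_fract 1 / to_fract (single (single i 1) 1 - single (single j 1) (1::'k))"
    using linear_to_fract[of 1 i 1 j] by simp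
  ultimately show ?thesis unfolding PL_def using lx_linear[OF assms, of 1 1] by blast
qed

text \<open>The q-shift of x_k multiplies x^\<nu> by q^{-\<nu>_k}, and the factor
  \<open>rr 1 t k i\<close> contributes t exactly for the k - 1 indices i < k.\<close>

definition macev :: "nat \<Rightarrow> 'k::field \<Rightarrow> 'k \<Rightarrow> (nat \<Rightarrow>\<^sub>0 int) \<Rightarrow> 'k" where
  "macev n q t \<nu> = (\<Sum>k\<in>{1..n}. q powi (- lookup \<nu> k) * t ^ (k - 1))"

lemma qshift_laurent:
  assumes q: "q \<noteq> 0" and p: "lx \<nu> c p"
  shows "PL \<nu> (q powi (- lookup \<nu> k) * c) (qshift q k (to_fract p))"
proof -
  interpret monsub "\<lambda>i. if i = k then inverse q else 1" "\<lambda>x. x" by (rule monsub_qshift[OF q])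
  have cv: "cval (\<lambda>i. if i = k then inverse q else 1) \<kappa> = q powi (- lookup \<kappa> k)" for \<kappa>
  proof -
    have "cval (\<lambda>i. if i = k then inverse q else 1) \<kappa> =
        (\<Prod>i\<in>insert k (keys \<kappa>). (if i = k then inverse q else 1) powi lookup \<kappa> i)"
      by (rule cval_superset) auto
    also have "\<dots> = (\<Prod>i\<in>insert k (keys \<kappa>). if i = k then inverse q powi lookup \<kappa> k else 1)"
      by (intro prod.cong) auto
    also have "\<dots> = q powi (- lookup \<kappa> k)" by (simp add: power_int_minus power_int_inverse)
    finally show ?thesis .
  qed
  have pm: "pmap (\<lambda>x. x) \<kappa> = \<kappa>" for \<kappa>
    by (rule poly_mapping_eqI) (use lookup_pmap'[OF bij_w] in simp)
  let ?h = "\<lambda>\<kappa>. lookup p \<kappa> * q powi (- lookup \<kappa> k)"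
  let ?p = "\<Sum>\<kappa>\<in>keys p. single \<kappa> (?h \<kappa>)"
  have "qshift q k (to_fract p) = to_fract ?p"
    unfolding qshift_def by (subst to_fract_expand)
      (simp add: msub_sum msub_mult msub_xmon cv pm to_fract_single cst_mult mult.assoc)
  moreover have "lx \<nu> (q powi (- lookup \<nu> k) * c) ?p"
  proof -
    have lk: "lookup ?p \<kappa> = ?h \<kappa>" for \<kappa>
    proof -
      have "lookup ?p \<kappa> = (\<Sum>\<kappa>'\<in>keys p. if \<kappa>' = \<kappa> then ?h \<kappa>' else 0)"
        by (simp add: lookup_sum lookup_single when_def)
      also have "\<dots> = ?h \<kappa>" by (simp add: in_keys_iff)
      finally show ?thesis .
    qed
    have "keys ?p \<subseteq> keys p" by (auto simp: in_keys_iff lk simp del: lookup_sum)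
    then show ?thesis using p lk[of \<nu>] unfolding lx_def by (auto simp: mult.commute)
  qed
  ultimately show ?thesis by (simp only: PL_laurent)
qed

lemma macop_leading:
  assumes q: "q \<noteq> 0" and p: "lx \<nu> c p"
  shows "PL \<nu> (macev n q t \<nu> * c) (macop n q t (to_fract p))"
proof -
  have "PL \<nu> (\<Sum>k\<in>{1..n}. (q powi (- lookup \<nu> k) * c) * (\<Prod>i\<in>{1..n} - {k}. if k < i then 1 else t)) (macop n q t (to_fract p))"
    unfolding macop_def
  proof (rule PL_sum)
    fix k
    have "PL (sum (\<lambda>_. 0) ({1..n} - {k})) (\<Prod>i\<in>{1..n} - {k}. if k < i then 1 else t) (\<Prod>i\<in>{1..n} - {k}. rr 1 t k i)"
      by (rule PL_prod, rule PL_rr) auto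
    from PL_mult[OF qshift_laurent[OF q p, of k] this]
    show "PL \<nu> ((q powi (- lookup \<nu> k) * c) * (\<Prod>i\<in>{1..n} - {k}. if k < i then 1 else t))
        (qshift q k (to_fract p) * (\<Prod>i\<in>{1..n} - {k}. rr 1 t k i))" by simp
  qed
  also have "(\<Sum>k\<in>{1..n}. (q powi (- lookup \<nu> k) * c) * (\<Prod>i\<in>{1..n} - {k}. if k < i then 1 else t)) = macev n q t \<nu> * c"
    unfolding macev_def sum_distrib_right
  proof (rule sum.cong)
    fix k assume k: "k \<in> {1..n}"
    have "(\<Prod>i\<in>{1..n} - {k}. if k < i then 1 else t) = (\<Prod>i\<in>{1..<k}. t)"
      using k by (intro prod.mono_neutral_cong_right) auto
    also have "\<dots> = t ^ (k - 1)" by simp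
    finally show "(q powi (- lookup \<nu> k) * c) * (\<Prod>i\<in>{1..n} - {k}. if k < i then 1 else t) = q powi (- lookup \<nu> k) * t ^ (k - 1) * c"
      by simp
  qed simp
  finally show ?thesis .
qed

lemma macop_eigenvalue:
  assumes "q \<noteq> 0" "lx \<nu> c p" "c \<noteq> 0" "macop n q t (to_fract p) = cst e * to_fract p"
  shows "e = macev n q t \<nu>"
proof -
  have "PL \<nu> (macev n q t \<nu> * c) (to_fract (single 0 e * p))"
    using macop_leading[OF assms(1,2), of n t] assms(4) by (simp add: to_fract_single)
  then have "lx \<nu> (macev n q t \<nu> * c) (single 0 e * p)" by (rule PL_laurentD)
  moreover have "lx (0 + \<nu>) (e * c) (single 0 e * p)"
    by (rule lx_mult[OF _ assms(2)]) (simp add: lx_def)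
  ultimately show ?thesis using assms(3) by (simp add: lx_def)
qed

lemma macop_add: "q \<noteq> 0 \<Longrightarrow> macop n q t (f + g) = macop n q t f + macop n q t g"
  unfolding macop_def qshift_def
  by (simp add: monsub.msub_add[OF monsub_qshift] distrib_right sum.distrib)

lemma macop_cst: "q \<noteq> 0 \<Longrightarrow> macop n q t (cst c * f) = cst c * macop n q t f"
  unfolding macop_def qshift_def
  by (simp add: monsub.msub_mult[OF monsub_qshift] monsub.msub_cst[OF monsub_qshift] sum_distrib_left mult.assoc)

text \<open>Subtracting c r removes x^lam but stays in the eigenspace. The largest exponent of a
  nonzero difference would have the same eigenvalue as lam, hence equal lam by separation.\<close>

lemma macop_unique:
  assumes q: "q \<noteq> 0" and sep: "\<And>\<mu> \<nu>. \<mu> \<in> Zn n \<Longrightarrow> \<nu> \<in> Zn n \<Longrightarrow> macev n q t \<mu> = macev n q t \<nu> \<Longrightarrow> \<mu> = \<nu>"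
    and lam: "lam \<in> Zn n"
    and p: "p \<in> laurent_ring n" "PL lam c (to_fract p)" "c \<noteq> 0" "macop n q t (to_fract p) = cst e * to_fract p"
    and r: "r \<in> laurent_ring n" "PL lam 1 (to_fract r)" "macop n q t (to_fract r) = cst e' * to_fract r"
  shows "to_fract p = cst c * to_fract r"
proof -
  have lp: "lx lam c p" and lr: "lx lam 1 r" using p r PL_laurentD by auto
  have e: "e = macev n q t lam" "e' = macev n q t lam"
    using macop_eigenvalue[OF q lp p(3,4)] macop_eigenvalue[OF q lr _ r(3)] by auto
  define g where "g = p + single 0 (- c) * r"
  have g_fract: "to_fract g = to_fract p + cst (- c) * to_fract r" by (simp add: g_def to_fract_single)
  have ev: "macop n q t (to_fract g) = cst e * to_fract g"
    unfolding g_fract macop_add[OF q] macop_cst[OF q] p(4) r(3) e by (simp add: algebra_simps)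
  have "lx (0 + lam) (- c * 1) (single 0 (- c) * r)" by (rule lx_mult[OF _ lr]) (simp add: lx_def)
  then have lg: "lookup g lam = 0" using lp by (simp add: g_def lookup_add lx_def)
  have Zn: "keys g \<subseteq> Zn n"
  proof -
    have "keys (single 0 (- c) * r) \<subseteq> keys r"
    proof
      fix x assume "x \<in> keys (single 0 (- c) * r)"
      then obtain a b where "a \<in> keys (single 0 (- c))" "b \<in> keys r" "x = a + b"
        using keys_mult[of "single 0 (- c)" r] by blast
      then show "x \<in> keys r" by (auto split: if_splits)
    qed
    then show ?thesis using keys_add[of p "single 0 (- c) * r"] p(1) r(1) unfolding g_def laurent_ring_def by blast
  qed
  have "g = 0"
  proof (rule ccontr)
    assume "g \<noteq> 0"
    then have ne: "keys g \<noteq> {}" by (metis poly_mapping_eqI in_keys_iff lookup_zero empty_iff)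
    let ?m = "Max (keys g)"
    have m: "?m \<in> keys g" using ne by simp
    then have "lx ?m (lookup g ?m) g" "lookup g ?m \<noteq> 0" by (auto simp: lx_def in_keys_iff)
    then have "e = macev n q t ?m" using macop_eigenvalue[OF q _ _ ev] by blast
    then have "?m = lam" using sep[of ?m lam] m Zn lam e by auto
    then show False using m lg by (simp add: in_keys_iff)
  qed
  then show ?thesis using g_fract by (simp add: cst_uminus)
qed

section \<open>The bosonic and fermionic polynomials\<close>

lemma PL_monic_perm:
  fixes f :: "'k::field ratfun"
  assumes dom: "\<forall>i\<in>{1..<n}. lookup lam (i + 1) \<le> lookup lam i" and lam: "lam \<in> Zn n"
    and f: "f - xmon lam \<in> lspan (below n lam - {lam})" and w: "w permutes {1..n}"
  shows "PL lam (if pmap w lam = lam then 1 else 0) (perm_act w f)"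
proof -
  let ?U = "{\<kappa>. \<kappa> < lam}"
  have "perm_act w (f - xmon lam) \<in> lspan ?U"
  proof (rule lspan_map[OF f])
    fix \<nu> assume "\<nu> \<in> below n lam - {lam}"
    then have "pmap w \<nu> < lam" using below_dominant_less[OF dom lam _ _ w] by blast
    then show "perm_act w (xmon \<nu>) \<in> lspan ?U" using permutes_bij[OF w] by (simp add: perm_act_hom lspan_xmon)
  qed (use permutes_bij[OF w] in \<open>simp_all add: perm_act_hom\<close>)
  then obtain p where p: "perm_act w (f - xmon lam) = to_fract p" "keys p \<subseteq> ?U" by (auto simp: lspan_def)
  then have "lx lam 0 p" unfolding lx_def by (auto simp: in_keys_iff subset_iff intro: less_imp_le)
  then have 1: "PL lam 0 (perm_act w (f - xmon lam))" unfolding p by (rule PL_laurent)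
  have "pmap w lam \<le> lam" using below_dominant_le[OF dom lam below_refl[OF lam] w] .
  then have "lx lam (if pmap w lam = lam then 1 else 0) (single (pmap w lam) 1 :: 'k laurent)"
    by (auto simp: lx_def lookup_single when_def)
  then have "PL lam (if pmap w lam = lam then 1 else 0) (to_fract (single (pmap w lam) 1 :: 'k laurent))" by (rule PL_laurent)
  then have 2: "PL lam (if pmap w lam = lam then 1 else 0) (perm_act w (xmon lam) :: 'k ratfun)"
    unfolding perm_act_hom(13)[OF permutes_bij[OF w]] unfolding xmon_def .
  have "perm_act w f = perm_act w (f - xmon lam) + perm_act w (xmon lam)"
    using permutes_bij[OF w] by (simp add: perm_act_hom)
  then show ?thesis using PL_add[OF 1 2] by simp
qed

text \<open>The sum of t^{l(w)} over the stabilizer of lam, a pair i < j with w(i) > w(j)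
  contributing t. It will be identified with \<open>Wconst\<close>.\<close>

definition poincare :: "nat \<Rightarrow> 'k::field \<Rightarrow> (nat \<Rightarrow>\<^sub>0 int) \<Rightarrow> 'k" where
  "poincare n t lam = (\<Sum>w | w permutes {1..n}.
     (if pmap w lam = lam then 1 else 0) * (\<Prod>(i, j)\<in>prs 1 n. if w i < w j then 1 else t))"

definition vander :: "nat \<Rightarrow> 'k::field ratfun" where
  "vander n = (\<Prod>(i, j)\<in>prs 1 n. xvar i - xvar j)"

lemma s_vander:
  assumes "1 \<le> i" "i < n" shows "s i (vander n :: 'k::field ratfun) = - vander n"
proof -
  let ?B = "\<Prod>(k, l)\<in>prs 1 n - {(i, Suc i)}. xvar k - xvar l :: 'k ratfun"
  have V: "vander n = (xvar i - xvar (Suc i)) * ?B"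
    unfolding vander_def by (rule prod_prs_remove[OF assms])
  have "s i ?B = (\<Prod>(k, l)\<in>prs 1 n - {(i, Suc i)}. xvar (sref i k) - xvar (sref i l))"
    by (simp add: perm_act_hom split_def)
  also have "\<dots> = ?B" by (rule prod_prs_sref[OF assms, of "\<lambda>k l. xvar k - xvar l"])
  finally have "s i (vander n :: 'k ratfun) = (xvar (Suc i) - xvar i) * ?B"
    unfolding V by (simp add: perm_act_hom(2,4,10))
  then show ?thesis unfolding V by (simp add: algebra_simps)
qed

text \<open>A general transposition is built from adjacent ones by conjugation, each conjugation
  contributing two signs.\<close>

lemma transpose_vander:
  assumes "1 \<le> a" "a < b" "b \<le> n"
  shows "perm_act (transpose a b) (vander n :: 'k::field ratfun) = - vander n"
  using assms(2,3)
proof (induction b)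
  case (Suc b)
  show ?case
  proof (cases "a = b")
    case True
    then show ?thesis using s_vander[of a n] Suc.prems assms(1) by (simp add: sref_def)
  next
    case False
    then have ab: "a < b" using Suc.prems by simp
    have sb: "s b (vander n :: 'k ratfun) = - vander n" using ab Suc.prems by (intro s_vander) auto
    have "transpose a (Suc b) = sref b \<circ> (transpose a b \<circ> sref b)"
      using ab by (auto simp: fun_eq_iff sref_def transpose_def)
    then have "perm_act (transpose a (Suc b)) (vander n :: 'k ratfun) = s b (perm_act (transpose a b) (s b (vander n)))"
      by (simp add: perm_act_comp bij_comp)
    also have "\<dots> = - vander n" using Suc.IH[OF ab] Suc.prems by (simp add: sb perm_act_hom(3))
    finally show ?thesis .
  qed
qed simp

lemma perm_vander:
  assumes "w permutes {1..n}"
  shows "perm_act w (vander n :: 'k::field ratfun) = of_int (sign w) * vander n"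
  using assms finite_atLeastAtMost
proof (induction w rule: permutes_induct)
  case id
  then show ?case by simp
next
  case (swap a b p)
  note perm = \<open>p permutes {1..n}\<close>
  have 1: "perm_act (transpose a b) (vander n :: 'k ratfun) = - vander n"
    using transpose_vander[of a b n] transpose_vander[of b a n] swap(1-3)
    by (cases a b rule: linorder_cases) (auto simp: transpose_commute)
  have 2: "sign (transpose a b \<circ> p) = - sign p"
    using \<open>a \<noteq> b\<close> permutes_imp_permutation[OF finite_atLeastAtMost perm]
    by (simp add: sign_compose sign_swap_id permutation_swap_id)
  have 3: "perm_act (transpose a b) (of_int (sign p) * vander n :: 'k ratfun) = of_int (sign p) * perm_act (transpose a b) (vander n)"
    by (cases p rule: sign_cases) (simp_all add: perm_act_hom(3))
  have 4: "perm_act (transpose a b \<circ> p) (vander n :: 'k ratfun) = perm_act (transpose a b) (perm_act p (vander n))"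
    by (rule perm_act_comp[OF bij_transpose permutes_bij[OF perm], symmetric])
  show ?case unfolding 4 \<open>perm_act p (vander n) = of_int (sign p) * vander n\<close> 3 1 2 by simp
qed

lemma sum_single_rho: "(\<Sum>(i, j)\<in>prs 1 n. single i 1) = rho n"
proof -
  have "prs 1 n = Sigma {1..n} (\<lambda>i. {i<..n})" by (auto simp: prs_def)
  then have "(\<Sum>(i, j)\<in>prs 1 n. single i (1::int)) = (\<Sum>i\<in>{1..n}. \<Sum>j\<in>{i<..n}. single i 1)"
    by (subst sum.Sigma) auto
  also have "\<dots> = rho n"
    unfolding rho_def zvec_def
  proof (rule sum.cong)
    fix i assume i: "i \<in> {1..n}"
    have "(\<Sum>j\<in>J. single i (1::int)) = single i (int (card J))" if "finite J" for J :: "nat set"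
      using that by induction (simp_all add: single_add del: sum_constant)
    from this[of "{i<..n}"] have "(\<Sum>j\<in>{i<..n}. single i (1::int)) = single i (int (card {i<..n}))" by blast
    moreover have "int (card {i<..n}) = int n - int i" using i by (simp add: of_nat_diff)
    ultimately show "(\<Sum>j\<in>{i<..n}. single i 1) = single i (int n - int i)" by (simp only:)
  qed simp
  finally show ?thesis .
qed

lemma PL_inverse_vander: "PL (- rho n) 1 (inverse (vander n) :: 'k::field ratfun)"
proof -
  have "PL (\<Sum>x\<in>prs 1 n. (case x of (i, j) \<Rightarrow> - single i 1)) (\<Prod>x\<in>prs 1 n. 1)
      (\<Prod>x\<in>prs 1 n. (case x of (i, j) \<Rightarrow> 1 / (xvar i - xvar j :: 'k ratfun)))"
    by (rule PL_prod) (auto simp: prs_def intro: PL_inverse_linear)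
  moreover have "(\<Sum>x\<in>prs 1 n. case x of (i, j) \<Rightarrow> - single i (1::int)) = - rho n"
    unfolding sum_single_rho[symmetric] sum_negf[symmetric] by (rule sum.cong) auto
  moreover have "(\<Prod>x\<in>prs 1 n. (case x of (i, j) \<Rightarrow> 1 / (xvar i - xvar j :: 'k ratfun))) = inverse (vander n)"
    unfolding vander_def prod_inversef[symmetric] by (rule prod.cong) (auto simp: divide_inverse)
  ultimately show ?thesis by simp
qed

lemma lspan_s:
  assumes "1 \<le> i" "i < n" "f \<in> lspan (Zn n)" shows "s i f \<in> lspan (Zn n)"
  using assms(3)
proof (rule lspan_map)
  fix \<nu> assume "\<nu> \<in> Zn n"
  then show "s i (xmon \<nu>) \<in> lspan (Zn n)" using assms by (simp add: s_xmon_perm lspan_xmon)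
qed (simp_all add: perm_act_hom)

context hecke
begin

text \<open>Here \<open>RR 1 t i\<close> is T_i + t, which commutes with \<open>C\<close> and
  preserves Laurent polynomials.\<close>

lemma RR_closed_eigen: "RR_closed n 1 t {f \<in> lspan (Zn n). C f = cst c * f}"
proof -
  have R: "RR 1 t i f = T i f + cst t * f" for i f by (simp add: T_RR)
  have "C 0 = 0" using C_cst[of 0 0] by simp
  then show ?thesis
    unfolding RR_closed_def
    by (auto simp: R C_add C_cst C_T T_cst distrib_left mult.left_commute
        intro!: lspan_add lspan_cst T_lspan_Zn)
qed

lemma RR_closed_antisym: "RR_closed n t 1 {f. C (Arho * f) = cst c * (Arho * f)}"
proof -
  have "C 0 = 0" using C_cst[of 0 0] by simp
  moreover have "C (Arho * (cst d * f)) = cst c * (Arho * (cst d * f))" if "C (Arho * f) = cst c * (Arho * f)" for d f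
    using C_cst[of d "Arho * f"] that by (simp add: mult.left_commute)
  moreover have "C (Arho * RR t 1 i f) = cst c * (Arho * RR t 1 i f)"
    if "1 \<le> i" "i < n" "C (Arho * f) = cst c * (Arho * f)" for i f
  proof -
    have "C (Arho * f - T i (Arho * f)) = C (Arho * f) - C (T i (Arho * f))"
      using C_add[of "Arho * f - T i (Arho * f)" "T i (Arho * f)"] by simp
    then show ?thesis unfolding Arho_RR[OF that(1,2)] C_T[OF that(1,2)] that(3) T_cst
      by (simp only: right_diff_distrib)
  qed
  ultimately show ?thesis unfolding RR_closed_def by (auto simp: distrib_left C_add)
qed

text \<open>\<open>RR 1 0 i\<close> is the case \<open>t = 0\<close> of the Demazure--Lusztig operator, a combination of \<open>T i\<close> and \<open>s i\<close>.\<close>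

lemma RR_closed_laurent:
  assumes "t \<noteq> 1"
  shows "RR_closed n 1 0 (lspan (Zn n) :: 'k ratfun set)"
proof -
  have R: "RR 1 0 i f = cst (1 / (1 - t)) * T i f + cst (1 - 1 / (1 - t)) * s i f" for i f
  proof -
    have c: "cst (1 / (1 - t)) * (1 - cst t) = (1 :: 'k ratfun)"
      using assms by (simp add: cst_diff[symmetric] cst_mult[symmetric] flip: cst_1)
    let ?x = "xvar i :: 'k ratfun" and ?y = "xvar (Suc i) :: 'k ratfun"
    have 1: "cst (1 / (1 - t)) * ca ?x ?y = ?x / (?x - ?y)"
      unfolding ca_def times_divide_eq_right mult.assoc[symmetric] c by simp
    have "cb ?x ?y = 1 - ca ?x ?y" using ca_plus_cb[of ?x ?y] by (metis add_diff_cancel_left' n_not_Suc_n xvar_eq_iff)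
    then have 2: "cst (1 / (1 - t)) * cb ?x ?y + cst (1 - 1 / (1 - t)) = 1 - ?x / (?x - ?y)"
      using 1 by (simp add: right_diff_distrib cst_diff)
    have "1 - ?x / (?x - ?y) = ?y / (?y - ?x)" by (simp add: divide_simps) (simp add: algebra_simps)
    then have "RR 1 0 i f = ?x / (?x - ?y) * f + (1 - ?x / (?x - ?y)) * s i f"
      by (simp add: RR_eq rr_def)
    also have "\<dots> = (cst (1 / (1 - t)) * ca ?x ?y) * f + (cst (1 / (1 - t)) * cb ?x ?y + cst (1 - 1 / (1 - t))) * s i f"
      unfolding 1 2 ..
    also have "\<dots> = cst (1 / (1 - t)) * T i f + cst (1 - 1 / (1 - t)) * s i f"
      unfolding T_def by (simp add: distrib_left distrib_right mult.assoc)
    finally show ?thesis .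
  qed
  show ?thesis unfolding RR_closed_def R
    by (auto intro!: lspan_add lspan_cst T_lspan_Zn lspan_s)
qed

end

context macdonald
begin

lemma bosonic_sum_symm: "lam \<in> Zn n \<Longrightarrow> bosonic_sum n q t lam = symm n 1 t 1 (elecZ lam)"
  unfolding bosonic_sum_def symm_def prs_index_pairs rr_def by (simp add: electronic_elecZ)

lemma bosonic_sum_eigen:
  assumes "lam \<in> Zn n"
  obtains p e where "p \<in> laurent_ring n" "bosonic_sum n q t lam = to_fract p"
    "macop n q t (to_fract p) = cst e * to_fract p"
proof -
  let ?B = "symm n 1 t 1 (elecZ lam)"
  obtain c where c: "C (elecZ lam) = cst c * elecZ lam" by (rule elecZ_eigen[OF assms])
  have "?B \<in> {f \<in> lspan (Zn n). C f = cst c * f}"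
    by (rule symm_closed[OF RR_closed_eigen]) (use c elecZ_lspan[OF assms] in auto)
  then have B: "?B \<in> lspan (Zn n)" "C ?B = cst c * ?B" by auto
  have "C ?B = cst (inverse t ^ (n - 1)) * macop n q t ?B"
    by (rule C_sym) (rule symm_sym)
  then have "cst (t ^ (n - 1)) * (cst (inverse t ^ (n - 1)) * macop n q t ?B) = cst (t ^ (n - 1)) * (cst c * ?B)"
    using B(2) by simp
  then have ev: "macop n q t ?B = cst (t ^ (n - 1) * c) * ?B"
    by (simp add: cst_mult[symmetric] mult.assoc[symmetric] power_mult_distrib[symmetric])
  obtain p where "?B = to_fract p" "keys p \<subseteq> Zn n" using B(1) by (auto simp: lspan_def)
  then show thesis
    using ev bosonic_sum_symm[OF assms] by (intro that[of p "t ^ (n - 1) * c"]) (simp_all add: laurent_ring_def)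
qed

lemma bosonic_sum_leading:
  assumes lam: "lam \<in> Zn n" and dom: "\<forall>i\<in>{1..<n}. lookup lam (i + 1) \<le> lookup lam i"
  shows "PL lam (poincare n t lam) (bosonic_sum n q t lam)"
  unfolding bosonic_sum_symm[OF lam] symm_def poincare_def
proof (rule PL_sum)
  fix w assume "w \<in> {w. w permutes {1..n}}"
  then have w: "w permutes {1..n}" by simp
  have f: "elecZ lam - xmon lam \<in> lspan (below n lam - {lam})"
    using elecZ_monic[OF lam] by (simp add: monic_at_def)
  have ne: "w i \<noteq> w j" if "i \<noteq> j" for i j using permutes_inj[OF w] that by (simp add: inj_eq)
  have "PL (\<Sum>x\<in>prs 1 n. 0) (\<Prod>x\<in>prs 1 n. (case x of (i, j) \<Rightarrow> if w i < w j then 1 else t))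
      (\<Prod>x\<in>prs 1 n. (case x of (i, j) \<Rightarrow> rr 1 t (w i) (w j)))"
  proof (rule PL_prod)
    fix x assume "x \<in> prs 1 n"
    then obtain i j where "x = (i, j)" "i \<noteq> j" by (auto simp: prs_def)
    show "PL 0 (case x of (i, j) \<Rightarrow> if w i < w j then 1 else t) (case x of (i, j) \<Rightarrow> rr 1 t (w i) (w j))"
      unfolding \<open>x = (i, j)\<close> prod.case by (rule PL_rr[OF ne[OF \<open>i \<noteq> j\<close>]])
  qed
  moreover have "perm_act w (\<Prod>(i, j)\<in>prs 1 n. rr 1 t i j) = (\<Prod>x\<in>prs 1 n. (case x of (i, j) \<Rightarrow> rr 1 t (w i) (w j)))"
    using permutes_bij[OF w] by (simp add: perm_act_hom perm_act_rr split_def)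
  ultimately have "PL 0 (\<Prod>(i, j)\<in>prs 1 n. if w i < w j then 1 else t) (perm_act w (\<Prod>(i, j)\<in>prs 1 n. rr 1 t i j))"
    by simp
  from PL_mult[OF PL_monic_perm[OF dom lam f w] this]
  show "PL lam ((if pmap w lam = lam then 1 else 0) * (\<Prod>(i, j)\<in>prs 1 n. if w i < w j then 1 else t))
      (perm_act w (elecZ lam * (\<Prod>(i, j)\<in>prs 1 n. rr 1 t i j)))"
    using permutes_bij[OF w] by (simp add: perm_act_hom(2))
qed

text \<open>The quotient of the fermionic polynomial by A_rho, written as a plain symmetrization:
  dividing by the Vandermonde product inside the sum absorbs the signs.\<close>

definition antisymm :: "(nat \<Rightarrow>\<^sub>0 int) \<Rightarrow> 'a ratfun" where
  "antisymm \<mu> = (\<Sum>w | w permutes {1..n}. perm_act w (elecZ \<mu> * inverse (vander n)))"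

lemma antisymm_sign:
  "antisymm \<mu> = inverse (vander n) * (\<Sum>w | w permutes {1..n}. of_int (sign w) * perm_act w (elecZ \<mu>))"
  unfolding antisymm_def sum_distrib_left
proof (rule sum.cong)
  fix w assume "w \<in> {w. w permutes {1..n}}"
  then have w: "w permutes {1..n}" by simp
  have "inverse (of_int (sign w)) = (of_int (sign w) :: 'a ratfun)"
    by (cases w rule: sign_cases) simp_all
  then show "perm_act w (elecZ \<mu> * inverse (vander n)) = inverse (vander n) * (of_int (sign w) * perm_act w (elecZ \<mu>))"
    using permutes_bij[OF w] by (simp add: perm_act_hom(2,6) perm_vander[OF w] inverse_mult_distrib mult_ac)
qed simp

lemma fermionic_antisymm: "\<mu> \<in> Zn n \<Longrightarrow> fermionic n q t \<mu> / A_rho n t = antisymm \<mu>"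
proof -
  assume \<mu>: "\<mu> \<in> Zn n"
  have "(\<Prod>(i, j)\<in>index_pairs n. (xvar j - cst t * xvar i) / (xvar i - xvar j)) = Arho / vander n"
    unfolding Arho_def vander_def prs_index_pairs by (simp add: split_def prod_dividef)
  then have "fermionic n q t \<mu> = Arho * antisymm \<mu>"
    unfolding fermionic_def antisymm_sign using \<mu> by (simp add: electronic_elecZ divide_inverse mult.assoc)
  then show ?thesis by (simp add: Arho_A_rho Arho_nonzero)
qed

lemma antisymm_sym: "w permutes {1..n} \<Longrightarrow> perm_act w (antisymm \<mu>) = antisymm \<mu>"
  unfolding antisymm_def by (rule perm_act_sum_permutations)

text \<open>The product of the factors \<open>rr t 1\<close> is A_rho over the Vandermonde product,
  with one sign for each pair. So \<open>antisymm\<close> is, up to sign, the (t, 1)-symmetrization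
  of E_\<mu> / A_rho, and \<open>Arho\<close> times it inherits the eigenvalue of E_\<mu>.\<close>

lemma antisymm_eigen:
  assumes "\<mu> \<in> Zn n"
  obtains e where "macop n q (q * t) (antisymm \<mu>) = cst e * antisymm \<mu>"
proof -
  obtain c where c: "C (elecZ \<mu>) = cst c * elecZ \<mu>" by (rule elecZ_eigen[OF assms])
  define N where "N = card (prs 1 n)"
  let ?V = "{f. C (Arho * f) = cst c * (Arho * f)}"
  have "(\<Prod>(i, j)\<in>prs 1 n. rr t 1 i j) = (\<Prod>x\<in>prs 1 n. (- 1) * (case x of (i, j) \<Rightarrow> (xvar j - cst t * xvar i) / (xvar i - xvar j)))"
    by (rule prod.cong) (auto simp: rr_def minus_divide_left)
  also have "\<dots> = (- 1) ^ N * (Arho / vander n)"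
    unfolding prod.distrib Arho_def vander_def by (simp add: N_def split_def prod_dividef)
  finally have "elecZ \<mu> / Arho * (\<Prod>(i, j)\<in>prs 1 n. rr t 1 i j) = cst ((- 1) ^ N) * (elecZ \<mu> * inverse (vander n))"
    by (simp add: Arho_nonzero cst_power cst_uminus divide_inverse)
  then have "symm n t 1 1 (elecZ \<mu> / Arho) = cst ((- 1) ^ N) * antisymm \<mu>"
    unfolding symm_def antisymm_def sum_distrib_left
    by (intro sum.cong) (simp_all add: perm_act_hom(2,9) permutes_bij)
  moreover have "symm n t 1 1 (elecZ \<mu> / Arho) \<in> ?V" (is "?S \<in> _")
    by (rule symm_closed[OF RR_closed_antisym]) (use c in \<open>auto simp: Arho_nonzero\<close>)
  moreover have "cst d * f \<in> ?V" if "f \<in> ?V" for d f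
    using RR_closed_antisym[of c] that unfolding RR_closed_def by blast
  ultimately have "cst ((- 1) ^ N) * (cst ((- 1) ^ N) * antisymm \<mu>) \<in> ?V" by (simp only:)
  moreover have "cst ((- 1) ^ N) * (cst ((- 1) ^ N) * antisymm \<mu>) = antisymm \<mu>"
    by (simp flip: cst_mult mult.assoc power_mult_distrib)
  ultimately have "C (Arho * antisymm \<mu>) = cst c * (Arho * antisymm \<mu>)" by simp
  moreover have "C (Arho * antisymm \<mu>) = Arho * (cst ((inverse t * inverse q) ^ (n - 1)) * macop n q (q * t) (antisymm \<mu>))"
    by (rule C_antisym) (rule antisymm_sym)
  ultimately have "Arho * (cst ((inverse t * inverse q) ^ (n - 1)) * macop n q (q * t) (antisymm \<mu>)) = Arho * (cst c * antisymm \<mu>)"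
    by (simp add: mult.left_commute)
  then have "cst ((inverse t * inverse q) ^ (n - 1)) * macop n q (q * t) (antisymm \<mu>) = cst c * antisymm \<mu>"
    using Arho_nonzero by simp
  then have "cst ((t * q) ^ (n - 1)) * (cst ((inverse t * inverse q) ^ (n - 1)) * macop n q (q * t) (antisymm \<mu>)) = cst ((t * q) ^ (n - 1)) * (cst c * antisymm \<mu>)"
    by simp
  then have "macop n q (q * t) (antisymm \<mu>) = cst ((t * q) ^ (n - 1) * c) * antisymm \<mu>"
    by (simp add: cst_mult[symmetric] mult.assoc[symmetric] power_mult_distrib[symmetric] mult.commute mult.left_commute)
  then show thesis by (rule that)
qed

lemma prod_xvar_rho: "(\<Prod>(i, j)\<in>prs 1 n. xvar i) = xmon (rho n)"
  unfolding sum_single_rho[symmetric] xmon_sum xvar_xmon by (rule prod.cong) auto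

lemma rho_in_Zn [simp]: "rho n \<in> Zn n" by (simp add: rho_def)

lemma Zn_uminus: "\<mu> \<in> Zn n \<Longrightarrow> - \<mu> \<in> Zn n" by (simp add: Zn_iff)

text \<open>Replaces a divisibility argument: for (a, b) = (1, 0) the product of all factors is
  x^rho over the Vandermonde product, so \<open>antisymm\<close> is a (1, 0)-symmetrization of the
  Laurent polynomial x^{-rho} E_\<mu>.\<close>

lemma antisymm_laurent:
  assumes "\<mu> \<in> Zn n" "t \<noteq> 1"
  obtains p where "p \<in> laurent_ring n" "antisymm \<mu> = to_fract p"
proof -
  have "(\<Prod>(i, j)\<in>prs 1 n. rr 1 0 i j) = (\<Prod>(i, j)\<in>prs 1 n. xvar i) / (vander n :: 'a ratfun)"
    unfolding vander_def rr_def by (simp add: split_def prod_dividef)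
  then have "(\<Prod>(i, j)\<in>prs 1 n. rr 1 0 i j) = xmon (rho n) * inverse (vander n :: 'a ratfun)"
    by (simp only: prod_xvar_rho divide_inverse)
  then have E: "xmon (- rho n) * elecZ \<mu> * (\<Prod>(i, j)\<in>prs 1 n. rr 1 0 i j) = elecZ \<mu> * inverse (vander n)"
    by (simp add: xmon_uminus)
  have "antisymm \<mu> = symm n 1 0 1 (xmon (- rho n) * elecZ \<mu>)"
    unfolding antisymm_def symm_def E ..
  moreover have "xmon (- rho n) * elecZ \<mu> \<in> lspan (Zn n)"
    by (rule lspan_xmon_mult[OF elecZ_lspan[OF assms(1)]]) (rule Zn_add[OF Zn_uminus[OF rho_in_Zn]])
  then have "symm n 1 0 1 (xmon (- rho n) * elecZ \<mu>) \<in> lspan (Zn n)"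
    by (rule symm_closed[OF RR_closed_laurent[OF assms(2)]]) auto
  ultimately show thesis using that by (auto simp: lspan_def laurent_ring_def)
qed

lemma antisymm_leading:
  assumes lam: "lam \<in> Zn n" and dom: "\<forall>i\<in>{1..<n}. lookup lam (i + 1) \<le> lookup lam i"
  shows "PL lam 1 (antisymm (lam + rho n))"
proof -
  let ?\<mu> = "lam + rho n"
  have \<mu>: "?\<mu> \<in> Zn n" by (simp add: Zn_add lam)
  have lk: "lookup ?\<mu> i = lookup lam i + int n - int i" if "i \<in> {1..n}" for i
    using that by (simp add: lookup_add rho_def lookup_zvec)
  have strict: "lookup ?\<mu> j < lookup ?\<mu> i" if "1 \<le> i" "i < j" "j \<le> n" for i j
    using dominant_mono[OF dom, of i j] that by (simp add: lk)
  then have dom\<mu>: "\<forall>i\<in>{1..<n}. lookup ?\<mu> (i + 1) \<le> lookup ?\<mu> i" by (simp add: less_imp_le)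
  \<comment> \<open>The entries of lam + rho are strictly decreasing, so only the identity
    contributes to the leading coefficient.\<close>
  have stab: "w = id" if w: "w permutes {1..n}" and eq: "pmap w ?\<mu> = ?\<mu>" for w
  proof
    fix j show "w j = id j"
    proof (cases "j \<in> {1..n}")
      case True
      then have wj: "w j \<in> {1..n}" using permutes_in_image[OF w] by simp
      have "lookup ?\<mu> (w j) = lookup ?\<mu> j"
        using lookup_pmap'[OF permutes_bij[OF w], of ?\<mu> j] eq by simp
      then show ?thesis using strict[of "w j" j] strict[of j "w j"] True wj
        by (cases "w j" j rule: linorder_cases) auto
    next
      case False
      then show ?thesis using w by (simp add: permutes_def)
    qed
  qed
  have idp: "pmap id ?\<mu> = ?\<mu>" using lookup_pmap'[of id ?\<mu>] by (intro poly_mapping_eqI) simp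
  have f: "elecZ ?\<mu> - xmon ?\<mu> \<in> lspan (below n ?\<mu> - {?\<mu>})"
    using elecZ_monic[OF \<mu>] by (simp add: monic_at_def)
  have "PL ?\<mu> (\<Sum>w | w permutes {1..n}. of_int (sign w) * (if pmap w ?\<mu> = ?\<mu> then 1 else 0))
      (\<Sum>w | w permutes {1..n}. of_int (sign w) * perm_act w (elecZ ?\<mu>))"
  proof (rule PL_sum)
    fix w assume "w \<in> {w. w permutes {1..n}}"
    then have w: "w permutes {1..n}" by simp
    have "of_int (sign w) = (cst (of_int (sign w)) :: 'a ratfun)"
      by (cases w rule: sign_cases) (simp_all add: cst_uminus)
    then show "PL ?\<mu> (of_int (sign w) * (if pmap w ?\<mu> = ?\<mu> then 1 else 0)) (of_int (sign w) * perm_act w (elecZ ?\<mu>))"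
      using PL_cst[OF PL_monic_perm[OF dom\<mu> \<mu> f w]] by metis
  qed
  also have "(\<Sum>w | w permutes {1..n}. of_int (sign w) * (if pmap w ?\<mu> = ?\<mu> then 1 else 0)) = (\<Sum>w | w permutes {1..n}. if w = id then 1 else (0 :: 'a))"
    using stab idp by (intro sum.cong) auto
  also have "\<dots> = 1" by (simp add: permutes_id finite_permutations)
  finally have "PL (- rho n + ?\<mu>) (1 * 1) (antisymm ?\<mu>)"
    unfolding antisymm_sign by (rule PL_mult[OF PL_inverse_vander])
  then show ?thesis by simp
qed

end

section \<open>The character formula for arbitrary generic parameters\<close>

lemma weyl_character:
  fixes q t :: "'k::field"
  assumes M: "macdonald n q t" and M': "macdonald n q (q * t)" and t1: "t \<noteq> 1"
    and sep: "\<And>\<mu> \<nu>. \<mu> \<in> Zn n \<Longrightarrow> \<nu> \<in> Zn n \<Longrightarrow> macev n q (q * t) \<mu> = macev n q (q * t) \<nu> \<Longrightarrow> \<mu> = \<nu>"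
    and poincare: "poincare n (q * t) lam \<noteq> 0"
    and lam: "lam \<in> Zn n" and dom: "\<forall>i\<in>{1..<n}. lookup lam (i + 1) \<le> lookup lam i"
  shows "bosonic n q (q * t) lam = fermionic n q t (lam + rho n) / A_rho n t"
proof -
  interpret M: macdonald n q t by fact
  interpret M': macdonald n q "q * t" by fact
  let ?\<mu> = "lam + rho n" and ?W = "poincare n (q * t) lam"
  have \<mu>: "?\<mu> \<in> Zn n" by (simp add: Zn_add lam rho_def)
  obtain p e where p: "p \<in> laurent_ring n" "bosonic_sum n q (q * t) lam = to_fract p"
    "macop n q (q * t) (to_fract p) = cst e * to_fract p" by (rule M'.bosonic_sum_eigen[OF lam])
  obtain r where r: "r \<in> laurent_ring n" "M.antisymm ?\<mu> = to_fract r" by (rule M.antisymm_laurent[OF \<mu> t1])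
  obtain e' where e': "macop n q (q * t) (to_fract r) = cst e' * to_fract r"
    using M.antisymm_eigen[OF \<mu>] unfolding r(2) .
  have Pr: "PL lam 1 (to_fract r)" using M.antisymm_leading[OF lam dom] unfolding r(2) .
  then have r1: "lookup r lam = 1" using PL_laurentD by (auto simp: lx_def)
  have Pp: "PL lam ?W (to_fract p)" using M'.bosonic_sum_leading[OF lam dom] unfolding p(2) .
  have pr: "to_fract p = cst ?W * to_fract r"
    by (rule macop_unique[OF M.q_nonzero sep lam p(1) Pp poincare p(3) r(1) Pr e'])
  have "Wconst n q (q * t) lam = ?W"
    unfolding Wconst_def
  proof (rule the_equality)
    show "\<exists>p\<in>laurent_ring n. to_fract p = bosonic_sum n q (q * t) lam / cst ?W \<and> lookup p lam = 1"
      using r(1) r1 poincare unfolding p(2) pr by (intro bexI[of _ r]) simp_all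
  next
    fix c assume "\<exists>p\<in>laurent_ring n. to_fract p = bosonic_sum n q (q * t) lam / cst c \<and> lookup p lam = 1"
    then obtain p' where p': "to_fract p' = bosonic_sum n q (q * t) lam / cst c" "lookup p' lam = 1" by blast
    have "to_fract p' = to_fract (single 0 (?W / c) * r)"
      unfolding p'(1) p(2) pr by (simp add: to_fract_single cst_divide)
    then have "p' = single 0 (?W / c) * r" by (simp only: to_fract_eq_iff)
    moreover have "lx (0 + lam) (?W / c * 1) (single 0 (?W / c) * r)"
      by (rule lx_mult[OF _ PL_laurentD[OF Pr]]) (simp add: lx_def)
    ultimately have "?W / c = 1" using p'(2) by (simp add: lx_def)
    \<comment> \<open>The value c = 0 is excluded here as well, since division by 0 gives 0 and not
      1.\<close>
    then show "c = ?W" by (metis divide_eq_1_iff)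
  qed
  then have "bosonic n q (q * t) lam = to_fract r"
    unfolding bosonic_def p(2) pr using poincare by simp
  then show ?thesis using M.fermionic_antisymm[OF \<mu>] r(2) by simp
qed

section \<open>The ground field\<close>

definition qP :: "complex poly poly" where "qP = [:[:0, 1:]:]"
definition tP :: "complex poly poly" where "tP = [:0, 1:] ^ 2"

lemma to_fract_power: "to_fract (x ^ m) = to_fract x ^ m"
  by (induction m) simp_all

lemma to_fract_prod: "to_fract (prod f A) = (\<Prod>i\<in>A. to_fract (f i))"
  by (induction A rule: infinite_finite_induct) simp_all

lemma qK_qP: "qK = to_fract qP" by (simp add: qK_def qP_def)
lemma tK_tP: "tK = to_fract tP" by (simp add: tK_def thalfK_def tP_def to_fract_power)

lemma qK_nonzero: "qK \<noteq> 0" by (simp add: qK_qP qP_def)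
lemma tK_nonzero: "tK \<noteq> 0" by (simp add: tK_tP tP_def)

text \<open>Evaluation at t^{1/2} = 0 makes the left-hand side vanish.\<close>

lemma K_generic:
  assumes "k > 0" shows "qK ^ m * tK ^ k \<noteq> 1"
proof
  assume "qK ^ m * tK ^ k = 1"
  then have "to_fract (qP ^ m * tP ^ k) = to_fract 1" by (simp add: qK_qP tK_tP to_fract_power)
  then have "qP ^ m * tP ^ k = 1" by (simp only: to_fract_eq_iff)
  then have "poly (qP ^ m * tP ^ k) 0 = 1" by simp
  then show False using assms by (simp add: tP_def zero_power)
qed

lemma macdonald_K: "n \<ge> 1 \<Longrightarrow> macdonald n qK tK"
  by standard (use qK_nonzero tK_nonzero K_generic in auto)

lemma macdonald_K': "n \<ge> 1 \<Longrightarrow> macdonald n qK (qK * tK)"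
proof
  fix m k :: nat assume "m > 0" "k > 0"
  have "qK ^ m * (qK * tK) ^ k = qK ^ (m + k) * tK ^ k" by (simp add: power_mult_distrib power_add)
  then show "qK ^ m * (qK * tK) ^ k \<noteq> 1" using K_generic[OF \<open>k > 0\<close>] by simp
qed (use qK_nonzero tK_nonzero in auto)

lemma tK_neq_1: "tK \<noteq> 1" using K_generic[of 1 0] by simp

text \<open>At \<open>q = t = 1\<close> the Poincare polynomial is the order of the stabilizer.\<close>

lemma poincare_K: "poincare n (qK * tK) lam \<noteq> 0"
proof -
  let ?P = "\<Sum>w | w permutes {1..n}. (if pmap w lam = lam then 1 else 0) * (\<Prod>(i, j)\<in>prs 1 n. if w i < w j then 1 else qP * tP)"
  have "poincare n (qK * tK) lam = to_fract ?P"
    unfolding poincare_def to_fract_sum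
    by (intro sum.cong refl) (simp add: to_fract_prod split_def qK_qP tK_tP if_distrib[of to_fract] cong: if_cong)
  moreover have "?P \<noteq> 0"
  proof
    assume "?P = 0"
    then have eval: "poly (poly ?P 1) 1 = 0" by simp
    let ?G = "{w. w permutes {1..n} \<and> pmap w lam = lam}"
    have "poly (poly ?P 1) 1 = (\<Sum>w | w permutes {1..n}. if pmap w lam = lam then 1 else 0)"
      unfolding poly_sum
    proof (rule sum.cong)
      fix w :: "nat \<Rightarrow> nat"
      have "poly (poly (if w i < w j then 1 else qP * tP) 1) 1 = 1" for i j
        by (simp add: qP_def tP_def)
      then show "poly (poly ((if pmap w lam = lam then 1 else 0) * (\<Prod>(i, j)\<in>prs 1 n. if w i < w j then 1 else qP * tP)) 1) 1
          = (if pmap w lam = lam then 1 else 0)"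
        by (simp add: poly_prod split_def)
    qed simp
    also have "\<dots> = of_nat (card ?G)"
      by (simp add: sum.If_cases finite_permutations Int_def)
    finally have "of_nat (card ?G) = (0 :: complex)" using eval by simp
    then have "card ?G = 0" by (simp only: of_nat_eq_0_iff)
    moreover have "finite ?G"
      by (rule finite_subset[OF _ finite_permutations[of "{1..n}"]]) auto
    moreover have "id \<in> ?G"
      using lookup_pmap'[of id lam] by (auto simp: permutes_id intro!: poly_mapping_eqI)
    ultimately show False by (simp only: card_0_eq) blast
  qed
  ultimately show ?thesis by (simp only: to_fract_eq_0_iff not_False_eq_True)
qed

lemma qP_tP_monom: "qP ^ a * tP ^ k = monom (monom 1 a) (2 * k)"
proof -
  have "qP ^ a = monom (monom 1 a) 0"
    by (induction a) (simp_all add: qP_def monom_0 monom_Suc one_pCons)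
  moreover have "tP ^ k = monom 1 (2 * k)"
    unfolding tP_def power_mult[symmetric] by (simp add: monom_altdef)
  ultimately show ?thesis by (simp add: mult_monom)
qed

text \<open>The k-th term carries t^{k-1}, that is, the power 2(k - 1) of t^{1/2}, so the terms do
  not mix. After clearing negative powers by q^N, the exponent of q in each coefficient recovers the
  entry at k; the extra q^{k-1} coming from q t is the same on both sides.\<close>

lemma macev_K:
  assumes "\<mu> \<in> Zn n" "\<nu> \<in> Zn n" and eq: "macev n qK (qK * tK) \<mu> = macev n qK (qK * tK) \<nu>"
  shows "\<mu> = \<nu>"
proof -
  define N where "N = (\<Sum>k\<in>{1..n}. nat \<bar>lookup \<mu> k\<bar> + nat \<bar>lookup \<nu> k\<bar>)"
  have N: "lookup \<mu> k \<le> int N" "lookup \<nu> k \<le> int N" if "k \<in> {1..n}" for k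
  proof -
    have "nat \<bar>lookup \<mu> k\<bar> + nat \<bar>lookup \<nu> k\<bar> \<le> N"
      unfolding N_def using that by (rule member_le_sum) auto
    then show "lookup \<mu> k \<le> int N" "lookup \<nu> k \<le> int N" by linarith+
  qed
  have expand: "qK ^ N * macev n qK (qK * tK) \<kappa> =
      to_fract (\<Sum>k\<in>{1..n}. monom (monom 1 (nat (int N - lookup \<kappa> k) + (k - 1))) (2 * (k - 1)))"
    if "\<And>k. k \<in> {1..n} \<Longrightarrow> lookup \<kappa> k \<le> int N" for \<kappa>
    unfolding macev_def sum_distrib_left to_fract_sum
  proof (rule sum.cong)
    fix k assume k: "k \<in> {1..n}"
    have "qK ^ N * qK powi (- lookup \<kappa> k) = qK powi (int N + - lookup \<kappa> k)"
      using qK_nonzero by (simp only: power_int_add power_int_of_nat simp_thms)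
    also have "\<dots> = qK ^ nat (int N - lookup \<kappa> k)" using that[OF k] by (simp add: power_int_def)
    finally have "qK ^ N * (qK powi (- lookup \<kappa> k) * (qK * tK) ^ (k - 1)) =
        qK ^ (nat (int N - lookup \<kappa> k) + (k - 1)) * tK ^ (k - 1)"
      by (simp add: power_add power_mult_distrib mult.assoc[symmetric])
    then show "qK ^ N * (qK powi (- lookup \<kappa> k) * (qK * tK) ^ (k - 1)) =
        to_fract (monom (monom 1 (nat (int N - lookup \<kappa> k) + (k - 1))) (2 * (k - 1)))"
      by (simp add: qP_tP_monom[symmetric] qK_qP tK_tP to_fract_power)
  qed simp
  let ?S = "\<lambda>\<kappa>. \<Sum>k\<in>{1..n}. monom (monom (1::complex) (nat (int N - lookup \<kappa> k) + (k - 1))) (2 * (k - 1))"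
  have "to_fract (?S \<mu>) = to_fract (?S \<nu>)"
    using expand[of \<mu>] expand[of \<nu>] N eq by simp
  then have S: "?S \<mu> = ?S \<nu>" by (simp only: to_fract_eq_iff)
  have coeff: "coeff (?S \<kappa>) (2 * (k - 1)) = monom 1 (nat (int N - lookup \<kappa> k) + (k - 1))" if "k \<in> {1..n}" for k \<kappa>
  proof -
    have "coeff (?S \<kappa>) (2 * (k - 1)) = (\<Sum>k'\<in>{1..n}. if k' = k then monom 1 (nat (int N - lookup \<kappa> k') + (k' - 1)) else 0)"
      unfolding coeff_sum using that by (intro sum.cong) auto
    then show ?thesis using that by simp
  qed
  show ?thesis
  proof (rule Zn_eqI[OF assms(1,2)])
    fix k assume "1 \<le> k" "k \<le> n"
    then have k: "k \<in> {1..n}" by simp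
    have "monom (1::complex) (nat (int N - lookup \<mu> k) + (k - 1)) = monom 1 (nat (int N - lookup \<nu> k) + (k - 1))"
      using coeff[OF k, of \<mu>] coeff[OF k, of \<nu>] S by simp
    then have "nat (int N - lookup \<mu> k) = nat (int N - lookup \<nu> k)"
      using degree_monom_eq[of "1::complex"] by (metis add_right_cancel zero_neq_one)
    then show "lookup \<mu> k = lookup \<nu> k" using N[OF k] by linarith
  qed
qed

theorem theorem6p5:
  fixes n :: nat and lam :: "nat \<Rightarrow>\<^sub>0 int"
  assumes "n \<ge> 1"
    and "lam \<in> Zn n"
    and "\<forall>i\<in>{1..<n}. Poly_Mapping.lookup lam i \<ge> Poly_Mapping.lookup lam (i + 1)"
  shows "bosonic n qK (qK * tK) lam = fermionic n qK tK (lam + rho n) / A_rho n tK"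
  by (rule weyl_character[OF macdonald_K[OF assms(1)] macdonald_K'[OF assms(1)] tK_neq_1 macev_K poincare_K assms(2,3)])

end
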